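(* Let $p\in H^\infty\cap C(\overline{\mathbb D})$. Then the Toeplitz operator $T_{\overline{z}+p}$ is invertible on the Bergman space $L^2_a$ if and only if the following two conditions hold: (i) $1+zp(z)$ has no zeros on the unit circle $\partial\mathbb D$; (ii) $1+zp(z)$ has exactly one zero $z_0$ in the open disk $\mathbb D$, this zero is simple, and $$z_0^2p'(z_0)-\frac{n+2}{n+1}\neq 0$$ for every nonnegative integer $n$.
   Context: $\mathbb D$ is the open unit disk, $dA$ normalized area measure on $\mathbb D$, $L^2_a$ the Bergman space of analytic functions in $L^2(\mathbb D,dA)$, $P$ the orthogonal projection of $L^2(\mathbb D,dA)$ onto $L^2_a$, and for $\varphi\in L^\infty(\mathbb D)$ the Toeplitz operator is $T_\varphi f=P(\varphi f)$ for $f\in L^2_a$. $H^\infty\cap C(\overline{\mathbb D})$ is the disk algebra. *)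

theory Defs
  imports "HOL-Analysis.Analysis"
begin

text \<open>Functions on the open unit disk are represented as total functions
  complex \<Rightarrow> complex; only their values on the disk matter.
  Normalized area measure: dA = (1/pi) d(Lebesgue).\<close>

definition disk :: "complex set" where
  "disk = ball 0 1"

definition bergman :: "(complex \<Rightarrow> complex) set" where
  "bergman = {f. f holomorphic_on disk \<and>
       set_integrable lborel disk (\<lambda>z. (cmod (f z))\<^sup>2)}"

definition L2_inner :: "(complex \<Rightarrow> complex) \<Rightarrow> (complex \<Rightarrow> complex) \<Rightarrow> complex" where
  "L2_inner f g = complex_of_real (1 / pi) * (LINT z : disk | lborel. f z * cnj (g z))"

definition L2_norm_disk :: "(complex \<Rightarrow> complex) \<Rightarrow> real" where
  "L2_norm_disk f = sqrt ((1 / pi) * (LINT z : disk | lborel. (cmod (f z))\<^sup>2))"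

definition is_bergman_proj :: "(complex \<Rightarrow> complex) \<Rightarrow> (complex \<Rightarrow> complex) \<Rightarrow> bool" where
  "is_bergman_proj g h \<longleftrightarrow> h \<in> bergman \<and>
     (\<forall>k\<in>bergman. L2_inner (\<lambda>z. g z - h z) k = 0)"

definition is_toeplitz_image ::
  "(complex \<Rightarrow> complex) \<Rightarrow> (complex \<Rightarrow> complex) \<Rightarrow> (complex \<Rightarrow> complex) \<Rightarrow> bool" where
  "is_toeplitz_image \<phi> f h \<longleftrightarrow> is_bergman_proj (\<lambda>z. \<phi> z * f z) h"

text \<open>T_phi is invertible on L^2_a: it is onto L^2_a and has a bounded
  inverse, i.e. ||f|| \<le> C ||T_phi f|| for all f in L^2_a (this also gives
  injectivity, modulo equality on the disk).\<close>
definition toeplitz_invertible :: "(complex \<Rightarrow> complex) \<Rightarrow> bool" where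
  "toeplitz_invertible \<phi> \<longleftrightarrow>
     (\<forall>g\<in>bergman. \<exists>f\<in>bergman. is_toeplitz_image \<phi> f g) \<and>
     (\<exists>C. \<forall>f\<in>bergman. \<forall>h. is_toeplitz_image \<phi> f h \<longrightarrow>
          L2_norm_disk f \<le> C * L2_norm_disk h)"

end

theory Submission
  imports Defs "HOL-Complex_Analysis.Complex_Analysis"
begin

text \<open>Every \<open>f\<close> in the Bergman space is \<open>(z G)'\<close> for a unique \<open>G\<close> in the Dirichlet space, and on Taylor
  coefficients one reads off that \<open>P (cnj z f) = G'\<close>. Hence the Toeplitz operator becomes the
  differential operator \<open>G \<mapsto> q G' + p G\<close> with \<open>q = 1 + z p\<close>.

  If \<open>q\<close> has exactly one zero \<open>z0\<close> in the closed disk, simple and interior, an integrating factor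
  turns this operator into \<open>H \<mapsto> (z - z0) H' - l H\<close> with \<open>l = - p z0 / q' z0\<close>, up to bounded invertible
  multipliers. That operator is invertible unless \<open>l\<close> is a natural number, in which case
  \<open>(z - z0)\<^sup>l\<close> spans the kernel; since \<open>p z0 = - 1 / z0\<close>, this is the stated arithmetic condition.

  In the remaining cases invertibility fails: a zero of \<open>q\<close> on the circle lets peak functions violate
  the lower bound, absence of zeros yields the kernel element \<open>exp (- \<integral> p / q)\<close>, and with two zeros
  (counted with multiplicity) \<open>G \<mapsto> q G'\<close> has too large a cokernel for the perturbation \<open>p G\<close>, which is
  norm-close to a finite rank operator.\<close>


section \<open>Integrals of monomials over disks centred at the origin\<close>

text \<open>The index \<open>n = 0, 1, ...\<close> of the theorem corresponds to
  \<open>l = n + 1\<close>: the value \<open>l = 0\<close> cannot occur, because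
  \<open>z0 * p z0 = - 1\<close> makes \<open>p z0\<close> nonzero.

  The obstacle in the reduction is that \<open>p\<close> is only continuous up to the circle, so
  \<open>p'\<close> may be unbounded, and the zero-free factor \<open>q1\<close> of
  \<open>1 + z p\<close> need not multiply the Dirichlet space into itself. Hence \<open>q1\<close>
  is divided out only on the Bergman side, where boundedness suffices. What acts on the Dirichlet
  side is \<open>E = exp R\<close>, with \<open>R'\<close> the difference quotient of
  \<open>p / q1\<close> at \<open>z0\<close>; this quotient is bounded because \<open>p / q1\<close>
  is, so \<open>E\<close>, \<open>1 / E\<close> and their derivatives are bounded.

  Fredholm theory is replaced by counting. With two zeros, \<open>m + 2\<close> functionals face
  only \<open>m + 1\<close> monomials, and the Taylor tail of \<open>G\<close> has norm at most a
  constant over \<open>m + 2\<close>. Iterating this estimate forces a nontrivial combination of the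
  functionals to vanish, which their independence forbids.\<close>

definition vec_to_complex :: "real^2 \<Rightarrow> complex" where
  "vec_to_complex v = Complex (v $ 1) (v $ 2)"

definition complex_to_vec :: "complex \<Rightarrow> real^2" where
  "complex_to_vec z = vector [Re z, Im z]"

lemma vec_to_complex_inverse [simp]:
  "vec_to_complex (complex_to_vec z) = z" "complex_to_vec (vec_to_complex v) = v"
  by (auto simp: vec_to_complex_def complex_to_vec_def vec_eq_iff forall_2)

lemma measurable_vec_to_complex [measurable]: "vec_to_complex \<in> borel \<rightarrow>\<^sub>M borel"
proof -
  have "continuous_on UNIV vec_to_complex"
    unfolding vec_to_complex_def Complex_eq by (intro continuous_intros)
  then show ?thesis by (rule borel_measurable_continuous_onI)
qed

lemma Basis_vec2: "(Basis :: (real^2) set) = {axis 1 1, axis 2 1}"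
  by (auto simp: Basis_vec_def UNIV_2)

lemma vec_to_complex_vimage_box:
  "vec_to_complex -` box l u = box (complex_to_vec l) (complex_to_vec u)"
  by (auto simp: box_def Basis_complex_def Basis_vec2 vec_to_complex_def complex_to_vec_def
      inner_axis axis_eq_axis)

text \<open>Moves the planar measure to \<open>real^2\<close>, where invariance under orthogonal
  transformations can be applied.\<close>

lemma lborel_complex_eq_distr: "(lborel :: complex measure) = distr lborel borel vec_to_complex"
proof (rule lborel_eqI)
  fix l u :: complex
  assume le: "\<And>b. b \<in> Basis \<Longrightarrow> l \<bullet> b \<le> u \<bullet> b"
  have "Re l \<le> Re u" "Im l \<le> Im u"
    using le[of 1] le[of \<i>] by (auto simp: Basis_complex_def)
  then have "emeasure lborel (box (complex_to_vec l) (complex_to_vec u))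
      = ennreal ((Re u - Re l) * (Im u - Im l))"
    by (subst emeasure_lborel_box) (auto simp: Basis_vec2 complex_to_vec_def inner_axis axis_eq_axis
        inner_diff_left)
  then show "emeasure (distr lborel borel vec_to_complex) (box l u) = (\<Prod>b\<in>Basis. (u - l) \<bullet> b)"
    by (simp add: emeasure_distr vec_to_complex_vimage_box Basis_complex_def)
qed simp

lemma emeasure_lborel_vec_to_complex:
  "A \<in> sets borel \<Longrightarrow> emeasure lborel (A :: complex set) = emeasure lborel (vec_to_complex -` A)"
  by (subst lborel_complex_eq_distr) (simp add: emeasure_distr)

text \<open>Multiplication by a unimodular \<open>w\<close> is a norm-preserving linear map of
  \<open>real^2\<close>, so it preserves the measure of every box, and boxes determine
  \<open>lborel\<close>.\<close>

lemma lborel_distr_rotation: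
  fixes w :: complex
  assumes w: "cmod w = 1"
  shows "(lborel :: complex measure) = distr lborel borel (\<lambda>z. w * z)"
proof (rule lborel_eqI)
  fix l u :: complex
  assume le: "\<And>b. b \<in> Basis \<Longrightarrow> l \<bullet> b \<le> u \<bullet> b"
  define T where "T = (\<lambda>v. complex_to_vec (w * vec_to_complex v))"
  define S where "S = vec_to_complex -` box l u"
  have lin: "linear T"
    by (rule linearI) (auto simp: T_def vec_eq_iff forall_2 complex_to_vec_def vec_to_complex_def
        algebra_simps)
  have nv: "norm (complex_to_vec z) = cmod z" for z
    by (simp add: norm_eq_sqrt_inner inner_vec_def sum_2 complex_to_vec_def inner_complex_def)
  have nT: "norm (T v) = norm v" for v
    by (metis T_def nv norm_mult w mult_1 vec_to_complex_inverse(2))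
  have orth: "orthogonal_transformation T"
    using lin nT by (simp add: orthogonal_transformation)
  have surj: "surj T"
    using orth by (rule orthogonal_transformation_surj)
  have Sopen: "S = box (complex_to_vec l) (complex_to_vec u)"
    unfolding S_def by (rule vec_to_complex_vimage_box)
  have contT: "continuous_on UNIV T"
    using lin linear_continuous_on linear_conv_bounded_linear by blast
  have TSopen: "open (T -` S)"
    using contT Sopen open_vimage by blast
  have "bounded (T -` S)"
  proof -
    obtain B where "\<And>v. v \<in> S \<Longrightarrow> norm v \<le> B"
      using bounded_box Sopen by (metis bounded_iff)
    then show ?thesis
      unfolding bounded_iff using nT by (metis vimageD)
  qed
  then have lm: "T -` S \<in> lmeasurable"
    using TSopen by (simp add: lmeasurable_open)
  have "measure lebesgue (T ` (T -` S)) = measure lebesgue (T -` S)"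
    using measure_orthogonal_image[OF orth lm] .
  then have m: "measure lebesgue S = measure lebesgue (T -` S)"
    by (simp only: surj_image_vimage_eq[OF surj])
  have Slm: "S \<in> lmeasurable" using Sopen by simp
  have em: "emeasure lborel (T -` S) = emeasure lborel S"
  proof -
    have "emeasure lebesgue (T -` S) = emeasure lebesgue S"
      using m lm Slm by (simp add: emeasure_eq_measure2)
    then show ?thesis
      using TSopen Sopen by simp
  qed
  have "(\<lambda>z. w * z) -` box l u \<in> sets borel"
    by (intro borel_open open_vimage continuous_intros) auto
  then have "emeasure lborel ((\<lambda>z. w * z) -` box l u) = emeasure lborel (vec_to_complex -` ((\<lambda>z. w * z) -` box l u))"
    by (rule emeasure_lborel_vec_to_complex)
  also have "vec_to_complex -` ((\<lambda>z. w * z) -` box l u) = T -` S"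
    by (auto simp: T_def S_def)
  also have "emeasure lborel (T -` S) = emeasure lborel (box l u)"
    unfolding em unfolding S_def by (rule emeasure_lborel_vec_to_complex[symmetric]) simp
  finally show "emeasure (distr lborel borel (\<lambda>z. w * z)) (box l u) = (\<Prod>b\<in>Basis. (u - l) \<bullet> b)"
    using le by (simp add: emeasure_distr)
qed simp

lemma set_integral_ball_rotate:
  fixes g :: "complex \<Rightarrow> complex"
  assumes w: "cmod w = 1" and [measurable]: "g \<in> borel_measurable borel"
  shows "(LINT z:ball 0 r|lborel. g z) = (LINT z:ball 0 r|lborel. g (w * z))"
proof -
  have "(LINT z:ball 0 r|lborel. g z) = (LINT z|distr lborel borel (\<lambda>z. w * z). indicator (ball 0 r) z *\<^sub>R g z)"
    using lborel_distr_rotation[OF w] by (simp add: set_lebesgue_integral_def)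
  also have "\<dots> = (LINT z:ball 0 r|lborel. g (w * z))"
    using w by (subst integral_distr) (auto simp: set_lebesgue_integral_def indicator_def norm_mult)
  finally show ?thesis .
qed

lemma set_integral_ball_monomials_orthogonal:
  assumes "n \<noteq> m"
  shows "(LINT z:ball 0 r|lborel. z ^ n * cnj z ^ m) = 0"
proof -
  \<comment> \<open>This angle gives \<open>w ^ n * cnj w ^ m = cis pi = - 1\<close>, so rotation by
    \<open>w\<close> sends the integral to its own negative. The difference is taken in the reals,
    since \<open>n - m\<close> would truncate.\<close>
  define t where "t = pi / (real n - real m)"
  define w where "w = cis t"
  have "real n * t + real m * (- t) = pi"
  proof -
    have "real n * t + real m * (- t) = (real n - real m) * t" by (simp add: algebra_simps)
    then show ?thesis using assms by (simp add: t_def)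
  qed
  then have w: "w ^ n * cnj w ^ m = -1"
    by (simp add: w_def Complex.DeMoivre cis_cnj cis_mult)
  have "(LINT z:ball 0 r|lborel. z ^ n * cnj z ^ m)
      = (LINT z:ball 0 r|lborel. (w * z) ^ n * cnj (w * z) ^ m)"
    by (rule set_integral_ball_rotate)
      (auto simp: w_def intro!: borel_measurable_continuous_onI continuous_intros)
  also have "\<dots> = (LINT z:ball 0 r|lborel. (w ^ n * cnj w ^ m) * (z ^ n * cnj z ^ m))"
    by (simp add: power_mult_distrib algebra_simps)
  also have "\<dots> = - (LINT z:ball 0 r|lborel. z ^ n * cnj z ^ m)"
    unfolding w by (simp add: set_lebesgue_integral_def)
  finally show ?thesis by simp
qed

section \<open>Radial moments of the disk\<close>

lemma content_ball_complex: "r \<ge> 0 \<Longrightarrow> measure lborel (ball (c::complex) r) = pi * r\<^sup>2"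
  using content_ball[of r c] by (simp add: unit_ball_vol_2)

lemma set_integrable_ball_bounded:
  fixes f :: "complex \<Rightarrow> 'a::{banach, second_countable_topology}"
  assumes "continuous_on (ball 0 r) f" and "\<And>z. z \<in> ball 0 r \<Longrightarrow> norm (f z) \<le> B"
  shows "set_integrable lborel (ball 0 r) f"
  unfolding set_integrable_def
proof (rule Bochner_Integration.integrable_bound[where f = "\<lambda>z. B * indicator (ball 0 r) z"])
  show "integrable lborel (\<lambda>z. B * indicator (ball 0 r) z :: real)"
    by (intro integrable_mult_right integrable_real_indicator emeasure_lborel_ball_finite) simp
  show "(\<lambda>x. indicat_real (ball 0 r) x *\<^sub>R f x) \<in> borel_measurable lborel"
    using borel_measurable_continuous_on_indicator[OF _ assms(1)] by simp
  show "AE x in lborel. norm (indicat_real (ball 0 r) x *\<^sub>R f x) \<le> norm (B * indicat_real (ball 0 r) x)"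
    using assms(2) by (auto simp: indicator_def intro!: AE_I2) (meson abs_ge_self mem_ball_0 order_trans)
qed

text \<open>Radii are written as \<open>sqrt t\<close> so that the annulus between the parameters
  \<open>a\<close> and \<open>b\<close> has area \<open>pi * (b - a)\<close>; on it
  \<open>cmod z ^ 2\<close> lies between \<open>a\<close> and \<open>b\<close>.\<close>

lemma moment_increment_bounds:
  fixes a b :: real and n :: nat
  defines "J \<equiv> \<lambda>t. LINT z:ball 0 (sqrt t)|lborel. cmod z ^ (2 * n)"
  assumes ab: "0 \<le> a" "a \<le> b"
  shows "a ^ n * (pi * (b - a)) \<le> J b - J a" "J b - J a \<le> b ^ n * (pi * (b - a))"
proof -
  let ?A = "ball (0::complex) (sqrt a)" and ?B = "ball (0::complex) (sqrt b)"
  let ?f = "\<lambda>z::complex. cmod z ^ (2 * n)"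
  have sub: "?A \<subseteq> ?B" using ab by (intro subset_ball) simp
  have int: "set_integrable lborel (ball 0 r) ?f" for r
  proof (rule set_integrable_ball_bounded)
    show "norm (?f z) \<le> r ^ (2 * n)" if "z \<in> ball 0 r" for z
      using that by (auto intro: power_mono)
  qed (intro continuous_intros)
  have intD: "set_integrable lborel (?B - ?A) ?f"
    using int[of "sqrt b"] by (rule set_integrable_subset) auto
  have fin: "emeasure lborel (?B - ?A) < \<infinity>"
    using emeasure_mono[of "?B - ?A" ?B lborel] emeasure_lborel_ball_finite[of "0::complex" "sqrt b"]
    by (auto simp: less_top top_unique)
  have "J b = (LINT z:(?B - ?A)|lborel. ?f z) + J a"
    using set_integral_Un[of "?B - ?A" ?A lborel ?f] intD int sub
    by (simp add: J_def Un_absorb2 Int_commute Diff_disjoint)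
  then have eq: "J b - J a = (LINT z:(?B - ?A)|lborel. ?f z)" by simp
  have "measure lborel (?B - ?A) = pi * b - pi * a"
    using ab sub emeasure_lborel_ball_finite[of "0::complex"]
    by (subst measure_Diff) (auto simp: content_ball_complex less_top fmeasurable_def)
  then have c: "(LINT z:(?B - ?A)|lborel. c) = c * (pi * (b - a))" for c :: real
    using fin by (simp add: set_integral_const right_diff_distrib mult.commute)
  have ic: "set_integrable lborel (?B - ?A) (\<lambda>z. c)" for c :: real
    using fin by (simp add: set_integrable_def)
  have pw: "?f z = (cmod z ^ 2) ^ n" for z by (simp add: power_mult)
  have lo: "a ^ n \<le> ?f z" if "z \<in> ?B - ?A" for z
  proof -
    have "sqrt a \<le> cmod z" using that by auto
    then have "a \<le> cmod z ^ 2" by (simp add: sqrt_le_D)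
    then show ?thesis unfolding pw using ab by (intro power_mono) auto
  qed
  have hi: "?f z \<le> b ^ n" if "z \<in> ?B - ?A" for z
  proof -
    have "cmod z < sqrt b" using that by auto
    then have "cmod z ^ 2 \<le> b" using ab by (metis less_le norm_ge_zero power_mono real_sqrt_pow2 order_trans)
    then show ?thesis unfolding pw by (intro power_mono) auto
  qed
  show "a ^ n * (pi * (b - a)) \<le> J b - J a"
    unfolding eq c[symmetric] using lo by (intro set_integral_mono ic intD) auto
  show "J b - J a \<le> b ^ n * (pi * (b - a))"
    unfolding eq c[symmetric] using hi by (intro set_integral_mono ic intD) auto
qed

text \<open>In the variable \<open>t = r\<^sup>2\<close> the area of a disk is linear, so both sides have increments
  trapped between \<open>a\<^sup>n \<pi> (b - a)\<close> and \<open>b\<^sup>n \<pi> (b - a)\<close>; subdividing makes the error vanish.\<close>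

lemma set_integral_ball_cmod_power:
  assumes r: "0 \<le> r"
  shows "(LINT z:ball 0 r|lborel. cmod z ^ (2 * n)) = pi * r ^ (2 * n + 2) / (n + 1)"
proof -
  define J where "J = (\<lambda>t. LINT z:ball 0 (sqrt t)|lborel. cmod z ^ (2 * n))"
  define D where "D = (\<lambda>t. J t - pi * t ^ (n + 1) / (n + 1))"
  \<comment> \<open>The increment of \<open>J\<close> and that of the closed form lie in the same
    interval, whose length is the right-hand side.\<close>
  have step: "\<bar>D b - D a\<bar> \<le> pi * (b - a) * (b ^ n - a ^ n)" if ab: "0 \<le> a" "a \<le> b" for a b
  proof -
    have "b ^ (n+1) - a ^ (n+1) = (b - a) * (\<Sum>i<n+1. a ^ (n - i) * b ^ i)"
      using power_diff_sumr2[of b "n+1" a] by (simp add: mult.commute)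
    moreover have "(\<Sum>i<n+1. a ^ (n - i) * b ^ i) \<le> (\<Sum>i<n+1. b ^ n)"
    proof (rule sum_mono)
      fix i assume "i \<in> {..<n+1}"
      then have "a ^ (n - i) * b ^ i \<le> b ^ (n - i) * b ^ i"
        using ab by (intro mult_right_mono power_mono) auto
      also have "\<dots> = b ^ n" using \<open>i \<in> _\<close> by (simp flip: power_add)
      finally show "a ^ (n - i) * b ^ i \<le> b ^ n" .
    qed
    moreover have "(\<Sum>i<n+1. a ^ n) \<le> (\<Sum>i<n+1. a ^ (n - i) * b ^ i)"
    proof (rule sum_mono)
      fix i assume "i \<in> {..<n+1}"
      then have "a ^ n = a ^ (n - i) * a ^ i" by (simp flip: power_add)
      also have "\<dots> \<le> a ^ (n - i) * b ^ i"
        using ab by (intro mult_left_mono power_mono) auto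
      finally show "a ^ n \<le> a ^ (n - i) * b ^ i" .
    qed
    ultimately have "b ^ (n+1) - a ^ (n+1) \<le> (b - a) * ((n + 1) * b ^ n)"
      "(b - a) * ((n + 1) * a ^ n) \<le> b ^ (n+1) - a ^ (n+1)"
      using ab by (auto intro!: mult_left_mono)
    then have "(b ^ (n+1) - a ^ (n+1)) / (n + 1) \<le> (b - a) * b ^ n"
      "(b - a) * a ^ n \<le> (b ^ (n+1) - a ^ (n+1)) / (n + 1)"
      by (auto simp: field_simps)
    then have "pi * ((b ^ (n+1) - a ^ (n+1)) / (n + 1)) \<le> pi * ((b - a) * b ^ n)"
      "pi * ((b - a) * a ^ n) \<le> pi * ((b ^ (n+1) - a ^ (n+1)) / (n + 1))"
      by (intro mult_left_mono; simp)+
    moreover have "D b - D a = (J b - J a) - pi * ((b ^ (n+1) - a ^ (n+1)) / (n + 1))"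
      by (simp add: D_def diff_divide_distrib algebra_simps)
    moreover have "pi * ((b - a) * a ^ n) \<le> J b - J a" "J b - J a \<le> pi * ((b - a) * b ^ n)"
      using moment_increment_bounds[of a b n, OF ab] unfolding J_def by (simp_all add: mult_ac)
    moreover have "pi * (b - a) * (b ^ n - a ^ n) = pi * ((b - a) * b ^ n) - pi * ((b - a) * a ^ n)"
      by (simp add: algebra_simps)
    ultimately show ?thesis by linarith
  qed
  have D0: "D 0 = 0" by (simp add: D_def J_def set_lebesgue_integral_def)
  have "\<bar>D T\<bar> \<le> pi * T * T ^ n * (1 / real (Suc N))" if T: "0 \<le> T" for T N
  proof -
    define h where "h = T / real (Suc N)"
    have h: "0 \<le> h" using T by (simp add: h_def)
    \<comment> \<open>The errors \<open>pi * h * (b ^ n - a ^ n)\<close> telescope over the grid, so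
      all \<open>N + 1\<close> steps of width \<open>h\<close> together cost only
      \<open>pi * h * T ^ n\<close>, which tends to 0.\<close>
    have bnd: "\<bar>D (real i * h)\<bar> \<le> pi * h * (real i * h) ^ n" for i
    proof (induction i)
      case (Suc i)
      have "\<bar>D (real (Suc i) * h) - D (real i * h)\<bar>
          \<le> pi * (real (Suc i) * h - real i * h) * ((real (Suc i) * h) ^ n - (real i * h) ^ n)"
        using h by (intro step) (auto intro: mult_right_mono)
      also have "real (Suc i) * h - real i * h = h" by (simp add: algebra_simps)
      finally show ?case using Suc by (simp only: right_diff_distrib)
    qed (use D0 h in auto)
    have "real (Suc N) * h = T" by (simp add: h_def)
    then have "\<bar>D T\<bar> \<le> pi * h * T ^ n" using bnd[of "Suc N"] by (simp only:)
    then show ?thesis by (simp add: h_def mult_ac)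
  qed
  then have small: "\<And>N. \<bar>D (r\<^sup>2)\<bar> \<le> pi * r\<^sup>2 * (r\<^sup>2) ^ n * (1 / real (Suc N))"
    by simp
  have "(\<lambda>N. pi * r\<^sup>2 * (r\<^sup>2) ^ n * (1 / real (Suc N))) \<longlonglongrightarrow> pi * r\<^sup>2 * (r\<^sup>2) ^ n * 0"
    by (intro tendsto_mult_left LIMSEQ_Suc lim_1_over_n)
  then have "\<bar>D (r\<^sup>2)\<bar> \<le> pi * r\<^sup>2 * (r\<^sup>2) ^ n * 0"
    by (rule LIMSEQ_le_const) (use small in blast)
  then have "J (r\<^sup>2) = pi * (r\<^sup>2) ^ (n + 1) / (n + 1)" by (simp add: D_def)
  moreover have "(r\<^sup>2) ^ (n + 1) = r ^ (2 * n + 2)"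
    by (simp only: power_mult[symmetric] distrib_left mult_1_right)
  ultimately show ?thesis using r by (simp add: J_def)
qed

lemma set_integral_ball_monomials:
  assumes r: "0 \<le> r"
  shows "(LINT z:ball 0 r|lborel. z ^ n * cnj z ^ m)
    = (if n = m then complex_of_real (pi * r ^ (2 * n + 2) / (n + 1)) else 0)"
proof (cases "n = m")
  case True
  have "z ^ n * cnj z ^ n = complex_of_real (cmod z ^ (2 * n))" for z
    by (metis complex_norm_square of_real_power power_mult power_mult_distrib)
  then have "(LINT z:ball 0 r|lborel. z ^ n * cnj z ^ n)
      = complex_of_real (LINT z:ball 0 r|lborel. cmod z ^ (2 * n))"
    by (simp only: set_integral_complex_of_real)
  with True set_integral_ball_cmod_power[OF r] show ?thesis by simp
qed (simp add: set_integral_ball_monomials_orthogonal)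


section \<open>Taylor coefficients and Parseval's identity\<close>

definition taylor :: "(complex \<Rightarrow> complex) \<Rightarrow> nat \<Rightarrow> complex" where
  "taylor f n = (deriv ^^ n) f 0 / fact n"

lemma open_disk [simp, intro]: "open disk" and zero_in_disk [simp, intro]: "0 \<in> disk"
  and convex_disk [simp, intro]: "convex disk"
  by (auto simp: disk_def)

lemma disk_iff: "z \<in> disk \<longleftrightarrow> cmod z < 1"
  by (simp add: disk_def)

lemma sets_disk [measurable, simp]: "disk \<in> sets borel"
  by auto

lemma taylor_sums:
  assumes "f holomorphic_on disk" "z \<in> disk"
  shows "(\<lambda>n. taylor f n * z ^ n) sums f z"
  using holomorphic_power_series[of f 0 1 z] assms by (simp add: disk_def taylor_def)

lemma taylor_summable_norm:
  assumes "f holomorphic_on disk" "0 \<le> r" "r < 1"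
  shows "summable (\<lambda>n. cmod (taylor f n) * r ^ n)"
proof -
  obtain s where s: "r < s" "s < 1" using \<open>r < 1\<close> dense by blast
  have "summable (\<lambda>n. taylor f n * (complex_of_real s) ^ n)"
    using taylor_sums[OF assms(1), of "of_real s"] s assms(2) by (auto simp: disk_iff sums_iff)
  from powser_insidea[OF this, of "of_real r"] show ?thesis
    using s assms(2) by (simp add: norm_mult norm_power)
qed

lemma taylor_eqI_fps:
  assumes "f has_fps_expansion F"
  shows "taylor f n = fps_nth F n"
  using fps_nth_fps_expansion[OF assms] by (simp add: taylor_def)

lemma has_fps_expansion_taylor:
  assumes "f holomorphic_on disk"
  shows "f has_fps_expansion Abs_fps (taylor f)"
proof -
  have "f has_fps_expansion fps_expansion f 0"
    using assms by (intro has_fps_expansion_fps_expansion[of disk]) auto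
  moreover have "fps_expansion f 0 = Abs_fps (taylor f)"
    by (simp add: fps_expansion_def taylor_def fps_eq_iff)
  ultimately show ?thesis by simp
qed

text \<open>Convergence at the real points of the disk already forces radius of convergence at least
  1; uniqueness of the expansion at 0 then identifies the coefficients.\<close>

lemma power_series_disk:
  assumes "\<And>z. z \<in> disk \<Longrightarrow> (\<lambda>n. a n * z ^ n) sums f z"
  shows power_series_holomorphic_disk: "f holomorphic_on disk" and taylor_power_series: "taylor f = a"
proof -
  show "f holomorphic_on disk"
    unfolding disk_def using assms by (intro power_series_holomorphic[of _ _ a]) (auto simp: disk_def)
  have "fps_conv_radius (Abs_fps a) \<ge> 1"
    unfolding fps_conv_radius_def
  proof (rule conv_radius_geI_ex')
    fix r :: real assume "0 < r" "ereal r < 1"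
    then show "summable (\<lambda>n. fps_nth (Abs_fps a) n * complex_of_real r ^ n)"
      using assms[of "of_real r"] by (auto simp: disk_iff sums_iff)
  qed
  then have "fps_conv_radius (Abs_fps a) > 0"
    using less_le_trans[of 0 "1::ereal"] by simp
  moreover have "eventually (\<lambda>z. eval_fps (Abs_fps a) z = f z) (nhds 0)"
    using eventually_nhds_in_open[OF open_disk zero_in_disk]
    by eventually_elim (use assms in \<open>auto simp: eval_fps_def sums_iff\<close>)
  ultimately have "f has_fps_expansion Abs_fps a" by (simp add: has_fps_expansion_def)
  then show "taylor f = a" by (auto simp: fun_eq_iff taylor_eqI_fps)
qed

lemma taylor_cong:
  assumes "\<And>z. z \<in> disk \<Longrightarrow> f z = g z"
  shows "taylor f n = taylor g n"
proof -
  have "eventually (\<lambda>z. f z = g z) (nhds 0)"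
    using eventually_nhds_in_open[OF open_disk zero_in_disk] by eventually_elim (use assms in auto)
  then show ?thesis unfolding taylor_def by (simp add: higher_deriv_cong_ev)
qed

lemma taylor_add:
  assumes "f holomorphic_on disk" "g holomorphic_on disk"
  shows "taylor (\<lambda>z. f z + g z) n = taylor f n + taylor g n"
  by (subst taylor_eqI_fps[OF has_fps_expansion_add[OF assms[THEN has_fps_expansion_taylor]]]) simp

lemma taylor_cmult:
  assumes "f holomorphic_on disk"
  shows "taylor (\<lambda>z. c * f z) n = c * taylor f n"
  by (subst taylor_eqI_fps[OF has_fps_expansion_cmult_left[OF assms[THEN has_fps_expansion_taylor]]]) simp

lemma taylor_diff:
  assumes "f holomorphic_on disk" "g holomorphic_on disk"
  shows "taylor (\<lambda>z. f z - g z) n = taylor f n - taylor g n"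
  by (subst taylor_eqI_fps[OF has_fps_expansion_diff[OF assms[THEN has_fps_expansion_taylor]]]) simp

lemma taylor_deriv:
  assumes "f holomorphic_on disk"
  shows "taylor (deriv f) n = of_nat (Suc n) * taylor f (Suc n)"
  by (subst taylor_eqI_fps[OF has_fps_expansion_deriv[OF assms[THEN has_fps_expansion_taylor]]]) simp

lemma taylor_power_mult:
  assumes "f holomorphic_on disk"
  shows "taylor (\<lambda>z. z ^ m * f z) n = (if n < m then 0 else taylor f (n - m))"
  by (subst taylor_eqI_fps[OF has_fps_expansion_mult[OF has_fps_expansion_fps_X_power
        assms[THEN has_fps_expansion_taylor]]]) (simp add: fps_X_power_mult_nth)

lemma holomorphic_eq_if_taylor_eq:
  assumes "f holomorphic_on disk" "g holomorphic_on disk" "\<And>n. taylor f n = taylor g n" "z \<in> disk"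
  shows "f z = g z"
  using taylor_sums[OF assms(1,4)] taylor_sums[OF assms(2,4)] assms(3) sums_unique2 by auto

lemma holomorphic_bounded_on_smaller_ball:
  assumes "f holomorphic_on disk" "r < 1"
  obtains B where "\<And>z. z \<in> ball 0 r \<Longrightarrow> cmod (f z) \<le> B"
proof -
  have "continuous_on (cball 0 r) f"
    using assms by (intro holomorphic_on_imp_continuous_on holomorphic_on_subset[OF assms(1)])
      (auto simp: disk_iff)
  then have "compact (f ` cball 0 r)" by (intro compact_continuous_image) auto
  then obtain B where "\<And>z. z \<in> cball 0 r \<Longrightarrow> cmod (f z) \<le> B"
    using compact_imp_bounded bounded_iff by (metis imageI)
  then show ?thesis using that by force
qed

text \<open>On a ball of radius \<open>r < 1\<close> the Taylor series converges absolutely and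
  uniformly, so summation and integration commute. The factor \<open>u\<close> is left general in
  order to serve for monomials and for \<open>cnj (g z)\<close>.\<close>

lemma set_integral_ball_power_series:
  assumes f: "f holomorphic_on disk" and r: "0 \<le> r" "r < 1"
    and u: "continuous_on (ball 0 r) u" "\<And>z. z \<in> ball 0 r \<Longrightarrow> cmod (u z) \<le> B"
  shows "(\<lambda>n. taylor f n * (LINT z:ball 0 r|lborel. z ^ n * u z)) sums (LINT z:ball 0 r|lborel. f z * u z)"
proof -
  let ?g = "\<lambda>n z. indicator (ball 0 r) z *\<^sub>R (taylor f n * z ^ n * u z)"
  have B: "0 \<le> B \<or> ball (0::complex) r = {}"
    by (metis ex_in_conv norm_ge_zero order_trans u(2))
  have bnd: "norm (taylor f n * z ^ n * u z) \<le> cmod (taylor f n) * r ^ n * B" if "z \<in> ball 0 r" for z n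
    unfolding norm_mult norm_power using that u(2)[OF that] r
    by (intro mult_mono power_mono) auto
  have int: "integrable lborel (?g n)" for n
    unfolding set_integrable_def[symmetric]
    by (rule set_integrable_ball_bounded[OF _ bnd]) (intro continuous_intros u(1))
  have sm: "summable (\<lambda>n. cmod (taylor f n) * r ^ n * B)"
    using taylor_summable_norm[OF f r] by (rule summable_mult2)
  have summ: "summable (\<lambda>n. norm (?g n z))" for z
  proof (cases "z \<in> ball 0 r")
    case True
    then show ?thesis using sm bnd
      by (intro summable_comparison_test'[OF sm, of 0]) (auto simp: indicator_def)
  qed auto
  have "summable (\<lambda>n. LINT z|lborel. norm (?g n z))"
  proof (rule summable_comparison_test'[where N = 0])
    show "summable (\<lambda>n. cmod (taylor f n) * r ^ n * B * (pi * r\<^sup>2))"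
      using sm by (rule summable_mult2)
    fix n
    have "(LINT z|lborel. norm (?g n z)) \<le> (LINT z|lborel. indicator (ball (0::complex) r) z *\<^sub>R (cmod (taylor f n) * r ^ n * B))"
    proof (rule Bochner_Integration.integral_mono)
      show "integrable lborel (\<lambda>z. indicat_real (ball (0::complex) r) z *\<^sub>R (cmod (taylor f n) * r ^ n * B))"
        using emeasure_lborel_ball_finite by (intro integrable_scaleR_left integrable_real_indicator) auto
      show "integrable lborel (\<lambda>z. norm (?g n z))"
        using int by (rule Bochner_Integration.integrable_norm)
    qed (use bnd in \<open>auto simp: indicator_def\<close>)
    also have "\<dots> = cmod (taylor f n) * r ^ n * B * (pi * r\<^sup>2)"
      using r by (simp add: content_ball_complex)
    finally show "norm (LINT z|lborel. norm (?g n z)) \<le> cmod (taylor f n) * r ^ n * B * (pi * r\<^sup>2)"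
      by simp
  qed
  from sums_integral[OF int _ this] summ
  have "(\<lambda>n. LINT z|lborel. ?g n z) sums (LINT z|lborel. (\<Sum>n. ?g n z))" by simp
  moreover have "(\<Sum>n. ?g n z) = indicator (ball 0 r) z *\<^sub>R (f z * u z)" for z
  proof (cases "z \<in> ball 0 r")
    case True
    with r have "z \<in> disk" by (simp add: disk_iff)
    from sums_mult2[OF taylor_sums[OF f this], of "u z"] show ?thesis
      using True by (simp add: sums_iff)
  qed auto
  moreover have "(LINT z|lborel. ?g n z) = taylor f n * (LINT z:ball 0 r|lborel. z ^ n * u z)" for n
  proof -
    have "?g n = (\<lambda>z. taylor f n * (indicator (ball 0 r) z *\<^sub>R (z ^ n * u z)))"
      by (auto simp: indicator_def)
    then show ?thesis
      by (simp only: set_lebesgue_integral_def integral_mult_right_zero)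
  qed
  ultimately show ?thesis by (simp add: set_lebesgue_integral_def)
qed

text \<open>\<open>set_integral_ball_power_series\<close> is used twice: for \<open>g\<close>
  against monomials, to find its moments, and for \<open>f\<close> against \<open>cnj (g z)\<close>.
  With \<open>r < 1\<close> all functions involved are bounded; the limit \<open>r = 1\<close> is
  taken only where square integrability is known.\<close>

lemma parseval_ball:
  assumes f: "f holomorphic_on disk" and g: "g holomorphic_on disk" and r: "0 \<le> r" "r < 1"
  shows "(\<lambda>n. taylor f n * cnj (taylor g n) * of_real (pi * r ^ (2 * n + 2) / (n + 1)))
    sums (LINT z:ball 0 r|lborel. f z * cnj (g z))"
proof -
  obtain B where B: "\<And>z. z \<in> ball 0 r \<Longrightarrow> cmod (g z) \<le> B"
    using holomorphic_bounded_on_smaller_ball[OF g r(2)] by blast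
  have contg: "continuous_on (ball 0 r) g"
    by (intro holomorphic_on_imp_continuous_on holomorphic_on_subset[OF g]) (use r in \<open>auto simp: disk_iff\<close>)
  have moment: "(LINT z:ball 0 r|lborel. z ^ n * cnj (g z)) = cnj (taylor g n) * of_real (pi * r ^ (2 * n + 2) / (n + 1))" for n
  proof -
    have "(\<lambda>k. taylor g k * (LINT z:ball 0 r|lborel. z ^ k * cnj z ^ n)) sums (LINT z:ball 0 r|lborel. g z * cnj z ^ n)"
    proof (rule set_integral_ball_power_series[OF g r])
      show "cmod (cnj z ^ n) \<le> 1" if "z \<in> ball 0 r" for z
        using that r by (auto simp: norm_power intro!: power_le_one)
    qed (intro continuous_intros)
    moreover have "(\<lambda>k. taylor g k * (LINT z:ball 0 r|lborel. z ^ k * cnj z ^ n))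
        = (\<lambda>k. if k = n then taylor g n * of_real (pi * r ^ (2 * n + 2) / (n + 1)) else 0)"
      by (auto simp: set_integral_ball_monomials[OF r(1)])
    ultimately have "(LINT z:ball 0 r|lborel. g z * cnj z ^ n) = taylor g n * of_real (pi * r ^ (2 * n + 2) / (n + 1))"
      using sums_single[of n "\<lambda>_. taylor g n * of_real (pi * r ^ (2 * n + 2) / (n + 1))"]
      by (simp only: sums_unique2)
    moreover have "(LINT z:ball 0 r|lborel. z ^ n * cnj (g z)) = cnj (LINT z:ball 0 r|lborel. g z * cnj z ^ n)"
      unfolding set_lebesgue_integral_def Bochner_Integration.integral_cnj[symmetric]
      by (intro Bochner_Integration.integral_cong refl) (simp add: mult.commute)
    ultimately show ?thesis by simp
  qed
  have "(\<lambda>n. taylor f n * (LINT z:ball 0 r|lborel. z ^ n * cnj (g z))) sums (LINT z:ball 0 r|lborel. f z * cnj (g z))"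
    by (rule set_integral_ball_power_series[OF f r]) (use contg B in \<open>auto intro!: continuous_intros\<close>)
  then show ?thesis unfolding moment by (simp add: mult.assoc)
qed

lemma parseval_ball_norm:
  assumes f: "f holomorphic_on disk" and r: "0 \<le> r" "r < 1"
  shows "(\<lambda>n. (cmod (taylor f n))\<^sup>2 * (pi * r ^ (2 * n + 2) / (n + 1)))
    sums (LINT z:ball 0 r|lborel. (cmod (f z))\<^sup>2)"
proof -
  have 1: "complex_of_real (LINT z:ball 0 r|lborel. (cmod (f z))\<^sup>2) = (LINT z:ball 0 r|lborel. f z * cnj (f z))"
    unfolding complex_norm_square[symmetric] by (simp only: set_integral_complex_of_real)
  have 2: "taylor f n * cnj (taylor f n) * of_real c = complex_of_real ((cmod (taylor f n))\<^sup>2 * c)" for n c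
    unfolding complex_norm_square[symmetric] by simp
  show ?thesis
    using parseval_ball[OF f f r] unfolding 2 1[symmetric] by (simp only: sums_of_real_iff)
qed


section \<open>The Bergman space\<close>

text \<open>Radii increasing to 1: the balls exhaust the disk, and a function holomorphic on the
  disk is bounded on each of them.\<close>

definition disk_radius :: "nat \<Rightarrow> real" where
  "disk_radius j = 1 - 1 / real (Suc j)"

lemma disk_radius_bounds: "0 \<le> disk_radius j" "disk_radius j < 1"
  by (auto simp: disk_radius_def field_simps)

lemma incseq_disk_radius_ball: "incseq (\<lambda>j. ball (0::complex) (disk_radius j))"
  by (intro incseq_SucI subset_ball) (auto simp: disk_radius_def field_simps)

lemma tendsto_disk_radius: "disk_radius \<longlonglongrightarrow> 1"
proof -
  have "(\<lambda>j. 1 - 1 / real (Suc j)) \<longlonglongrightarrow> 1 - 0"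
    by (intro tendsto_diff tendsto_const LIMSEQ_Suc lim_1_over_n)
  then show ?thesis by (simp add: disk_radius_def[abs_def])
qed

lemma UN_disk_radius_ball: "(\<Union>j. ball 0 (disk_radius j)) = disk"
proof
  show "(\<Union>j. ball 0 (disk_radius j)) \<subseteq> disk"
    by (auto simp: disk_iff intro: less_trans[OF _ disk_radius_bounds(2)])
  show "disk \<subseteq> (\<Union>j. ball 0 (disk_radius j))"
  proof
    fix z :: complex assume "z \<in> disk"
    then have "eventually (\<lambda>j. cmod z < disk_radius j) sequentially"
      using tendsto_disk_radius by (intro order_tendstoD(1)) (auto simp: disk_iff)
    then show "z \<in> (\<Union>j. ball 0 (disk_radius j))"
      by (auto simp: eventually_sequentially)
  qed
qed

lemma set_integral_disk_limit:
  fixes f :: "complex \<Rightarrow> 'a::{banach, second_countable_topology}"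
  assumes "set_integrable lborel disk f"
  shows "(\<lambda>j. LINT z:ball 0 (disk_radius j)|lborel. f z) \<longlonglongrightarrow> (LINT z:disk|lborel. f z)"
  using set_integral_cont_up[of "\<lambda>j. ball 0 (disk_radius j)" lborel f] assms incseq_disk_radius_ball
  by (simp add: UN_disk_radius_ball)

lemma bergmanD:
  assumes "f \<in> bergman"
  shows "f holomorphic_on disk" "continuous_on disk f" "set_integrable lborel disk (\<lambda>z. (cmod (f z))\<^sup>2)"
  using assms by (auto simp: bergman_def holomorphic_on_imp_continuous_on)

lemma L2_norm_disk_nonneg [simp]: "0 \<le> L2_norm_disk f"
  by (auto simp: L2_norm_disk_def set_lebesgue_integral_def intro!: mult_nonneg_nonneg Bochner_Integration.integral_nonneg)

lemma L2_norm_disk_sq: "(L2_norm_disk f)\<^sup>2 = (1 / pi) * (LINT z:disk|lborel. (cmod (f z))\<^sup>2)"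
  unfolding L2_norm_disk_def
  by (intro real_sqrt_pow2 mult_nonneg_nonneg) (auto simp: set_lebesgue_integral_def intro!: Bochner_Integration.integral_nonneg)

text \<open>Parseval's identity on the smaller balls passes to the limit in two ways: finitely many
  terms converge to a partial sum bounded by \<open>I\<close>, and each radius factor is at most 1,
  which bounds \<open>I\<close> by the full series.\<close>

lemma bergman_norm_sums:
  assumes "f \<in> bergman"
  shows "(\<lambda>n. (cmod (taylor f n))\<^sup>2 / (n + 1)) sums (L2_norm_disk f)\<^sup>2"
proof -
  note f = bergmanD[OF assms]
  define c where "c = (\<lambda>n. (cmod (taylor f n))\<^sup>2 / (n + 1))"
  define I where "I = (LINT z:disk|lborel. (cmod (f z))\<^sup>2)"
  define J where "J = (\<lambda>j. LINT z:ball 0 (disk_radius j)|lborel. (cmod (f z))\<^sup>2)"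
  have c0: "0 \<le> c n" for n by (simp add: c_def)
  have J: "(\<lambda>n. pi * disk_radius j ^ (2 * n + 2) * c n) sums J j" for j
    using parseval_ball_norm[OF f(1) disk_radius_bounds] by (simp add: c_def J_def mult_ac)
  have lim: "J \<longlonglongrightarrow> I"
    unfolding I_def J_def using f(3) by (rule set_integral_disk_limit)
  have part: "(\<Sum>n<N. pi * c n) \<le> I" for N
  proof (rule LIMSEQ_le[OF _ lim])
    have "(\<lambda>j. \<Sum>n<N. pi * disk_radius j ^ (2 * n + 2) * c n) \<longlonglongrightarrow> (\<Sum>n<N. pi * 1 ^ (2 * n + 2) * c n)"
      by (intro tendsto_intros tendsto_disk_radius)
    then show "(\<lambda>j. \<Sum>n<N. pi * disk_radius j ^ (2 * n + 2) * c n) \<longlonglongrightarrow> (\<Sum>n<N. pi * c n)" by simp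
    have "(\<Sum>n<N. pi * disk_radius j ^ (2 * n + 2) * c n) \<le> J j" for j
      using sum_le_suminf[OF sums_summable[OF J], of "{..<N}" j] sums_unique[OF J, of j] c0
        disk_radius_bounds(1) by (auto intro!: mult_nonneg_nonneg)
    then show "\<exists>M. \<forall>j\<ge>M. (\<Sum>n<N. pi * disk_radius j ^ (2 * n + 2) * c n) \<le> J j" by blast
  qed
  have summ: "summable (\<lambda>n. pi * c n)"
    using part c0 by (intro summableI_nonneg_bounded[where x = I]) auto
  have "(\<Sum>n. pi * c n) \<le> I"
    using summ part by (intro suminf_le_const) auto
  moreover have "I \<le> (\<Sum>n. pi * c n)"
  proof (rule LIMSEQ_le_const2[OF lim])
    have "J j \<le> (\<Sum>n. pi * c n)" for j
    proof -
      have "pi * disk_radius j ^ (2 * n + 2) * c n \<le> pi * 1 * c n" for n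
        using disk_radius_bounds[of j] c0 by (intro mult_right_mono mult_left_mono power_le_one) auto
      then show ?thesis
        using suminf_le[OF _ sums_summable[OF J[of j]] summ] sums_unique[OF J[of j]] by auto
    qed
    then show "\<exists>N. \<forall>n\<ge>N. J n \<le> (\<Sum>n. pi * c n)" by blast
  qed
  ultimately have "(\<lambda>n. pi * c n) sums I" using summ by (simp add: sums_iff)
  then have "(\<lambda>n. (1 / pi) * (pi * c n)) sums ((1 / pi) * I)" by (rule sums_mult)
  then show ?thesis by (simp add: c_def L2_norm_disk_sq I_def)
qed

text \<open>The converse of \<open>bergman_norm_sums\<close>: the series bounds the integrals over
  all smaller balls, and monotone convergence yields integrability on the disk.\<close>

lemma bergmanI_taylor:
  assumes f: "f holomorphic_on disk" and summ: "summable (\<lambda>n. (cmod (taylor f n))\<^sup>2 / (n + 1))"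
  shows "f \<in> bergman"
proof -
  define c where "c = (\<lambda>n. (cmod (taylor f n))\<^sup>2 / (n + 1))"
  define F where "F = (\<lambda>j z. indicator (ball 0 (disk_radius j)) z *\<^sub>R (cmod (f z))\<^sup>2)"
  have c0: "0 \<le> c n" for n by (simp add: c_def)
  have sc: "summable (\<lambda>n. pi * c n)" using summ unfolding c_def by (rule summable_mult)
  have int: "integrable lborel (F j)" for j
  proof -
    obtain B where B: "\<And>z. z \<in> ball 0 (disk_radius j) \<Longrightarrow> cmod (f z) \<le> B"
      using holomorphic_bounded_on_smaller_ball[OF f disk_radius_bounds(2)] by blast
    have "continuous_on (ball 0 (disk_radius j)) f"
      using disk_radius_bounds(2)[of j]
      by (intro holomorphic_on_imp_continuous_on holomorphic_on_subset[OF f]) (auto simp: disk_iff)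
    then have "set_integrable lborel (ball 0 (disk_radius j)) (\<lambda>z. (cmod (f z))\<^sup>2)"
      by (intro set_integrable_ball_bounded[where B = "B\<^sup>2"]) (auto intro!: continuous_intros power_mono B)
    then show ?thesis by (simp add: set_integrable_def F_def)
  qed
  have mono: "mono (\<lambda>j. F j z)" for z
  proof (rule monoI)
    fix i j :: nat assume "i \<le> j"
    then have "ball (0::complex) (disk_radius i) \<subseteq> ball 0 (disk_radius j)"
      using incseq_disk_radius_ball by (rule monoD[rotated])
    then show "F i z \<le> F j z"
      unfolding F_def by (auto simp: indicator_def split: if_splits)
  qed
  have "(LINT z|lborel. F j z) \<le> (\<Sum>n. pi * c n)" for j
  proof -
    have J: "(\<lambda>n. pi * disk_radius j ^ (2 * n + 2) * c n) sums (LINT z|lborel. F j z)"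
      using parseval_ball_norm[OF f disk_radius_bounds]
      by (simp add: c_def F_def set_lebesgue_integral_def mult_ac)
    have "pi * disk_radius j ^ (2 * n + 2) * c n \<le> pi * 1 * c n" for n
      using disk_radius_bounds[of j] c0 by (intro mult_right_mono mult_left_mono power_le_one) auto
    then show ?thesis
      using suminf_le[OF _ sums_summable[OF J] sc] sums_unique[OF J] by auto
  qed
  moreover have "incseq (\<lambda>j. LINT z|lborel. F j z)"
    by (intro incseq_SucI Bochner_Integration.integral_mono int monoD[OF mono]) simp
  ultimately obtain L where L: "(\<lambda>j. LINT z|lborel. F j z) \<longlonglongrightarrow> L"
    using incseq_convergent by blast
  have pt: "(\<lambda>j. F j z) \<longlonglongrightarrow> indicator disk z *\<^sub>R (cmod (f z))\<^sup>2" for z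
  proof -
    have "(\<lambda>j. indicat_real (ball 0 (disk_radius j)) z) \<longlonglongrightarrow> indicat_real (\<Union>j. ball 0 (disk_radius j)) z"
      using incseq_disk_radius_ball by (rule LIMSEQ_indicator_incseq)
    then show ?thesis
      unfolding F_def UN_disk_radius_ball by (intro tendsto_intros)
  qed
  have meas: "(\<lambda>z. indicator disk z *\<^sub>R (cmod (f z))\<^sup>2) \<in> borel_measurable lborel"
    using borel_measurable_continuous_on_indicator[of disk "\<lambda>z. (cmod (f z))\<^sup>2"] f
    by (simp add: holomorphic_on_imp_continuous_on continuous_on_norm continuous_on_power)
  have "integrable lborel (\<lambda>z. indicator disk z *\<^sub>R (cmod (f z))\<^sup>2)"
    by (rule integrable_monotone_convergence[OF int _ _ L meas]) (use mono pt in auto)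
  then show ?thesis using f by (simp add: bergman_def set_integrable_def)
qed

lemma bergman_taylor_le:
  assumes f: "f holomorphic_on disk" and le: "\<And>n. (cmod (taylor f n))\<^sup>2 / (n + 1) \<le> u n"
    and u: "summable u" "suminf u \<le> K\<^sup>2" and K: "0 \<le> K"
  shows "f \<in> bergman" "L2_norm_disk f \<le> K"
proof -
  have summ: "summable (\<lambda>n. (cmod (taylor f n))\<^sup>2 / (n + 1))"
    using le by (intro summable_comparison_test'[OF u(1), of 0]) auto
  show b: "f \<in> bergman" using bergmanI_taylor[OF f summ] .
  have "(L2_norm_disk f)\<^sup>2 \<le> suminf u"
    using suminf_le[OF le summ u(1)] bergman_norm_sums[OF b] by (simp add: sums_iff)
  with u(2) have "(L2_norm_disk f)\<^sup>2 \<le> K\<^sup>2" by linarith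
  then show "L2_norm_disk f \<le> K" using K by (rule power2_le_imp_le)
qed

lemma taylor_le_L2_norm:
  assumes "f \<in> bergman"
  shows "cmod (taylor f n) \<le> real (n + 1) * L2_norm_disk f"
proof -
  note s = bergman_norm_sums[OF assms]
  have "(cmod (taylor f n))\<^sup>2 / (n + 1) \<le> (L2_norm_disk f)\<^sup>2"
    using sum_le_suminf[OF sums_summable[OF s], of "{n}"] sums_unique[OF s] by auto
  then have "(cmod (taylor f n))\<^sup>2 \<le> (n + 1) * (L2_norm_disk f)\<^sup>2"
    by (simp add: field_simps)
  \<comment> \<open>The sharp factor would be \<open>sqrt (n + 1)\<close>; the cruder
    \<open>n + 1\<close> avoids roots and is still summable against geometric decay.\<close>
  also have "\<dots> \<le> ((n + 1) * (n + 1)) * (L2_norm_disk f)\<^sup>2"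
    by (intro mult_right_mono) (auto simp: algebra_simps)
  also have "\<dots> = ((n + 1) * L2_norm_disk f)\<^sup>2" by (simp add: power2_eq_square algebra_simps)
  finally show ?thesis by (rule power2_le_imp_le) simp
qed

lemma bergman_cong:
  assumes "\<And>z. z \<in> disk \<Longrightarrow> f z = g z"
  shows "f \<in> bergman \<longleftrightarrow> g \<in> bergman"
proof -
  have "f holomorphic_on disk \<longleftrightarrow> g holomorphic_on disk"
    using assms by (intro holomorphic_cong) auto
  moreover have "set_integrable lborel disk (\<lambda>z. (cmod (f z))\<^sup>2) \<longleftrightarrow> set_integrable lborel disk (\<lambda>z. (cmod (g z))\<^sup>2)"
    using assms by (intro set_integrable_cong) auto
  ultimately show ?thesis by (simp add: bergman_def)
qed

section \<open>Congruence, sums and bounded multipliers\<close>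

lemma L2_norm_disk_cong:
  assumes "\<And>z. z \<in> disk \<Longrightarrow> f z = g z"
  shows "L2_norm_disk f = L2_norm_disk g"
proof -
  have "(LINT z:disk|lborel. (cmod (f z))\<^sup>2) = (LINT z:disk|lborel. (cmod (g z))\<^sup>2)"
    using assms by (intro set_lebesgue_integral_cong) auto
  then show ?thesis by (simp add: L2_norm_disk_def)
qed

lemma L2_inner_cong:
  assumes "\<And>z. z \<in> disk \<Longrightarrow> f z = f' z" "\<And>z. z \<in> disk \<Longrightarrow> g z = g' z"
  shows "L2_inner f g = L2_inner f' g'"
proof -
  have "(LINT z:disk|lborel. f z * cnj (g z)) = (LINT z:disk|lborel. f' z * cnj (g' z))"
    using assms by (intro set_lebesgue_integral_cong) auto
  then show ?thesis by (simp add: L2_inner_def)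
qed

lemma set_integrable_disk_bound:
  fixes f :: "complex \<Rightarrow> 'a::{banach, second_countable_topology}" and u :: "complex \<Rightarrow> real"
  assumes "set_integrable lborel disk u" "continuous_on disk f"
    and "\<And>z. z \<in> disk \<Longrightarrow> norm (f z) \<le> u z"
  shows "set_integrable lborel disk f"
proof (rule set_integrable_bound[OF assms(1)])
  show "set_borel_measurable lborel disk f"
    unfolding set_borel_measurable_def
    using borel_measurable_continuous_on_indicator[OF _ assms(2)] by simp
  show "AE x in lborel. x \<in> disk \<longrightarrow> norm (f x) \<le> norm (u x)"
    using assms(3) by (auto intro!: AE_I2 intro: order_trans[OF _ abs_ge_self])
qed

lemma cmod_sum_sq_le: "(cmod (a + b))\<^sup>2 \<le> 2 * (cmod a)\<^sup>2 + 2 * (cmod b)\<^sup>2"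
proof -
  have "(cmod (a + b))\<^sup>2 \<le> (cmod a + cmod b)\<^sup>2"
    by (intro power_mono norm_triangle_ineq) auto
  also have "\<dots> \<le> 2 * (cmod a)\<^sup>2 + 2 * (cmod b)\<^sup>2"
    using zero_le_power2[of "cmod a - cmod b"] by (simp add: power2_eq_square algebra_simps)
  finally show ?thesis .
qed

text \<open>The constant 2, instead of the 1 of the triangle inequality, comes from the pointwise
  bound \<open>cmod_sum_sq_le\<close> and spares a Cauchy-Schwarz argument; only boundedness of
  operators is at stake.\<close>

lemma bergman_add:
  assumes "f \<in> bergman" "g \<in> bergman"
  shows "(\<lambda>z. f z + g z) \<in> bergman"
    and "L2_norm_disk (\<lambda>z. f z + g z) \<le> 2 * (L2_norm_disk f + L2_norm_disk g)"
proof -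
  note f = bergmanD[OF assms(1)] and g = bergmanD[OF assms(2)]
  have i: "set_integrable lborel disk (\<lambda>z. 2 * (cmod (f z))\<^sup>2 + 2 * (cmod (g z))\<^sup>2)"
    using f g by (intro set_integral_add set_integrable_mult_right) auto
  have i2: "set_integrable lborel disk (\<lambda>z. (cmod (f z + g z))\<^sup>2)"
    by (rule set_integrable_disk_bound[OF i]) (use f g cmod_sum_sq_le in \<open>auto intro!: continuous_intros\<close>)
  then show "(\<lambda>z. f z + g z) \<in> bergman"
    using f g by (auto simp: bergman_def intro!: holomorphic_intros)
  have "(LINT z:disk|lborel. (cmod (f z + g z))\<^sup>2) \<le> (LINT z:disk|lborel. 2 * (cmod (f z))\<^sup>2 + 2 * (cmod (g z))\<^sup>2)"
    using i i2 cmod_sum_sq_le by (intro set_integral_mono) auto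
  also have "\<dots> = 2 * (LINT z:disk|lborel. (cmod (f z))\<^sup>2) + 2 * (LINT z:disk|lborel. (cmod (g z))\<^sup>2)"
    using f g by (subst set_integral_add(2)) (auto intro!: set_integrable_mult_right)
  finally have "(L2_norm_disk (\<lambda>z. f z + g z))\<^sup>2 \<le> 2 * (L2_norm_disk f)\<^sup>2 + 2 * (L2_norm_disk g)\<^sup>2"
    unfolding L2_norm_disk_sq by (simp add: field_simps)
  also have "\<dots> \<le> (2 * (L2_norm_disk f + L2_norm_disk g))\<^sup>2"
  proof -
    have "0 \<le> L2_norm_disk f * L2_norm_disk g" by simp
    moreover have "(2 * (L2_norm_disk f + L2_norm_disk g))\<^sup>2
        = 4 * (L2_norm_disk f)\<^sup>2 + 4 * (L2_norm_disk g)\<^sup>2 + 8 * (L2_norm_disk f * L2_norm_disk g)"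
      by (simp add: power2_eq_square algebra_simps)
    moreover have "0 \<le> (L2_norm_disk f)\<^sup>2" "0 \<le> (L2_norm_disk g)\<^sup>2" by simp_all
    ultimately show ?thesis by linarith
  qed
  finally show "L2_norm_disk (\<lambda>z. f z + g z) \<le> 2 * (L2_norm_disk f + L2_norm_disk g)"
    by (rule power2_le_imp_le) simp
qed

text \<open>Stated for continuous \<open>f\<close>, because it is also applied to products with the
  non-holomorphic symbol \<open>cnj z + p z\<close>.\<close>

lemma L2_norm_disk_mono:
  assumes g: "set_integrable lborel disk (\<lambda>z. (cmod (g z))\<^sup>2)" and f: "continuous_on disk f"
    and le: "\<And>z. z \<in> disk \<Longrightarrow> cmod (f z) \<le> M * cmod (g z)" and M: "0 \<le> M"
  shows "set_integrable lborel disk (\<lambda>z. (cmod (f z))\<^sup>2)" "L2_norm_disk f \<le> M * L2_norm_disk g"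
proof -
  have le2: "(cmod (f z))\<^sup>2 \<le> M\<^sup>2 * (cmod (g z))\<^sup>2" if "z \<in> disk" for z
    using power_mono[OF le[OF that], of 2] by (simp add: power_mult_distrib)
  have i: "set_integrable lborel disk (\<lambda>z. M\<^sup>2 * (cmod (g z))\<^sup>2)"
    using g by (intro set_integrable_mult_right) auto
  show i2: "set_integrable lborel disk (\<lambda>z. (cmod (f z))\<^sup>2)"
    by (rule set_integrable_disk_bound[OF i]) (use f le2 in \<open>auto intro!: continuous_intros\<close>)
  have "(LINT z:disk|lborel. (cmod (f z))\<^sup>2) \<le> (LINT z:disk|lborel. M\<^sup>2 * (cmod (g z))\<^sup>2)"
    using i i2 le2 by (intro set_integral_mono) auto
  then have "(L2_norm_disk f)\<^sup>2 \<le> (M * L2_norm_disk g)\<^sup>2"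
    unfolding L2_norm_disk_sq power_mult_distrib by (simp add: field_simps)
  then show "L2_norm_disk f \<le> M * L2_norm_disk g"
    by (rule power2_le_imp_le) (use M in simp)
qed

lemma bergman_mult:
  assumes f: "f \<in> bergman" and m: "m holomorphic_on disk" and M: "\<And>z. z \<in> disk \<Longrightarrow> cmod (m z) \<le> M"
  shows "(\<lambda>z. m z * f z) \<in> bergman" "L2_norm_disk (\<lambda>z. m z * f z) \<le> M * L2_norm_disk f"
proof -
  note f = bergmanD[OF f]
  have M0: "0 \<le> M" using M[OF zero_in_disk] norm_ge_zero order_trans by blast
  have c: "continuous_on disk (\<lambda>z. m z * f z)"
    using f m holomorphic_on_imp_continuous_on by (intro continuous_intros) auto
  have le: "cmod (m z * f z) \<le> M * cmod (f z)" if "z \<in> disk" for z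
    using M[OF that] by (simp add: norm_mult mult_right_mono)
  from L2_norm_disk_mono[OF f(3) c le M0] f(1) m
  show "(\<lambda>z. m z * f z) \<in> bergman" "L2_norm_disk (\<lambda>z. m z * f z) \<le> M * L2_norm_disk f"
    by (auto simp: bergman_def intro!: holomorphic_intros)
qed

lemma bergman_bounded:
  assumes f: "f holomorphic_on disk" and M: "\<And>z. z \<in> disk \<Longrightarrow> cmod (f z) \<le> M"
  shows "f \<in> bergman"
proof -
  have "taylor (\<lambda>z. 1) n = (if n = 0 then 1 else 0)" for n
    by (subst taylor_eqI_fps[OF has_fps_expansion_1]) simp
  then have "(\<lambda>z. 1) \<in> bergman"
    by (intro bergmanI_taylor) (auto intro!: summable_finite[of "{0}"] split: if_splits)
  from bergman_mult(1)[OF this f M] show ?thesis by simp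
qed

lemma bergman_cmult:
  assumes "f \<in> bergman" shows "(\<lambda>z. c * f z) \<in> bergman"
  using bergman_mult(1)[OF assms, of "\<lambda>_. c" "cmod c"] by simp

lemma bergman_diff:
  assumes "f \<in> bergman" "g \<in> bergman" shows "(\<lambda>z. f z - g z) \<in> bergman"
  using bergman_add(1)[OF assms(1) bergman_cmult[OF assms(2), of "-1"]] by simp

lemma bergman_norm_zero:
  assumes "f \<in> bergman" "L2_norm_disk f = 0" "z \<in> disk"
  shows "f z = 0"
proof -
  have "taylor f n = 0" for n
    using taylor_le_L2_norm[OF assms(1), of n] assms(2) by simp
  then show ?thesis
    using taylor_sums[OF bergmanD(1)[OF assms(1)] assms(3)] by (simp add: sums_iff)
qed


section \<open>The Toeplitz operator as a first-order differential operator\<close>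

lemma set_integrable_disk_mult_cnj:
  assumes "continuous_on disk f" "set_integrable lborel disk (\<lambda>z. (cmod (f z))\<^sup>2)"
    and "continuous_on disk g" "set_integrable lborel disk (\<lambda>z. (cmod (g z))\<^sup>2)"
  shows "set_integrable lborel disk (\<lambda>z. f z * cnj (g z))"
proof (rule set_integrable_disk_bound)
  show "set_integrable lborel disk (\<lambda>z. (cmod (f z))\<^sup>2 + (cmod (g z))\<^sup>2)"
    using assms by (intro set_integral_add)
  show "continuous_on disk (\<lambda>z. f z * cnj (g z))"
    using assms by (intro continuous_intros)
  have "x * y \<le> x\<^sup>2 + y\<^sup>2" if "0 \<le> x" "0 \<le> y" for x y :: real
  proof -
    have "2 * (x * y) \<le> x\<^sup>2 + y\<^sup>2"
      using zero_le_power2[of "x - y"] by (simp add: power2_eq_square algebra_simps)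
    moreover have "0 \<le> x * y" using that by simp
    ultimately show ?thesis by linarith
  qed
  then show "cmod (f z * cnj (g z)) \<le> (cmod (f z))\<^sup>2 + (cmod (g z))\<^sup>2" for z
    by (simp add: norm_mult)
qed

lemma L2_inner_self: "L2_inner f f = of_real ((L2_norm_disk f)\<^sup>2)"
proof -
  have "(LINT z:disk|lborel. f z * cnj (f z)) = complex_of_real (LINT z:disk|lborel. (cmod (f z))\<^sup>2)"
    unfolding complex_norm_square[symmetric] by (simp only: set_integral_complex_of_real)
  then show ?thesis unfolding L2_inner_def L2_norm_disk_sq by (simp only: of_real_mult)
qed

text \<open>The function is the derivative of \<open>z * G z\<close>, whose coefficient of
  \<open>z ^ (n + 1)\<close> is \<open>taylor G n\<close>.\<close>

lemma taylor_add_mult_deriv: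
  assumes "G holomorphic_on disk"
  shows "taylor (\<lambda>z. G z + z * deriv G z) n = of_nat (Suc n) * taylor G n"
proof -
  have h: "deriv G holomorphic_on disk" using assms by (intro holomorphic_deriv) auto
  have "taylor (\<lambda>z. G z + z ^ 1 * deriv G z) n = taylor G n + taylor (\<lambda>z. z ^ 1 * deriv G z) n"
    using assms h by (intro taylor_add) (auto intro!: holomorphic_intros)
  also have "\<dots> = of_nat (Suc n) * taylor G n"
    unfolding taylor_power_mult[OF h] taylor_deriv[OF assms] by (cases n) (auto simp: algebra_simps)
  finally show ?thesis by simp
qed

text \<open>The factor \<open>cnj z\<close> is moved onto \<open>k\<close>, so both pairings are
  between holomorphic functions and can be compared term by term with Parseval's identity on smaller
  balls.\<close>

lemma L2_inner_cnj_mult_diff_deriv: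
  assumes G: "G \<in> bergman" "deriv G \<in> bergman" and f: "f \<in> bergman" and k: "k \<in> bergman"
    and fG: "\<And>z. z \<in> disk \<Longrightarrow> f z = G z + z * deriv G z"
  shows "L2_inner (\<lambda>z. cnj z * f z - deriv G z) k = 0"
proof -
  note Gd = bergmanD[OF G(1)] and dGd = bergmanD[OF G(2)] and fd = bergmanD[OF f] and kd = bergmanD[OF k]
  have tf: "taylor f n = of_nat (Suc n) * taylor G n" for n
    using taylor_cong[of f "\<lambda>z. G z + z * deriv G z", OF fG] taylor_add_mult_deriv[OF Gd(1)] by simp
  have zk: "(\<lambda>z. z ^ 1 * k z) \<in> bergman"
    by (rule bergman_mult[OF k, where M = 1]) (auto simp: disk_iff intro!: holomorphic_intros)
  note zkd = bergmanD[OF zk]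
  define A where "A = (\<lambda>j. LINT z:ball 0 (disk_radius j)|lborel. f z * cnj (z ^ 1 * k z))"
  define B where "B = (\<lambda>j. LINT z:ball 0 (disk_radius j)|lborel. deriv G z * cnj (k z))"
  have i1: "set_integrable lborel disk (\<lambda>z. f z * cnj (z ^ 1 * k z))"
    using fd zkd by (intro set_integrable_disk_mult_cnj)
  have i2: "set_integrable lborel disk (\<lambda>z. deriv G z * cnj (k z))"
    using dGd kd by (intro set_integrable_disk_mult_cnj)
  \<comment> \<open>Term \<open>n + 1\<close> on the left pairs
    \<open>(n + 2) * taylor G (n + 1)\<close> with \<open>taylor k n\<close> under the weight
    \<open>r ^ (2 * n + 4) / (n + 2)\<close>. The factor \<open>n + 2\<close> cancels, leaving
    \<open>r\<^sup>2\<close> times term \<open>n\<close> on the right.\<close>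
  have AB: "A j = of_real ((disk_radius j)\<^sup>2) * B j" for j
  proof -
    let ?r = "disk_radius j"
    let ?a = "\<lambda>n. taylor f n * cnj (taylor (\<lambda>z. z ^ 1 * k z) n) * of_real (pi * ?r ^ (2 * n + 2) / (n + 1))"
    let ?b = "\<lambda>n. taylor (deriv G) n * cnj (taylor k n) * of_real (pi * ?r ^ (2 * n + 2) / (n + 1))"
    have a: "?a sums A j" unfolding A_def
      by (rule parseval_ball[OF fd(1) zkd(1) disk_radius_bounds])
    have b: "?b sums B j" unfolding B_def
      by (rule parseval_ball[OF dGd(1) kd(1) disk_radius_bounds])
    \<comment> \<open>Term 0 drops out because \<open>z * k z\<close> has no constant
      coefficient.\<close>
    have "(\<lambda>n. ?a (Suc n)) sums A j"
      using a taylor_power_mult[OF kd(1), of 1 0] by (subst sums_Suc_iff) simp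
    moreover have "?a (Suc n) = of_real (?r\<^sup>2) * ?b n" for n
    proof -
      have "of_real (pi * ?r ^ (2 * Suc n + 2) / (Suc n + 1)) * of_nat (Suc (Suc n))
          = complex_of_real (pi * ?r ^ (2 * n + 2) * ?r\<^sup>2)"
      proof -
        have "pi * ?r ^ (2 * Suc n + 2) / (Suc n + 1) * real (Suc (Suc n)) = pi * ?r ^ (2 * n + 2) * ?r\<^sup>2"
          by (simp add: power2_eq_square)
        then show ?thesis by (metis of_real_mult of_real_of_nat_eq)
      qed
      moreover have "of_real (pi * ?r ^ (2 * n + 2) / (n + 1)) * of_nat (Suc n)
          = complex_of_real (pi * ?r ^ (2 * n + 2))"
      proof -
        have "pi * ?r ^ (2 * n + 2) / (n + 1) * real (Suc n) = pi * ?r ^ (2 * n + 2)" by simp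
        then show ?thesis by (metis of_real_mult of_real_of_nat_eq)
      qed
      ultimately show ?thesis
        unfolding tf taylor_deriv[OF Gd(1)] taylor_power_mult[OF kd(1)]
        by (simp add: mult_ac del: of_nat_Suc of_real_divide)
    qed
    ultimately have "(\<lambda>n. of_real (?r\<^sup>2) * ?b n) sums A j" by simp
    with sums_mult[OF b] show ?thesis using sums_unique2 by blast
  qed
  have "A \<longlonglongrightarrow> (LINT z:disk|lborel. f z * cnj (z ^ 1 * k z))"
    unfolding A_def using i1 by (rule set_integral_disk_limit)
  moreover have "A \<longlonglongrightarrow> of_real (1\<^sup>2) * (LINT z:disk|lborel. deriv G z * cnj (k z))"
    unfolding AB
    by (intro tendsto_intros tendsto_disk_radius set_integral_disk_limit[OF i2, folded B_def])
  ultimately have "(LINT z:disk|lborel. f z * cnj (z ^ 1 * k z)) = (LINT z:disk|lborel. deriv G z * cnj (k z))"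
    using LIMSEQ_unique by fastforce
  moreover have "(LINT z:disk|lborel. (cnj z * f z - deriv G z) * cnj (k z))
      = (LINT z:disk|lborel. f z * cnj (z ^ 1 * k z) - deriv G z * cnj (k z))"
    by (intro set_lebesgue_integral_cong) (auto simp: algebra_simps)
  moreover have "\<dots> = (LINT z:disk|lborel. f z * cnj (z ^ 1 * k z)) - (LINT z:disk|lborel. deriv G z * cnj (k z))"
    using i1 i2 by (rule set_integral_diff)
  ultimately show ?thesis by (simp add: L2_inner_def)
qed

section \<open>The Dirichlet space and the transported operator\<close>

definition dirichlet :: "(complex \<Rightarrow> complex) set" where
  "dirichlet = {G. G \<in> bergman \<and> deriv G \<in> bergman}"

text \<open>The derivative of \<open>z * G z\<close>; by \<open>bergman_eq_dirichlet_lift\<close> it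
  maps the Dirichlet space onto the Bergman space with bounded inverse.\<close>

definition dirichlet_lift :: "(complex \<Rightarrow> complex) \<Rightarrow> complex \<Rightarrow> complex" where
  "dirichlet_lift G z = G z + z * deriv G z"

text \<open>The sum of \<open>deriv G\<close>, the projection of \<open>cnj z * f z\<close>, and
  \<open>p z * f z\<close>, for \<open>f = dirichlet_lift G\<close>, with the \<open>deriv G\<close>
  terms collected.\<close>

definition toeplitz_ode :: "(complex \<Rightarrow> complex) \<Rightarrow> (complex \<Rightarrow> complex) \<Rightarrow> complex \<Rightarrow> complex" where
  "toeplitz_ode p G z = (1 + z * p z) * deriv G z + p z * G z"

lemma dirichletD:
  assumes "G \<in> dirichlet"
  shows "G \<in> bergman" "deriv G \<in> bergman" "G holomorphic_on disk" "deriv G holomorphic_on disk"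
  using assms by (auto simp: dirichlet_def dest: bergmanD(1))

lemma dirichlet_lift_bergman:
  assumes "G \<in> dirichlet"
  shows "dirichlet_lift G \<in> bergman"
    "L2_norm_disk (dirichlet_lift G) \<le> 2 * (L2_norm_disk G + L2_norm_disk (deriv G))"
proof -
  note G = dirichletD[OF assms]
  have zG: "(\<lambda>z. z * deriv G z) \<in> bergman" "L2_norm_disk (\<lambda>z. z * deriv G z) \<le> 1 * L2_norm_disk (deriv G)"
    using bergman_mult[OF G(2), of "\<lambda>z. z" 1] by (auto simp: disk_iff less_imp_le intro!: holomorphic_intros)
  show "dirichlet_lift G \<in> bergman"
    using bergman_add(1)[OF G(1) zG(1)] by (simp add: dirichlet_lift_def[abs_def])
  show "L2_norm_disk (dirichlet_lift G) \<le> 2 * (L2_norm_disk G + L2_norm_disk (deriv G))"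
    using bergman_add(2)[OF G(1) zG(1)] zG(2) by (simp add: dirichlet_lift_def[abs_def])
qed

text \<open>\<open>G\<close> is the primitive of \<open>f\<close> vanishing at 0, divided by
  \<open>z\<close>; its coefficients are those of \<open>f\<close> divided by
  \<open>n + 1\<close>.\<close>

lemma bergman_eq_dirichlet_lift:
  assumes f: "f \<in> bergman"
  obtains G where "G \<in> dirichlet" "\<And>z. z \<in> disk \<Longrightarrow> f z = dirichlet_lift G z"
    "L2_norm_disk G \<le> L2_norm_disk f" "L2_norm_disk (deriv G) \<le> L2_norm_disk f"
    "\<And>n. taylor f n = of_nat (Suc n) * taylor G n"
proof -
  note fd = bergmanD[OF f] and fs = bergman_norm_sums[OF f]
  define c where "c = (\<lambda>n. taylor f n / of_nat (Suc n))"
  define G where "G = (\<lambda>z. \<Sum>n. c n * z ^ n)"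
  have cle: "cmod (c n) \<le> cmod (taylor f n)" for n
    by (simp add: c_def norm_divide field_simps del: of_nat_Suc) (simp add: distrib_right)
  have sums: "(\<lambda>n. c n * z ^ n) sums G z" if "z \<in> disk" for z
  proof -
    have "summable (\<lambda>n. cmod (taylor f n) * cmod z ^ n)"
      using that by (intro taylor_summable_norm[OF fd(1)]) (auto simp: disk_iff)
    then have "summable (\<lambda>n. c n * z ^ n)"
      by (rule summable_comparison_test') (use cle in \<open>auto simp: norm_mult norm_power intro!: mult_right_mono\<close>)
    then show ?thesis by (simp add: G_def summable_sums)
  qed
  have hG: "G holomorphic_on disk" using sums by (rule power_series_holomorphic_disk)
  have tG: "taylor G = c" using sums by (rule taylor_power_series)
  have hdG: "deriv G holomorphic_on disk" using hG by (intro holomorphic_deriv) auto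
  have Gb: "G \<in> bergman" "L2_norm_disk G \<le> L2_norm_disk f"
  proof -
    have *: "(cmod (taylor G n))\<^sup>2 / (n + 1) \<le> (cmod (taylor f n))\<^sup>2 / (n + 1)" for n
      unfolding tG using cle by (intro divide_right_mono power_mono) auto
    show "G \<in> bergman" "L2_norm_disk G \<le> L2_norm_disk f"
      using bergman_taylor_le[OF hG *, of "L2_norm_disk f"] fs by (auto simp: sums_iff)
  qed
  have dGb: "deriv G \<in> bergman" "L2_norm_disk (deriv G) \<le> L2_norm_disk f"
  proof -
    let ?u = "\<lambda>n. (cmod (taylor f (Suc n)))\<^sup>2 / (Suc n + 1)"
    \<comment> \<open>Coefficient \<open>n\<close> of \<open>deriv G\<close> is
      \<open>(n + 1) / (n + 2)\<close> times \<open>taylor f (n + 1)\<close>. As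
      \<open>(n + 1) / (n + 2)\<^sup>2 \<le> 1 / (n + 2)\<close>, the shifted norm series of
      \<open>f\<close> is a majorant and no constant appears.\<close>
    have *: "(cmod (taylor (deriv G) n))\<^sup>2 / (n + 1) \<le> ?u n" for n
    proof -
      have gen: "(a / b * x)\<^sup>2 / a = x\<^sup>2 * (a / b\<^sup>2)" if "a > 0" for a b x :: real
        using that by (cases "b = 0") (auto simp: field_simps power2_eq_square)
      have "cmod (taylor (deriv G) n) = real (n + 1) / real (n + 2) * cmod (taylor f (Suc n))"
        unfolding taylor_deriv[OF hG] tG c_def by (simp add: norm_mult norm_divide del: of_nat_Suc)
      then have "(cmod (taylor (deriv G) n))\<^sup>2 / (n + 1)
          = (cmod (taylor f (Suc n)))\<^sup>2 * (real (n + 1) / (real (n + 2))\<^sup>2)"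
        by (simp only: gen of_nat_0_less_iff zero_less_Suc Suc_eq_plus1[symmetric])
      also have "\<dots> \<le> (cmod (taylor f (Suc n)))\<^sup>2 * (1 / real (n + 2))"
      proof (rule mult_left_mono)
        have "real (n + 1) / (real (n + 2))\<^sup>2 \<le> real (n + 2) / (real (n + 2))\<^sup>2"
          by (intro divide_right_mono) auto
        then show "real (n + 1) / (real (n + 2))\<^sup>2 \<le> 1 / real (n + 2)"
          by (simp add: power2_eq_square)
      qed simp
      finally show ?thesis by (simp add: add_ac)
    qed
    have su: "summable ?u"
      using sums_summable[OF fs] by (subst summable_Suc_iff)
    have "suminf ?u \<le> (L2_norm_disk f)\<^sup>2"
      using suminf_split_head[OF sums_summable[OF fs]] sums_unique[OF fs] by simp
    from bergman_taylor_le[OF hdG * su this]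
    show "deriv G \<in> bergman" "L2_norm_disk (deriv G) \<le> L2_norm_disk f" by auto
  qed
  have tf: "taylor f n = of_nat (Suc n) * taylor G n" for n
    by (simp add: tG c_def del: of_nat_Suc)
  have G: "G \<in> dirichlet" using Gb dGb by (simp add: dirichlet_def)
  have "f z = dirichlet_lift G z" if "z \<in> disk" for z
  proof (rule holomorphic_eq_if_taylor_eq[OF fd(1) _ _ that])
    show "dirichlet_lift G holomorphic_on disk"
      using dirichlet_lift_bergman(1)[OF G] by (rule bergmanD(1))
    show "taylor f n = taylor (dirichlet_lift G) n" for n
      using taylor_add_mult_deriv[OF hG] tf by (simp add: dirichlet_lift_def[abs_def])
  qed
  with G Gb dGb tf show ?thesis by (intro that)
qed

context
  fixes p :: "complex \<Rightarrow> complex" and M :: real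
  assumes p: "p holomorphic_on disk" and M: "\<And>z. z \<in> disk \<Longrightarrow> cmod (p z) \<le> M"
begin

lemma toeplitz_ode_bergman:
  assumes "G \<in> dirichlet"
  shows "toeplitz_ode p G \<in> bergman"
proof -
  note G = dirichletD[OF assms]
  have "cmod (1 + z * p z) \<le> 1 + M" if "z \<in> disk" for z
  proof -
    have "cmod (1 + z * p z) \<le> 1 + cmod z * cmod (p z)"
      using norm_triangle_ineq[of 1 "z * p z"] by (simp add: norm_mult)
    also have "cmod z * cmod (p z) \<le> 1 * M"
      using that M[OF that] by (intro mult_mono) (auto simp: disk_iff)
    finally show ?thesis by simp
  qed
  then have "(\<lambda>z. (1 + z * p z) * deriv G z) \<in> bergman"
    using p by (intro bergman_mult[OF G(2)]) (auto intro!: holomorphic_intros)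
  moreover have "(\<lambda>z. p z * G z) \<in> bergman"
    using bergman_mult(1)[OF G(1) p M] .
  ultimately show ?thesis
    unfolding toeplitz_ode_def[abs_def] by (rule bergman_add)
qed

text \<open>The forward direction is uniqueness of the projection: the difference \<open>d\<close>
  of two candidates lies in the Bergman space, is therefore an admissible test function, and is
  orthogonal to itself.\<close>

lemma is_toeplitz_image_iff:
  assumes "G \<in> dirichlet" and f: "f \<in> bergman" and fG: "\<And>z. z \<in> disk \<Longrightarrow> f z = dirichlet_lift G z"
  shows "is_toeplitz_image (\<lambda>z. cnj z + p z) f h \<longleftrightarrow>
    h \<in> bergman \<and> (\<forall>z\<in>disk. h z = toeplitz_ode p G z)"
proof -
  note G = dirichletD[OF assms(1)]
  let ?h = "toeplitz_ode p G"
  let ?s = "\<lambda>z. (cnj z + p z) * f z"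
  have hb: "?h \<in> bergman" using toeplitz_ode_bergman[OF assms(1)] .
  have orth: "L2_inner (\<lambda>z. ?s z - ?h z) k = 0" if "k \<in> bergman" for k
  proof -
    have "L2_inner (\<lambda>z. ?s z - ?h z) k = L2_inner (\<lambda>z. cnj z * f z - deriv G z) k"
      by (intro L2_inner_cong) (auto simp: toeplitz_ode_def fG dirichlet_lift_def algebra_simps)
    also have "\<dots> = 0"
      using G f that fG by (intro L2_inner_cnj_mult_diff_deriv) (auto simp: dirichlet_lift_def)
    finally show ?thesis .
  qed
  have sc: "continuous_on disk ?s"
    using bergmanD(2)[OF f] holomorphic_on_imp_continuous_on[OF p] by (intro continuous_intros)
  have si: "set_integrable lborel disk (\<lambda>z. (cmod (?s z))\<^sup>2)"
  proof (rule L2_norm_disk_mono(1)[OF bergmanD(3)[OF f] sc])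
    fix z assume z: "z \<in> disk"
    have "cmod (cnj z + p z) \<le> 1 + M"
      using norm_triangle_ineq[of "cnj z" "p z"] M[OF z] z by (simp add: disk_iff)
    then show "cmod (?s z) \<le> (1 + M) * cmod (f z)"
      unfolding norm_mult by (intro mult_right_mono) auto
  next
    show "0 \<le> 1 + M" using M[OF zero_in_disk] norm_ge_zero[of "p 0"] by linarith
  qed
  show ?thesis
  proof
    assume "is_toeplitz_image (\<lambda>z. cnj z + p z) f h"
    then have h: "h \<in> bergman" and o: "\<And>k. k \<in> bergman \<Longrightarrow> L2_inner (\<lambda>z. ?s z - h z) k = 0"
      by (auto simp: is_toeplitz_image_def is_bergman_proj_def)
    define d where "d = (\<lambda>z. h z - ?h z)"
    have d: "d \<in> bergman" unfolding d_def using h hb by (rule bergman_diff)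
    note dd = bergmanD[OF d]
    have int: "set_integrable lborel disk (\<lambda>z. (?s z - u z) * cnj (d z))" if "u \<in> bergman" for u
    proof -
      note ud = bergmanD[OF that]
      have "set_integrable lborel disk (\<lambda>z. ?s z * cnj (d z) - u z * cnj (d z))"
        using sc si dd ud by (intro set_integral_diff set_integrable_disk_mult_cnj)
      then show ?thesis by (simp add: algebra_simps)
    qed
    have "(LINT z:disk|lborel. d z * cnj (d z)) =
        (LINT z:disk|lborel. (?s z - ?h z) * cnj (d z) - (?s z - h z) * cnj (d z))"
      by (intro set_lebesgue_integral_cong) (auto simp: d_def algebra_simps)
    also have "\<dots> = (LINT z:disk|lborel. (?s z - ?h z) * cnj (d z)) - (LINT z:disk|lborel. (?s z - h z) * cnj (d z))"
      by (intro set_integral_diff int h hb)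
    finally have "L2_inner d d = L2_inner (\<lambda>z. ?s z - ?h z) d - L2_inner (\<lambda>z. ?s z - h z) d"
      unfolding L2_inner_def right_diff_distrib[symmetric] by (rule arg_cong)
    then have "L2_inner d d = 0" using o[OF d] orth[OF d] by simp
    then have "L2_norm_disk d = 0" by (simp add: L2_inner_self)
    then have "d z = 0" if "z \<in> disk" for z using bergman_norm_zero[OF d] that by blast
    then show "h \<in> bergman \<and> (\<forall>z\<in>disk. h z = ?h z)" using h by (auto simp: d_def)
  next
    assume h: "h \<in> bergman \<and> (\<forall>z\<in>disk. h z = ?h z)"
    then have "L2_inner (\<lambda>z. ?s z - h z) k = L2_inner (\<lambda>z. ?s z - ?h z) k" for k
      by (intro L2_inner_cong) auto
    then show "is_toeplitz_image (\<lambda>z. cnj z + p z) f h"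
      using h orth by (auto simp: is_toeplitz_image_def is_bergman_proj_def)
  qed
qed

text \<open>\<open>f\<close> and \<open>G\<close> determine each other on the disk, so surjectivity
  and the lower bound transfer separately, the latter with the same \<open>C\<close>.\<close>

lemma toeplitz_invertible_iff_ode:
  "toeplitz_invertible (\<lambda>z. cnj z + p z) \<longleftrightarrow>
    (\<forall>g\<in>bergman. \<exists>G\<in>dirichlet. \<forall>z\<in>disk. toeplitz_ode p G z = g z) \<and>
    (\<exists>C. \<forall>G\<in>dirichlet. L2_norm_disk (dirichlet_lift G) \<le> C * L2_norm_disk (toeplitz_ode p G))"
    (is "_ \<longleftrightarrow> ?surj \<and> ?bound")
proof -
  let ?phi = "\<lambda>z. cnj z + p z"
  have surj: "(\<forall>g\<in>bergman. \<exists>f\<in>bergman. is_toeplitz_image ?phi f g) \<longleftrightarrow> ?surj"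
  proof (intro iffI ballI)
    fix g assume a: "\<forall>g\<in>bergman. \<exists>f\<in>bergman. is_toeplitz_image ?phi f g" and g: "g \<in> bergman"
    then obtain f where f: "f \<in> bergman" "is_toeplitz_image ?phi f g" by blast
    obtain G where G: "G \<in> dirichlet" "\<And>z. z \<in> disk \<Longrightarrow> f z = dirichlet_lift G z"
      by (rule bergman_eq_dirichlet_lift[OF f(1)]) (rule that; assumption)
    from is_toeplitz_image_iff[OF G(1) f(1) G(2)] f(2) G(1)
    show "\<exists>G\<in>dirichlet. \<forall>z\<in>disk. toeplitz_ode p G z = g z" by auto
  next
    fix g assume a: ?surj and g: "g \<in> bergman"
    then obtain G where G: "G \<in> dirichlet" "\<forall>z\<in>disk. toeplitz_ode p G z = g z" by blast
    from is_toeplitz_image_iff[OF G(1) dirichlet_lift_bergman(1)[OF G(1)] refl] G g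
      dirichlet_lift_bergman(1)[OF G(1)]
    show "\<exists>f\<in>bergman. is_toeplitz_image ?phi f g" by fastforce
  qed
  have bound: "(\<forall>f\<in>bergman. \<forall>h. is_toeplitz_image ?phi f h \<longrightarrow> L2_norm_disk f \<le> C * L2_norm_disk h)
      \<longleftrightarrow> (\<forall>G\<in>dirichlet. L2_norm_disk (dirichlet_lift G) \<le> C * L2_norm_disk (toeplitz_ode p G))" for C
  proof (intro iffI ballI allI impI)
    fix G assume a: "\<forall>f\<in>bergman. \<forall>h. is_toeplitz_image ?phi f h \<longrightarrow> L2_norm_disk f \<le> C * L2_norm_disk h"
      and G: "G \<in> dirichlet"
    have "is_toeplitz_image ?phi (dirichlet_lift G) (toeplitz_ode p G)"
      using is_toeplitz_image_iff[OF G dirichlet_lift_bergman(1)[OF G] refl] toeplitz_ode_bergman[OF G]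
      by blast
    with a dirichlet_lift_bergman(1)[OF G]
    show "L2_norm_disk (dirichlet_lift G) \<le> C * L2_norm_disk (toeplitz_ode p G)" by blast
  next
    fix f h assume a: "\<forall>G\<in>dirichlet. L2_norm_disk (dirichlet_lift G) \<le> C * L2_norm_disk (toeplitz_ode p G)"
      and f: "f \<in> bergman" and h: "is_toeplitz_image ?phi f h"
    obtain G where G: "G \<in> dirichlet" "\<And>z. z \<in> disk \<Longrightarrow> f z = dirichlet_lift G z"
      by (rule bergman_eq_dirichlet_lift[OF f]) (rule that; assumption)
    from is_toeplitz_image_iff[OF G(1) f G(2)] h
    have "L2_norm_disk h = L2_norm_disk (toeplitz_ode p G)" by (intro L2_norm_disk_cong) blast
    moreover have "L2_norm_disk f = L2_norm_disk (dirichlet_lift G)"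
      using G(2) by (rule L2_norm_disk_cong)
    ultimately show "L2_norm_disk f \<le> C * L2_norm_disk h" using a G(1) by simp
  qed
  show ?thesis unfolding toeplitz_invertible_def surj bound by (rule refl)
qed

end


section \<open>The Euler equation\<close>

text \<open>These are exactly the Taylor sequences of Bergman functions. The recurrence is solved
  for sequences first, and \<open>bergman_of_seq\<close> returns to functions.\<close>

definition bergman_seq :: "(nat \<Rightarrow> complex) \<Rightarrow> bool" where
  "bergman_seq a \<longleftrightarrow> summable (\<lambda>n. (cmod (a n))\<^sup>2 / (n + 1))"

lemma summable_linear_times_power:
  fixes r :: real
  assumes "0 \<le> r" "r < 1"
  shows "summable (\<lambda>j. r ^ j * real (n + j + 1))"
proof -
  have "summable (\<lambda>j. real n * r ^ j + real (Suc j) * r ^ j)"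
    using assms geometric_deriv_sums[of r]
    by (intro summable_add summable_mult summable_geometric) (auto simp: sums_iff)
  then show ?thesis by (simp add: algebra_simps)
qed

lemma bergman_seq_sq_le:
  assumes "bergman_seq a"
  shows "(cmod (a n))\<^sup>2 \<le> real (n + 1) * (\<Sum>n. (cmod (a n))\<^sup>2 / (n + 1))"
proof -
  have "(cmod (a n))\<^sup>2 / (n + 1) \<le> (\<Sum>n. (cmod (a n))\<^sup>2 / (n + 1))"
    using sum_le_suminf[of "\<lambda>n. (cmod (a n))\<^sup>2 / (n + 1)" "{n}"] assms by (auto simp: bergman_seq_def)
  then show ?thesis by (simp add: field_simps)
qed

text \<open>Follows from \<open>2 * x \<le> 1 + x\<^sup>2\<close>; linear growth is good enough, as
  it only has to lose against geometric decay.\<close>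

lemma bergman_seq_le:
  assumes "bergman_seq a"
  obtains S where "0 \<le> S" "\<And>n. cmod (a n) \<le> S * real (n + 1)"
proof -
  let ?S = "\<Sum>n. (cmod (a n))\<^sup>2 / (n + 1)"
  have S: "0 \<le> ?S" using assms by (intro suminf_nonneg) (auto simp: bergman_seq_def)
  have "cmod (a n) \<le> (1 + ?S) * real (n + 1)" for n
  proof -
    have "2 * cmod (a n) \<le> 1 + (cmod (a n))\<^sup>2"
      using zero_le_power2[of "cmod (a n) - 1"] by (simp add: power2_eq_square algebra_simps)
    also have "\<dots> \<le> 1 + real (n + 1) * ?S" using bergman_seq_sq_le[OF assms] by simp
    also have "\<dots> \<le> real (n + 1) + real (n + 1) * ?S" by simp
    also have "\<dots> = (1 + ?S) * real (n + 1)" by (simp add: algebra_simps)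
    finally show ?thesis using norm_ge_zero[of "a n"] by linarith
  qed
  with S show ?thesis by (intro that[of "1 + ?S"]) auto
qed

lemma bergman_of_seq:
  assumes "bergman_seq a"
  obtains f where "f \<in> bergman" "taylor f = a"
proof -
  obtain S where S: "0 \<le> S" "\<And>n. cmod (a n) \<le> S * real (n + 1)" by (rule bergman_seq_le[OF assms]) (rule that)
  have sums: "(\<lambda>n. a n * z ^ n) sums (\<Sum>n. a n * z ^ n)" if "z \<in> disk" for z
  proof (rule summable_sums, rule summable_comparison_test'[where N = 0])
    show "summable (\<lambda>n. S * (cmod z ^ n * real (0 + n + 1)))"
      using that by (intro summable_mult summable_linear_times_power) (auto simp: disk_iff)
    show "norm (a n * z ^ n) \<le> S * (cmod z ^ n * real (0 + n + 1))" for n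
      using mult_right_mono[OF S(2)[of n], of "cmod z ^ n"] by (simp add: norm_mult norm_power mult_ac)
  qed
  have h: "(\<lambda>z. \<Sum>n. a n * z ^ n) holomorphic_on disk"
    using sums by (rule power_series_holomorphic_disk)
  have t: "taylor (\<lambda>z. \<Sum>n. a n * z ^ n) = a"
    using sums by (rule taylor_power_series)
  have "(\<lambda>z. \<Sum>n. a n * z ^ n) \<in> bergman"
    by (rule bergmanI_taylor[OF h]) (use assms in \<open>simp only: t bergman_seq_def\<close>)
  then show ?thesis using t by (rule that)
qed

lemma weighted_cauchy_schwarz_geometric:
  fixes x :: "nat \<Rightarrow> real"
  assumes r: "0 \<le> r" "r < 1" and s1: "summable (\<lambda>j. r ^ j * x j)" and s2: "summable (\<lambda>j. r ^ j * (x j)\<^sup>2)"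
  shows "(\<Sum>j. r ^ j * x j)\<^sup>2 \<le> (1 / (1 - r)) * (\<Sum>j. r ^ j * (x j)\<^sup>2)"
proof -
  define S where "S = (\<Sum>j. r ^ j * x j)"
  \<comment> \<open>The mean of \<open>x\<close> under the weights \<open>r ^ j\<close>, whose total
    mass is \<open>1 / (1 - r)\<close>. With this value, summing
    \<open>2 * t * x j \<le> (x j)\<^sup>2 + t\<^sup>2\<close> gives the Cauchy-Schwarz
    bound.\<close>
  define t where "t = (1 - r) * S"
  have sg: "summable (\<lambda>j. r ^ j)" using r by (intro summable_geometric) auto
  have g: "(\<Sum>j. r ^ j) = 1 / (1 - r)" using r by (intro suminf_geometric) auto
  have "2 * t * (r ^ j * x j) \<le> r ^ j * (x j)\<^sup>2 + t\<^sup>2 * r ^ j" for j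
  proof -
    have "2 * t * x j \<le> (x j)\<^sup>2 + t\<^sup>2"
      using zero_le_power2[of "x j - t"] by (simp add: power2_eq_square algebra_simps)
    from mult_left_mono[OF this, of "r ^ j"] r show ?thesis by (simp add: algebra_simps)
  qed
  then have "(\<Sum>j. 2 * t * (r ^ j * x j)) \<le> (\<Sum>j. r ^ j * (x j)\<^sup>2 + t\<^sup>2 * r ^ j)"
    using s1 s2 sg by (intro suminf_le summable_mult summable_add) auto
  then have "2 * t * S \<le> (\<Sum>j. r ^ j * (x j)\<^sup>2) + t\<^sup>2 * (1 / (1 - r))"
    using s1 s2 sg by (simp add: suminf_mult suminf_add[symmetric] summable_mult S_def g)
  moreover have "t\<^sup>2 * (1 / (1 - r)) = t * S"
    using r by (simp add: t_def power2_eq_square)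
  ultimately have "(1 - r) * S\<^sup>2 \<le> (\<Sum>j. r ^ j * (x j)\<^sup>2)"
    by (simp add: t_def power2_eq_square algebra_simps)
  then show ?thesis using r by (simp add: S_def field_simps)
qed

text \<open>\<open>b\<close> holds the factors of a backward recurrence from index
  \<open>n + 1\<close> to \<open>n\<close>; the bound on their products is uniform in the starting
  index.\<close>

context
  fixes b :: "nat \<Rightarrow> complex" and C r :: real
  assumes r: "0 \<le> r" "r < 1" and C: "\<And>n j. cmod (\<Prod>i<j. b (n + i)) \<le> C * r ^ j"
begin

text \<open>Iterating expresses \<open>d n\<close> by \<open>d (n + j)\<close>; the product decays
  geometrically in \<open>j\<close>, while a Bergman sequence grows at most linearly.\<close>

lemma recurrence_unique:
  assumes d: "bergman_seq d" and rec: "\<And>n. d n = b n * d (Suc n)"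
  shows "d n = 0"
proof -
  obtain S where S: "0 \<le> S" "\<And>n. cmod (d n) \<le> S * real (n + 1)" by (rule bergman_seq_le[OF d]) (rule that)
  have C0: "0 \<le> C" using C[of 0 0] by simp
  have iter: "d n = (\<Prod>i<j. b (n + i)) * d (n + j)" for j
  proof (induction j)
    case (Suc j)
    have "d (n + j) = b (n + j) * d (n + Suc j)" using rec[of "n + j"] by simp
    with Suc show ?case by simp
  qed simp
  have "cmod (d n) \<le> C * S * (r ^ j * real (n + j + 1))" for j
  proof -
    have "cmod (d n) = cmod (\<Prod>i<j. b (n + i)) * cmod (d (n + j))"
      by (subst iter[of j]) (simp only: norm_mult)
    also have "\<dots> \<le> (C * r ^ j) * (S * real (n + j + 1))"
      using C S(2)[of "n + j"] C0 r by (intro mult_mono) auto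
    finally show ?thesis by (simp add: mult_ac)
  qed
  moreover have "(\<lambda>j. C * S * (r ^ j * real (n + j + 1))) \<longlonglongrightarrow> C * S * 0"
    by (intro tendsto_mult_left summable_LIMSEQ_zero summable_linear_times_power r)
  ultimately have "cmod (d n) \<le> C * S * 0"
    by (intro LIMSEQ_le_const) blast+
  then show ?thesis by simp
qed

text \<open>The solution is the Neumann series obtained by iterating the recurrence without end. In
  the constant, one factor \<open>1 / (1 - r)\<close> comes from the weighted Cauchy-Schwarz
  inequality and two from the sum of \<open>(j + 1) * r ^ j\<close>.\<close>

lemma recurrence_solve:
  assumes k: "bergman_seq k"
  obtains d where "bergman_seq d" "\<And>n. d n = k n + b n * d (Suc n)"
    "(\<Sum>n. (cmod (d n))\<^sup>2 / (n + 1)) \<le> C\<^sup>2 / (1 - r) ^ 3 * (\<Sum>n. (cmod (k n))\<^sup>2 / (n + 1))"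
proof -
  define K where "K = (\<Sum>n. (cmod (k n))\<^sup>2 / (n + 1))"
  define P where "P = (\<lambda>n j. \<Prod>i<j. b (n + i))"
  define d where "d = (\<lambda>n. \<Sum>j. P n j * k (n + j))"
  have C0: "0 \<le> C" using C[of 0 0] by simp
  have K0: "0 \<le> K" unfolding K_def using k by (intro suminf_nonneg) (auto simp: bergman_seq_def)
  have s2: "summable (\<lambda>j. r ^ j * (cmod (k (n + j)))\<^sup>2)" for n
  proof (rule summable_comparison_test'[where N = 0])
    show "summable (\<lambda>j. K * (r ^ j * real (n + j + 1)))"
      by (intro summable_mult summable_linear_times_power r)
    show "norm (r ^ j * (cmod (k (n + j)))\<^sup>2) \<le> K * (r ^ j * real (n + j + 1))" for j
      using mult_left_mono[OF bergman_seq_sq_le[OF k, of "n + j"], of "r ^ j"] r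
      by (simp add: K_def mult_ac)
  qed
  have s1: "summable (\<lambda>j. r ^ j * cmod (k (n + j)))" for n
  proof (rule summable_comparison_test'[where N = 0])
    show "summable (\<lambda>j. r ^ j + r ^ j * (cmod (k (n + j)))\<^sup>2)"
      using r by (intro summable_add s2 summable_geometric) auto
    have "x \<le> 1 + x\<^sup>2" for x :: real
    proof -
      have "2 * x \<le> 1 + x\<^sup>2" using zero_le_power2[of "x - 1"] by (simp add: power2_eq_square algebra_simps)
      then show ?thesis using zero_le_power2[of x] by linarith
    qed
    from mult_left_mono[OF this, of "r ^ j" for j]
    show "norm (r ^ j * cmod (k (n + j))) \<le> r ^ j + r ^ j * (cmod (k (n + j)))\<^sup>2" for j
      using r by (simp add: distrib_left)
  qed
  have ple: "norm (P n j * k (n + j)) \<le> C * (r ^ j * cmod (k (n + j)))" for n j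
    using mult_right_mono[OF C[of n j], of "cmod (k (n + j))"] by (simp add: norm_mult P_def mult_ac)
  have sd: "summable (\<lambda>j. P n j * k (n + j))" for n
    by (rule summable_comparison_test'[where N = 0, OF summable_mult[OF s1, of C]]) (use ple in auto)
  have rec: "d n = k n + b n * d (Suc n)" for n
  proof -
    have "P n (Suc j) * k (n + Suc j) = b n * (P (Suc n) j * k (Suc n + j))" for j
      unfolding P_def by (subst prod.lessThan_Suc_shift) simp
    then have "(\<Sum>j. P n (Suc j) * k (n + Suc j)) = b n * d (Suc n)"
      unfolding d_def suminf_mult[OF sd, symmetric] by (simp only:)
    then show ?thesis
      using suminf_split_head[OF sd[of n]] by (simp add: d_def P_def)
  qed
  have dsq: "(cmod (d n))\<^sup>2 \<le> C\<^sup>2 / (1 - r) * (\<Sum>j. r ^ j * (cmod (k (n + j)))\<^sup>2)" for n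
  proof -
    have sn: "summable (\<lambda>j. norm (P n j * k (n + j)))"
      by (rule summable_comparison_test'[where N = 0, OF summable_mult[OF s1, of C]]) (use ple in auto)
    have "cmod (d n) \<le> (\<Sum>j. norm (P n j * k (n + j)))"
      unfolding d_def using sn by (rule summable_norm)
    also have "\<dots> \<le> (\<Sum>j. C * (r ^ j * cmod (k (n + j))))"
      using ple sn s1 by (intro suminf_le summable_mult) auto
    also have "\<dots> = C * (\<Sum>j. r ^ j * cmod (k (n + j)))" by (intro suminf_mult s1)
    finally have "(cmod (d n))\<^sup>2 \<le> (C * (\<Sum>j. r ^ j * cmod (k (n + j))))\<^sup>2" by (intro power_mono) auto
    also have "\<dots> = C\<^sup>2 * (\<Sum>j. r ^ j * cmod (k (n + j)))\<^sup>2" by (simp add: power_mult_distrib)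
    also have "\<dots> \<le> C\<^sup>2 * ((1 / (1 - r)) * (\<Sum>j. r ^ j * (cmod (k (n + j)))\<^sup>2))"
      by (intro mult_left_mono weighted_cauchy_schwarz_geometric r s1 s2) auto
    finally show ?thesis by simp
  qed
  have part: "(\<Sum>n<N. (cmod (d n))\<^sup>2 / (n + 1)) \<le> C\<^sup>2 / (1 - r) ^ 3 * K" for N
  proof -
    have "(\<Sum>n<N. (cmod (d n))\<^sup>2 / (n + 1)) \<le> (\<Sum>n<N. C\<^sup>2 / (1 - r) * (\<Sum>j. r ^ j * (cmod (k (n + j)))\<^sup>2) / (n + 1))"
      by (intro sum_mono divide_right_mono dsq) auto
    also have "\<dots> = C\<^sup>2 / (1 - r) * (\<Sum>n<N. \<Sum>j. r ^ j * (cmod (k (n + j)))\<^sup>2 / (n + 1))"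
      by (simp add: sum_distrib_left suminf_divide[OF s2])
    finally have outer: "(\<Sum>n<N. (cmod (d n))\<^sup>2 / (n + 1))
      \<le> C\<^sup>2 / (1 - r) * (\<Sum>n<N. \<Sum>j. r ^ j * (cmod (k (n + j)))\<^sup>2 / (n + 1))" .
    have "(\<Sum>n<N. \<Sum>j. r ^ j * (cmod (k (n + j)))\<^sup>2 / (n + 1))
        = (\<Sum>j. \<Sum>n<N. r ^ j * (cmod (k (n + j)))\<^sup>2 / (n + 1))"
      by (intro suminf_sum[symmetric] summable_divide s2)
    also have "\<dots> \<le> (\<Sum>j. K * (real (Suc j) * r ^ j))"
    proof (rule suminf_le)
      fix j
      have "(\<Sum>n<N. r ^ j * (cmod (k (n + j)))\<^sup>2 / (n + 1))
          \<le> (\<Sum>n<N. real (Suc j) * r ^ j * ((cmod (k (n + j)))\<^sup>2 / (n + j + 1)))"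
      proof (rule sum_mono)
        fix n
        \<comment> \<open>Moving the weight from index \<open>n\<close> to \<open>n + j\<close>
          costs a factor \<open>j + 1\<close>, since
          \<open>n + j + 1 \<le> (j + 1) * (n + 1)\<close>.\<close>
        have "1 / real (n + 1) \<le> real (Suc j) / real (n + j + 1)"
          by (simp add: field_simps)
        from mult_left_mono[OF this, of "r ^ j * (cmod (k (n + j)))\<^sup>2"] r
        show "r ^ j * (cmod (k (n + j)))\<^sup>2 / (n + 1)
            \<le> real (Suc j) * r ^ j * ((cmod (k (n + j)))\<^sup>2 / (n + j + 1))"
          by (simp add: mult_ac)
      qed
      also have "\<dots> = real (Suc j) * r ^ j * (\<Sum>n<N. (cmod (k (n + j)))\<^sup>2 / (n + j + 1))"
        by (simp add: sum_distrib_left)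
      also have "(\<Sum>n<N. (cmod (k (n + j)))\<^sup>2 / (n + j + 1)) = (\<Sum>m\<in>{j..<N + j}. (cmod (k m))\<^sup>2 / (m + 1))"
        using sum.shift_bounds_nat_ivl[of "\<lambda>m. (cmod (k m))\<^sup>2 / real (m + 1)" 0 j N]
        by (simp add: lessThan_atLeast0)
      also have "real (Suc j) * r ^ j * \<dots> \<le> real (Suc j) * r ^ j * K"
        unfolding K_def using k r
        by (intro mult_left_mono sum_le_suminf mult_nonneg_nonneg) (auto simp: bergman_seq_def)
      finally show "(\<Sum>n<N. r ^ j * (cmod (k (n + j)))\<^sup>2 / (n + 1)) \<le> K * (real (Suc j) * r ^ j)"
        by (simp only: mult_ac)
    next
      show "summable (\<lambda>j. \<Sum>n<N. r ^ j * (cmod (k (n + j)))\<^sup>2 / real (n + 1))"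
        by (intro summable_sum summable_divide s2)
      show "summable (\<lambda>j. K * (real (Suc j) * r ^ j))"
        using geometric_deriv_sums[of r] r by (intro summable_mult) (auto simp: sums_iff)
    qed
    also have "\<dots> = K * (1 / (1 - r)\<^sup>2)"
      using sums_unique[OF sums_mult[OF geometric_deriv_sums[of r], of K]] r by simp
    finally have "C\<^sup>2 / (1 - r) * (\<Sum>n<N. \<Sum>j. r ^ j * (cmod (k (n + j)))\<^sup>2 / (n + 1))
        \<le> C\<^sup>2 / (1 - r) * (K * (1 / (1 - r)\<^sup>2))"
      using r by (intro mult_left_mono) auto
    with outer have "(\<Sum>n<N. (cmod (d n))\<^sup>2 / (n + 1)) \<le> C\<^sup>2 / (1 - r) * (K * (1 / (1 - r)\<^sup>2))"
      by (rule order_trans)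
    then show ?thesis by (simp add: power2_eq_square power3_eq_cube mult_ac)
  qed
  have bd: "bergman_seq d"
    unfolding bergman_seq_def using part by (intro summableI_nonneg_bounded[where x = "C\<^sup>2 / (1 - r) ^ 3 * K"]) auto
  have "(\<Sum>n. (cmod (d n))\<^sup>2 / (n + 1)) \<le> C\<^sup>2 / (1 - r) ^ 3 * K"
    by (rule suminf_le_const[OF bd[unfolded bergman_seq_def] part])
  from that[OF bd rec this[unfolded K_def]] show ?thesis .
qed

end

text \<open>Any \<open>r\<close> strictly between \<open>cmod l\<close> and 1 dominates all factors
  from some index \<open>m\<close> on; at most \<open>m\<close> factors of a product come earlier,
  and each of those is at most \<open>B\<close>.\<close>

lemma product_geometric_bound:
  fixes b :: "nat \<Rightarrow> complex"
  assumes b: "b \<longlonglongrightarrow> l" and l: "cmod l < 1"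
  obtains C r where "0 \<le> r" "r < 1" "\<And>n j. cmod (\<Prod>i<j. b (n + i)) \<le> C * r ^ j"
proof -
  obtain r where r: "cmod l < r" "r < 1" using l dense by blast
  have r0: "0 < r" using r norm_ge_zero[of l] by linarith
  have "eventually (\<lambda>n. cmod (b n) < r) sequentially"
    using tendsto_norm[OF b] r by (intro order_tendstoD(2))
  then obtain m where m: "\<And>n. n \<ge> m \<Longrightarrow> cmod (b n) < r" by (auto simp: eventually_sequentially)
  have "Bseq b" using b convergent_def convergent_imp_Bseq by blast
  then obtain B0 where B0: "\<And>n. cmod (b n) \<le> B0" by (auto simp: Bseq_def)
  define B where "B = max B0 1"
  have B: "cmod (b n) \<le> B" "1 \<le> B" for n using B0[of n] by (auto simp: B_def)
  \<comment> \<open>Pays \<open>B / r\<close> for each index from \<open>n\<close> to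
    \<open>m - 1\<close>, and equals 1 for \<open>n \<ge> m\<close> by truncated subtraction. This
    makes \<open>phi n * r ^ j\<close> stable under splitting off the first factor.\<close>
  define phi where "phi = (\<lambda>n. (B / r) ^ (m - n))"
  have phi0: "0 \<le> phi n" for n using B r0 by (simp add: phi_def)
  have step: "cmod (b n) * phi (Suc n) \<le> r * phi n" for n
  proof (cases "n < m")
    case True
    then have "m - n = Suc (m - Suc n)" by simp
    then have "r * phi n = B * phi (Suc n)" using r0 by (simp add: phi_def)
    then show ?thesis using B(1)[of n] phi0 by (simp add: mult_right_mono)
  next
    case False
    then show ?thesis using m[of n] by (simp add: phi_def)
  qed
  have "cmod (\<Prod>i<j. b (n + i)) \<le> phi n * r ^ j" for n j
  proof (induction j arbitrary: n)
    case 0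
    have "1 \<le> B / r" using B(2) r r0 by (simp add: field_simps)
    then show ?case by (simp add: phi_def one_le_power)
  next
    case (Suc j)
    have "cmod (\<Prod>i<Suc j. b (n + i)) = cmod (b n) * cmod (\<Prod>i<j. b (Suc n + i))"
      by (subst prod.lessThan_Suc_shift) (simp add: norm_mult)
    also have "\<dots> \<le> cmod (b n) * (phi (Suc n) * r ^ j)"
      by (intro mult_left_mono Suc.IH) auto
    also have "\<dots> \<le> (r * phi n) * r ^ j"
      using mult_right_mono[OF step[of n], of "r ^ j"] r0 by (simp add: mult_ac)
    finally show ?case by (simp add: mult_ac)
  qed
  moreover have "phi n \<le> (B / r) ^ m" for n
    unfolding phi_def using B(2) r r0 by (intro power_increasing) (auto simp: field_simps)
  ultimately have "cmod (\<Prod>i<j. b (n + i)) \<le> (B / r) ^ m * r ^ j" for n j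
    using r0 by (meson mult_right_mono order_trans zero_le_power less_imp_le)
  with r r0 show ?thesis by (intro that[of r "(B / r) ^ m"]) auto
qed


section \<open>The Euler operator on Taylor coefficients\<close>

lemma taylor_euler_ode:
  assumes H: "H holomorphic_on disk"
  shows "taylor (\<lambda>z. (z - z0) * deriv H z - l * H z) n
    = (of_nat n - l) * taylor H n - z0 * (of_nat (Suc n) * taylor H (Suc n))"
proof -
  have h: "deriv H holomorphic_on disk" using H by (intro holomorphic_deriv) auto
  have "taylor (\<lambda>z. (z - z0) * deriv H z - l * H z) n
      = taylor (\<lambda>z. (z ^ 1 * deriv H z - z0 * deriv H z) - l * H z) n"
    by (rule taylor_cong) (simp add: algebra_simps)
  also have "\<dots> = taylor (\<lambda>z. z ^ 1 * deriv H z) n - z0 * taylor (deriv H) n - l * taylor H n"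
    by (subst taylor_diff taylor_cmult | intro holomorphic_intros h H)+ simp
  also have "taylor (\<lambda>z. z ^ 1 * deriv H z) n = of_nat n * taylor H n"
    unfolding taylor_power_mult[OF h] taylor_deriv[OF H] by (cases n) auto
  finally show ?thesis by (simp add: taylor_deriv[OF H] algebra_simps)
qed

lemma ratio_tendsto_one: "(\<lambda>n. of_nat (Suc n) / (of_nat (Suc n) - l :: complex)) \<longlonglongrightarrow> 1"
proof -
  have "(\<lambda>n. 1 / (1 - l / of_nat n)) \<longlonglongrightarrow> 1 / (1 - 0)"
    by (intro tendsto_intros lim_const_over_n) auto
  then have "(\<lambda>n. 1 / (1 - l / of_nat (Suc n))) \<longlonglongrightarrow> 1" using LIMSEQ_Suc by fastforce
  moreover have "1 / (1 - l / of_nat (Suc n)) = of_nat (Suc n) / (of_nat (Suc n) - l)" for n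
  proof -
    have "1 - l / of_nat (Suc n) = (of_nat (Suc n) - l) / of_nat (Suc n)"
      by (simp add: field_simps del: of_nat_Suc)
    then show ?thesis by simp
  qed
  ultimately show ?thesis by simp
qed

text \<open>In Taylor coefficients \<open>c\<close> of \<open>H\<close> the equation reads
  \<open>(n - l) c\<^sub>n = k\<^sub>n + z0 (n + 1) c\<^sub>n\<^sub>+\<^sub>1\<close>. It is solved backwards from infinity,
  which is possible at every step exactly because \<open>l\<close> is not a natural number; the
  factors tend to \<open>z0\<close>, so the solution is governed by a geometric series.\<close>

lemma euler_ode:
  assumes z0: "z0 \<in> disk" and l: "\<And>n. l \<noteq> of_nat n"
  obtains K where "0 \<le> K"
    "\<And>k. k \<in> bergman \<Longrightarrow> \<exists>H\<in>dirichlet. (\<forall>z\<in>disk. (z - z0) * deriv H z - l * H z = k z) \<and>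
        L2_norm_disk H \<le> K * L2_norm_disk k \<and> L2_norm_disk (deriv H) \<le> K * L2_norm_disk k"
    "\<And>H. H \<in> dirichlet \<Longrightarrow> \<forall>z\<in>disk. (z - z0) * deriv H z - l * H z = 0 \<Longrightarrow> \<forall>z\<in>disk. H z = 0"
proof -
  \<comment> \<open>In terms of \<open>d\<^sub>n = (n - l) c\<^sub>n\<close> the coefficient
    equation reads \<open>d n = k n + b n * d (Suc n)\<close>, the form that
    \<open>recurrence_solve\<close> and \<open>recurrence_unique\<close> handle.\<close>
  define q where "q = (\<lambda>n. of_nat (Suc n) / (of_nat (Suc n) - l))"
  define b where "b = (\<lambda>n. z0 * q n)"
  have nz: "of_nat n - l \<noteq> 0" for n using l[of n] by auto
  have qlim: "q \<longlonglongrightarrow> 1" unfolding q_def by (rule ratio_tendsto_one)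
  then have "b \<longlonglongrightarrow> z0 * 1" unfolding b_def by (intro tendsto_intros)
  then have "b \<longlonglongrightarrow> z0" by simp
  then obtain C r where r: "0 \<le> r" "r < 1" and C: "\<And>n j. cmod (\<Prod>i<j. b (n + i)) \<le> C * r ^ j"
    by (rule product_geometric_bound) (use z0 in \<open>auto simp: disk_iff intro: that\<close>)
  have "Bseq q" using qlim convergent_def convergent_imp_Bseq by blast
  then obtain A1 where A1: "\<And>n. cmod (q n) \<le> A1" by (auto simp: Bseq_def)
  \<comment> \<open>One constant for both \<open>q n\<close> and \<open>1 / (n - l)\<close>: for
    \<open>n > 0\<close> the latter is at most \<open>cmod (q (n - 1))\<close>, and
    \<open>n = 0\<close> contributes \<open>1 / cmod l\<close>.\<close>
  define A where "A = max A1 (1 / cmod l)"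
  have A0: "0 \<le> A" using order_trans[OF norm_ge_zero A1[of 0]] by (simp add: A_def le_max_iff_disj)
  have Aq: "cmod (q n) \<le> A" for n using A1[of n] by (simp add: A_def)
  have Ai: "cmod (1 / (of_nat n - l)) \<le> A" for n
  proof (cases n)
    case 0
    then show ?thesis by (simp add: A_def norm_divide)
  next
    case (Suc m)
    have "cmod (1 / (of_nat n - l)) \<le> real (Suc m) * cmod (1 / (of_nat n - l))"
      using mult_right_mono[of 1 "real (Suc m)" "cmod (1 / (of_nat n - l))"] by simp
    also have "\<dots> = cmod (q m)"
      unfolding q_def Suc norm_divide norm_of_nat by simp
    finally show ?thesis using Aq[of m] by simp
  qed
  define Q where "Q = C\<^sup>2 / (1 - r) ^ 3"
  have Q0: "0 \<le> Q" using r by (simp add: Q_def)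
  \<comment> \<open>\<open>A\<close> bounds the passage from \<open>d\<close> to the coefficients of
    \<open>H\<close> and \<open>deriv H\<close>, \<open>Q\<close> is the squared-norm cost of
    solving the recurrence, and 2 pays for \<open>1 / (n + 1) \<le> 2 / (n + 2)\<close> in the norm
    of \<open>deriv H\<close>.\<close>
  define K where "K = A * sqrt (2 * Q)"
  have K0: "0 \<le> K" using A0 Q0 by (simp add: K_def)
  have K2: "K\<^sup>2 = A\<^sup>2 * (2 * Q)" using Q0 by (simp add: K_def power_mult_distrib)
  have ex: "\<exists>H\<in>dirichlet. (\<forall>z\<in>disk. (z - z0) * deriv H z - l * H z = k z) \<and>
        L2_norm_disk H \<le> K * L2_norm_disk k \<and> L2_norm_disk (deriv H) \<le> K * L2_norm_disk k"
    if k: "k \<in> bergman" for k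
  proof -
    note ks = bergman_norm_sums[OF k]
    have kb: "bergman_seq (taylor k)" using ks by (auto simp: bergman_seq_def sums_iff)
    obtain d where d: "bergman_seq d" "\<And>n. d n = taylor k n + b n * d (Suc n)"
      "(\<Sum>n. (cmod (d n))\<^sup>2 / (n + 1)) \<le> Q * (\<Sum>n. (cmod (taylor k n))\<^sup>2 / (n + 1))"
      by (rule recurrence_solve[OF r C kb, folded Q_def]) (rule that)
    have ds: "summable (\<lambda>n. (cmod (d n))\<^sup>2 / (n + 1))" using d(1) by (simp add: bergman_seq_def)
    define D where "D = (\<Sum>n. (cmod (d n))\<^sup>2 / (n + 1))"
    have DQ: "D \<le> Q * (L2_norm_disk k)\<^sup>2" using d(3) sums_unique[OF ks] by (simp add: D_def)
    have D0: "0 \<le> D" unfolding D_def using ds by (intro suminf_nonneg) auto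
    define c where "c = (\<lambda>n. d n / (of_nat n - l))"
    have c_le: "cmod (c n) \<le> A * cmod (d n)" for n
      using mult_right_mono[OF Ai[of n], of "cmod (d n)"] by (simp add: c_def norm_divide)
    have c_le2: "(cmod (c n))\<^sup>2 / (n + 1) \<le> A\<^sup>2 * ((cmod (d n))\<^sup>2 / (n + 1))" for n
      using divide_right_mono[OF power_mono[OF c_le[of n] norm_ge_zero, of 2], of "real (n + 1)"]
      by (simp add: power_mult_distrib)
    have cb: "bergman_seq c"
      unfolding bergman_seq_def
      by (rule summable_comparison_test'[OF summable_mult[OF ds, of "A\<^sup>2"], of 0]) (use c_le2 in auto)
    obtain H where H: "H \<in> bergman" and tH: "taylor H = c" by (rule bergman_of_seq[OF cb]) (rule that)
    note hH = bergmanD(1)[OF H]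
    have hdH: "deriv H holomorphic_on disk" using hH by (intro holomorphic_deriv) auto
    have nH: "L2_norm_disk H \<le> K * L2_norm_disk k"
    proof (rule bergman_taylor_le(2)[OF hH])
      show "(cmod (taylor H n))\<^sup>2 / (n + 1) \<le> A\<^sup>2 * ((cmod (d n))\<^sup>2 / (n + 1))" for n
        unfolding tH by (rule c_le2)
      show "summable (\<lambda>n. A\<^sup>2 * ((cmod (d n))\<^sup>2 / (n + 1)))" by (rule summable_mult[OF ds])
      have "(\<Sum>n. A\<^sup>2 * ((cmod (d n))\<^sup>2 / (n + 1))) = A\<^sup>2 * D" unfolding D_def by (rule suminf_mult[OF ds])
      also have "\<dots> \<le> A\<^sup>2 * (2 * (Q * (L2_norm_disk k)\<^sup>2))"
        using DQ D0 by (intro mult_left_mono) auto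
      finally show "(\<Sum>n. A\<^sup>2 * ((cmod (d n))\<^sup>2 / (n + 1))) \<le> (K * L2_norm_disk k)\<^sup>2"
        by (simp add: power_mult_distrib K2 mult_ac)
    qed (use K0 in simp)
    have tdH: "taylor (deriv H) n = q n * d (Suc n)" for n
      unfolding taylor_deriv[OF hH] tH c_def q_def by simp
    have dH: "deriv H \<in> bergman" "L2_norm_disk (deriv H) \<le> K * L2_norm_disk k"
    proof -
      let ?u = "\<lambda>n. 2 * A\<^sup>2 * ((cmod (d (Suc n)))\<^sup>2 / (Suc n + 1))"
      have *: "(cmod (taylor (deriv H) n))\<^sup>2 / (n + 1) \<le> ?u n" for n
      proof -
        have "(cmod (taylor (deriv H) n))\<^sup>2 \<le> (A * cmod (d (Suc n)))\<^sup>2"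
          unfolding tdH norm_mult by (intro power_mono mult_right_mono Aq) auto
        then have "(cmod (taylor (deriv H) n))\<^sup>2 / (n + 1) \<le> A\<^sup>2 * (cmod (d (Suc n)))\<^sup>2 * (1 / real (n + 1))"
          using divide_right_mono[of _ _ "real (n + 1)"] by (simp add: power_mult_distrib)
        also have "\<dots> \<le> A\<^sup>2 * (cmod (d (Suc n)))\<^sup>2 * (2 / real (n + 2))"
          by (intro mult_left_mono) (auto simp: field_simps)
        finally show ?thesis by (simp add: mult_ac)
      qed
      have su0: "summable (\<lambda>n. (cmod (d (Suc n)))\<^sup>2 / (Suc n + 1))"
        using ds by (subst summable_Suc_iff)
      have su: "summable ?u" by (rule summable_mult[OF su0])
      have "(\<Sum>n. (cmod (d (Suc n)))\<^sup>2 / (Suc n + 1)) \<le> D"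
        using suminf_split_head[OF ds] by (simp add: D_def)
      then have "2 * A\<^sup>2 * (\<Sum>n. (cmod (d (Suc n)))\<^sup>2 / (Suc n + 1)) \<le> 2 * A\<^sup>2 * (Q * (L2_norm_disk k)\<^sup>2)"
        using DQ by (intro mult_left_mono) auto
      then have "suminf ?u \<le> (K * L2_norm_disk k)\<^sup>2"
        unfolding suminf_mult[OF su0] by (simp add: power_mult_distrib K2 mult_ac)
      from bergman_taylor_le[OF hdH * su this] K0
      show "deriv H \<in> bergman" "L2_norm_disk (deriv H) \<le> K * L2_norm_disk k" by auto
    qed
    have "(z - z0) * deriv H z - l * H z = k z" if "z \<in> disk" for z
    proof (rule holomorphic_eq_if_taylor_eq[OF _ bergmanD(1)[OF k] _ that])
      show "(\<lambda>z. (z - z0) * deriv H z - l * H z) holomorphic_on disk"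
        by (intro holomorphic_intros hH hdH)
      fix n
      have "taylor (\<lambda>z. (z - z0) * deriv H z - l * H z) n = d n - z0 * (of_nat (Suc n) * c (Suc n))"
        unfolding taylor_euler_ode[OF hH] tH using nz[of n] by (simp add: c_def)
      also have "of_nat (Suc n) * c (Suc n) = q n * d (Suc n)" by (simp add: c_def q_def)
      finally show "taylor (\<lambda>z. (z - z0) * deriv H z - l * H z) n = taylor k n"
        using d(2)[of n] by (simp add: b_def)
    qed
    with nH dH H show ?thesis by (auto simp: dirichlet_def)
  qed
  have uniq: "H z = 0" if H: "H \<in> dirichlet" and eq: "\<And>z. z \<in> disk \<Longrightarrow> (z - z0) * deriv H z - l * H z = 0"
    and z: "z \<in> disk" for H z
  proof -
    note Hd = dirichletD[OF H]
    define d where "d = (\<lambda>n. (of_nat n - l) * taylor H n)"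
    have t0: "taylor (\<lambda>z. (z - z0) * deriv H z - l * H z) n = 0" for n
    proof -
      have "taylor (\<lambda>z. (z - z0) * deriv H z - l * H z) n = taylor (\<lambda>z. 0) n"
        by (rule taylor_cong) (use eq in simp)
      also have "\<dots> = 0" by (subst taylor_eqI_fps[OF has_fps_expansion_0]) simp
      finally show ?thesis .
    qed
    have rec: "d n = b n * d (Suc n)" for n
    proof -
      have "d n = z0 * (of_nat (Suc n) * taylor H (Suc n))"
        using t0[of n] unfolding taylor_euler_ode[OF Hd(3)] by (simp add: d_def)
      also have "\<dots> = b n * d (Suc n)"
        using nz[of "Suc n"] by (simp add: b_def q_def d_def del: of_nat_Suc)
      finally show ?thesis .
    qed
    \<comment> \<open>\<open>d\<close> is the Taylor sequence of
      \<open>z * deriv H z - l * H z\<close>, by \<open>taylor_euler_ode\<close> with 0 in place of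
      \<open>z0\<close>; this function is in the Bergman space because \<open>H\<close> is in the
      Dirichlet space.\<close>
    have "bergman_seq d"
    proof -
      have "(\<lambda>z. z * deriv H z) \<in> bergman"
        using bergman_mult(1)[OF Hd(2), of "\<lambda>z. z" 1] by (auto simp: disk_iff intro!: holomorphic_intros)
      then have "(\<lambda>z. z * deriv H z - l * H z) \<in> bergman"
        using Hd(1) by (intro bergman_diff bergman_cmult)
      from sums_summable[OF bergman_norm_sums[OF this]]
      have "bergman_seq (taylor (\<lambda>z. (z - 0) * deriv H z - l * H z))" by (simp add: bergman_seq_def)
      moreover have "taylor (\<lambda>z. (z - 0) * deriv H z - l * H z) = d"
        unfolding fun_eq_iff taylor_euler_ode[OF Hd(3)] by (simp add: d_def)
      ultimately show ?thesis by (simp only:)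
    qed
    from recurrence_unique[OF r C this rec] have d0: "d n = 0" for n .
    have "taylor H n = 0" for n using d0[of n] nz[of n] by (simp add: d_def)
    then show ?thesis using taylor_sums[OF Hd(3) z] by (simp add: sums_iff)
  qed
  then have uniq': "\<forall>z\<in>disk. H z = 0"
    if "H \<in> dirichlet" "\<forall>z\<in>disk. (z - z0) * deriv H z - l * H z = 0" for H
    using that by blast
  show ?thesis by (rule that[OF K0 ex uniq'])
qed


section \<open>Reduction to the Euler equation\<close>

lemma deriv_cong_disk:
  assumes "\<And>z. z \<in> disk \<Longrightarrow> f z = g z" "z \<in> disk"
  shows "deriv f z = deriv g z"
proof (rule deriv_cong_ev[OF _ refl])
  show "eventually (\<lambda>z. f z = g z) (nhds z)"
    using eventually_nhds_in_open[OF open_disk assms(2)] by eventually_elim (use assms in auto)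
qed

lemma field_differentiable_disk:
  assumes "f holomorphic_on disk" "z \<in> disk"
  shows "f field_differentiable at z"
  using assms by (simp add: holomorphic_on_imp_differentiable_at)

text \<open>The bound on \<open>deriv m\<close> is what a Dirichlet multiplier needs beyond a
  Bergman multiplier. It is available for \<open>E\<close> and \<open>1 / E\<close>, but not for the
  factor \<open>q1\<close>, whose derivative may blow up at the circle.\<close>

lemma dirichlet_mult:
  assumes G: "G \<in> dirichlet" and m: "m holomorphic_on disk"
    and B: "\<And>z. z \<in> disk \<Longrightarrow> cmod (m z) \<le> B" "\<And>z. z \<in> disk \<Longrightarrow> cmod (deriv m z) \<le> B"
  shows "(\<lambda>z. m z * G z) \<in> dirichlet"
    and "L2_norm_disk (\<lambda>z. m z * G z) \<le> B * L2_norm_disk G"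
    and "L2_norm_disk (deriv (\<lambda>z. m z * G z)) \<le> 2 * B * (L2_norm_disk G + L2_norm_disk (deriv G))"
proof -
  note Gd = dirichletD[OF G]
  have hm: "deriv m holomorphic_on disk" using m by (intro holomorphic_deriv) auto
  have d: "deriv (\<lambda>z. m z * G z) z = m z * deriv G z + deriv m z * G z" if "z \<in> disk" for z
    using that m Gd(3) by (intro deriv_mult field_differentiable_disk)
  have b1: "(\<lambda>z. m z * G z) \<in> bergman" "L2_norm_disk (\<lambda>z. m z * G z) \<le> B * L2_norm_disk G"
    and b2: "(\<lambda>z. m z * deriv G z) \<in> bergman" "L2_norm_disk (\<lambda>z. m z * deriv G z) \<le> B * L2_norm_disk (deriv G)"
    and b3: "(\<lambda>z. deriv m z * G z) \<in> bergman" "L2_norm_disk (\<lambda>z. deriv m z * G z) \<le> B * L2_norm_disk G"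
    using bergman_mult[OF Gd(1) m B(1)] bergman_mult[OF Gd(2) m B(1)] bergman_mult[OF Gd(1) hm B(2)] by simp_all
  show "L2_norm_disk (\<lambda>z. m z * G z) \<le> B * L2_norm_disk G" by (rule b1(2))
  have "deriv (\<lambda>z. m z * G z) \<in> bergman \<longleftrightarrow> (\<lambda>z. m z * deriv G z + deriv m z * G z) \<in> bergman"
    using d by (rule bergman_cong)
  then have "deriv (\<lambda>z. m z * G z) \<in> bergman"
    using bergman_add(1)[OF b2(1) b3(1)] by blast
  with b1(1) show "(\<lambda>z. m z * G z) \<in> dirichlet" by (simp add: dirichlet_def)
  have "L2_norm_disk (deriv (\<lambda>z. m z * G z)) = L2_norm_disk (\<lambda>z. m z * deriv G z + deriv m z * G z)"
    using d by (rule L2_norm_disk_cong)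
  also have "\<dots> \<le> 2 * (B * L2_norm_disk (deriv G) + B * L2_norm_disk G)"
    by (rule order_trans[OF bergman_add(2)[OF b2(1) b3(1)]]) (intro mult_left_mono add_mono b2(2) b3(2), simp)
  finally show "L2_norm_disk (deriv (\<lambda>z. m z * G z)) \<le> 2 * B * (L2_norm_disk G + L2_norm_disk (deriv G))"
    by (simp add: algebra_simps)
qed

lemma dirichlet_diff:
  assumes "f \<in> dirichlet" "g \<in> dirichlet"
  shows "(\<lambda>z. f z - g z) \<in> dirichlet"
proof -
  note fd = dirichletD[OF assms(1)] and gd = dirichletD[OF assms(2)]
  have d: "deriv (\<lambda>z. f z - g z) z = deriv f z - deriv g z" if "z \<in> disk" for z
    using that fd gd by (intro deriv_diff field_differentiable_disk)
  have "deriv (\<lambda>z. f z - g z) \<in> bergman \<longleftrightarrow> (\<lambda>z. deriv f z - deriv g z) \<in> bergman"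
    using d by (rule bergman_cong)
  then have "deriv (\<lambda>z. f z - g z) \<in> bergman"
    using bergman_diff[OF fd(2) gd(2)] by blast
  then show ?thesis using bergman_diff[OF fd(1) gd(1)] by (simp add: dirichlet_def)
qed

lemma dirichlet_polynomial_power: "(\<lambda>z. (z - a) ^ n) \<in> dirichlet"
proof -
  have bd: "(\<lambda>z. c * (z - a) ^ m) \<in> bergman" for c m
  proof (rule bergman_bounded)
    fix z assume "z \<in> disk"
    then have "cmod (z - a) \<le> 1 + cmod a"
      using norm_triangle_ineq4[of z a] by (simp add: disk_iff)
    then show "cmod (c * (z - a) ^ m) \<le> cmod c * (1 + cmod a) ^ m"
      unfolding norm_mult norm_power by (intro mult_left_mono power_mono) auto
  qed (intro holomorphic_intros)
  have "deriv (\<lambda>z. (z - a) ^ n) z = of_nat n * (z - a) ^ (n - 1)" for z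
    by (intro DERIV_imp_deriv) (auto intro!: derivative_eq_intros)
  then have "deriv (\<lambda>z. (z - a) ^ n) = (\<lambda>z. of_nat n * (z - a) ^ (n - 1))" by auto
  then show ?thesis using bd[of 1 n] bd[of "of_nat n" "n - 1"] by (simp add: dirichlet_def)
qed

text \<open>Near \<open>z0\<close> the difference quotient is bounded by compactness of a small
  closed ball; outside that ball its denominator is at least \<open>e\<close>.\<close>

lemma bounded_holomorphic_slope:
  assumes F: "F holomorphic_on disk" and M: "\<And>z. z \<in> disk \<Longrightarrow> cmod (F z) \<le> M" and z0: "z0 \<in> disk"
  obtains S B where "S holomorphic_on disk" "\<And>z. z \<in> disk \<Longrightarrow> cmod (S z) \<le> B"
    "\<And>z. F z = F z0 + (z - z0) * S z" "S z0 = deriv F z0"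
proof -
  define S where "S = (\<lambda>z. if z = z0 then deriv F z0 else (F z - F z0) / (z - z0))"
  have hS: "S holomorphic_on disk"
    unfolding S_def using F by (rule pole_lemma_open) simp
  obtain e where e: "e > 0" "cball z0 e \<subseteq> disk" using z0 open_contains_cball by blast
  have "compact (S ` cball z0 e)"
    using hS e by (intro compact_continuous_image holomorphic_on_imp_continuous_on holomorphic_on_subset[OF hS]) auto
  then obtain B1 where B1: "\<And>z. z \<in> cball z0 e \<Longrightarrow> cmod (S z) \<le> B1"
    using compact_imp_bounded bounded_iff by (metis imageI)
  have bnd: "cmod (S z) \<le> max B1 (2 * M / e)" if z: "z \<in> disk" for z
  proof (cases "z \<in> cball z0 e")
    case False
    then have d: "e < cmod (z - z0)" by (simp add: dist_norm norm_minus_commute)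
    have "cmod (F z - F z0) \<le> 2 * M"
      using norm_triangle_ineq4[of "F z" "F z0"] M[OF z] M[OF z0] by linarith
    then have "cmod (F z - F z0) / cmod (z - z0) \<le> 2 * M / e"
      using d e order_trans[OF norm_ge_zero M[OF z]] by (intro frac_le) auto
    moreover have "z \<noteq> z0" using d e by auto
    ultimately show ?thesis by (simp add: S_def norm_divide)
  qed (use B1 in \<open>auto simp: max_def intro: order_trans\<close>)
  have eq: "F z = F z0 + (z - z0) * S z" for z by (simp add: S_def)
  show ?thesis
    by (rule that[of S "max B1 (2 * M / e)"]) (fact hS, erule bnd, fact eq, simp add: S_def)
qed

text \<open>\<open>E\<close> is the exponential of a primitive of \<open>S\<close>. The primitive is
  bounded because \<open>S\<close> is bounded and the disk is convex, hence \<open>E\<close> is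
  bounded above and away from 0.\<close>

lemma bounded_exp_primitive:
  assumes S: "S holomorphic_on disk" and B: "\<And>z. z \<in> disk \<Longrightarrow> cmod (S z) \<le> B"
  obtains E B' where "E holomorphic_on disk" "\<And>z. E z \<noteq> 0"
    "\<And>z. z \<in> disk \<Longrightarrow> cmod (E z) \<le> B'" "\<And>z. z \<in> disk \<Longrightarrow> cmod (1 / E z) \<le> B'"
    "\<And>z. z \<in> disk \<Longrightarrow> (E has_field_derivative S z * E z) (at z)"
    "\<And>z. z \<in> disk \<Longrightarrow> ((\<lambda>z. 1 / E z) has_field_derivative - (S z / E z)) (at z)"
proof -
  obtain R where R: "\<And>z. z \<in> disk \<Longrightarrow> (R has_field_derivative S z) (at z within disk)"
    using holomorphic_convex_primitive[of disk "{}" S] S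
    by (metis convex_disk finite.emptyI holomorphic_on_imp_continuous_on Diff_empty interior_open open_disk
        field_differentiable_disk)
  then have R': "(R has_field_derivative S z) (at z)" if "z \<in> disk" for z
    using that by (metis at_within_open open_disk)
  have Rb: "cmod (R z) \<le> cmod (R 0) + B" if z: "z \<in> disk" for z
  proof -
    have "cmod (R z - R 0) \<le> B * cmod (z - 0)"
      by (rule field_differentiable_bound[OF convex_disk R B z zero_in_disk])
    also have "\<dots> \<le> B * 1"
      using z B[OF z] by (intro mult_left_mono) (auto simp: disk_iff intro: order_trans[OF norm_ge_zero])
    finally show ?thesis using norm_triangle_sub[of "R z" "R 0"] by linarith
  qed
  define E where "E = (\<lambda>z. exp (R z))"
  define B' where "B' = exp (cmod (R 0) + B)"
  have dE: "(E has_field_derivative S z * E z) (at z)" if "z \<in> disk" for z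
    unfolding E_def using R'[OF that] by (auto intro!: derivative_eq_intros)
  have nz: "E z \<noteq> 0" for z by (simp add: E_def)
  have inv: "1 / E z = exp (- R z)" for z by (simp add: E_def exp_minus field_simps)
  have dI: "((\<lambda>z. 1 / E z) has_field_derivative - (S z / E z)) (at z)" if "z \<in> disk" for z
    using dE[OF that] nz by (auto intro!: derivative_eq_intros)
  have bE: "cmod (E z) \<le> B'" if "z \<in> disk" for z
    using Rb[OF that] abs_Re_le_cmod[of "R z"] by (simp add: E_def B'_def)
  have bI: "cmod (1 / E z) \<le> B'" if "z \<in> disk" for z
    unfolding inv using Rb[OF that] abs_Re_le_cmod[of "R z"] by (simp add: B'_def)
  have hE: "E holomorphic_on disk"
    using dE by (auto simp: holomorphic_on_open)
  show ?thesis
    by (rule that[of E B']) (fact hE, fact nz, erule bE, erule bI, erule dE, erule dI)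
qed

section \<open>Kernel and range through an integrating factor\<close>

context
  fixes p :: "complex \<Rightarrow> complex" and M :: real
  assumes p: "p holomorphic_on disk" and M: "\<And>z. z \<in> disk \<Longrightarrow> cmod (p z) \<le> M"
begin

text \<open>The lower bound annihilates \<open>dirichlet_lift G\<close>, whose coefficients are
  those of \<open>G\<close> times the nonzero factors \<open>n + 1\<close>.\<close>

lemma toeplitz_ode_kernel_trivial:
  assumes C: "\<forall>G\<in>dirichlet. L2_norm_disk (dirichlet_lift G) \<le> C * L2_norm_disk (toeplitz_ode p G)"
    and G: "G \<in> dirichlet" and ker: "\<And>z. z \<in> disk \<Longrightarrow> toeplitz_ode p G z = 0" and z: "z \<in> disk"
  shows "G z = 0"
proof -
  have "L2_norm_disk (toeplitz_ode p G) = L2_norm_disk (\<lambda>z. 0)"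
    using ker by (rule L2_norm_disk_cong)
  then have "L2_norm_disk (toeplitz_ode p G) = 0"
    by (simp add: L2_norm_disk_def set_lebesgue_integral_def)
  with C G have "L2_norm_disk (dirichlet_lift G) \<le> 0" by force
  then have "L2_norm_disk (dirichlet_lift G) = 0" by (simp add: antisym)
  then have "cmod (taylor (dirichlet_lift G) n) \<le> 0" for n
    using taylor_le_L2_norm[OF dirichlet_lift_bergman(1)[OF G], of n] by simp
  then have "taylor (\<lambda>z. G z + z * deriv G z) n = 0" for n
    by (simp add: dirichlet_lift_def[abs_def])
  then have "taylor G n = 0" for n
    using taylor_add_mult_deriv[OF dirichletD(3)[OF G], of n] by (simp del: of_nat_Suc)
  then show ?thesis using taylor_sums[OF dirichletD(3)[OF G] z] by (simp add: sums_iff)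
qed

text \<open>With \<open>S = p / (1 + z p)\<close> the zero-free function \<open>1 / E\<close> lies
  in the kernel; the bound \<open>d\<close> makes \<open>S\<close> bounded, which puts
  \<open>1 / E\<close> into the Dirichlet space.\<close>

lemma not_injective_if_no_zeros:
  assumes C: "\<forall>G\<in>dirichlet. L2_norm_disk (dirichlet_lift G) \<le> C * L2_norm_disk (toeplitz_ode p G)"
    and d: "0 < d" "\<And>z. z \<in> disk \<Longrightarrow> d \<le> cmod (1 + z * p z)"
  shows False
proof -
  have nz: "1 + z * p z \<noteq> 0" if "z \<in> disk" for z using d(2)[OF that] d(1) by auto
  define S where "S = (\<lambda>z. p z / (1 + z * p z))"
  have hS: "S holomorphic_on disk" unfolding S_def using p nz by (intro holomorphic_intros)
  have bS: "cmod (S z) \<le> M / d" if "z \<in> disk" for z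
    unfolding S_def norm_divide using d M[OF that] d(2)[OF that]
    by (intro frac_le) (auto intro: order_trans[OF norm_ge_zero])
  obtain E B where E: "E holomorphic_on disk" "\<And>z. E z \<noteq> 0"
    "\<And>z. z \<in> disk \<Longrightarrow> cmod (E z) \<le> B" "\<And>z. z \<in> disk \<Longrightarrow> cmod (1 / E z) \<le> B"
    "\<And>z. z \<in> disk \<Longrightarrow> (E has_field_derivative S z * E z) (at z)"
    "\<And>z. z \<in> disk \<Longrightarrow> ((\<lambda>z. 1 / E z) has_field_derivative - (S z / E z)) (at z)"
    by (rule bounded_exp_primitive[OF hS bS]) (assumption | rule that)+
  define G where "G = (\<lambda>z. 1 / E z)"
  have hG: "G holomorphic_on disk" unfolding G_def using E by (intro holomorphic_intros) auto
  have dG: "deriv G z = - (S z * (1 / E z))" if "z \<in> disk" for z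
    unfolding G_def using DERIV_imp_deriv[OF E(6)[OF that]] by simp
  have "G \<in> bergman" using E(4) by (intro bergman_bounded[OF hG]) (auto simp: G_def)
  moreover have "deriv G \<in> bergman"
  proof (rule bergman_bounded)
    show "deriv G holomorphic_on disk" using hG by (intro holomorphic_deriv) auto
    show "cmod (deriv G z) \<le> (M / d) * B" if "z \<in> disk" for z
      unfolding dG[OF that] norm_minus_cancel norm_mult using bS[OF that] E(4)[OF that]
      by (intro mult_mono) (auto intro: order_trans[OF norm_ge_zero])
  qed
  ultimately have "G \<in> dirichlet" by (simp add: dirichlet_def)
  moreover have "toeplitz_ode p G z = 0" if "z \<in> disk" for z
    unfolding toeplitz_ode_def dG[OF that] using nz[OF that] by (simp add: S_def G_def)
  ultimately have "G 0 = 0" by (rule toeplitz_ode_kernel_trivial[OF C]) auto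
  then show False using E(2) by (simp add: G_def)
qed

text \<open>Reduction to the Euler equation \<open>(z - z0) H' - l H = k\<close>: divide by the zero-free factor of
  \<open>1 + z p\<close> and absorb the regular part of \<open>p\<close> over that factor into the integrating factor \<open>E\<close>.\<close>

lemma euler_normal_form:
  assumes z0: "z0 \<in> disk" and q1: "q1 holomorphic_on disk" "\<And>z. z \<in> disk \<Longrightarrow> 1 + z * p z = (z - z0) * q1 z"
    and d: "0 < d" "\<And>z. z \<in> disk \<Longrightarrow> d \<le> cmod (q1 z)" "\<And>z. z \<in> disk \<Longrightarrow> cmod (q1 z) \<le> D"
  obtains E W B where "E holomorphic_on disk" "W holomorphic_on disk"
    "\<And>z. E z \<noteq> 0" "\<And>z. z \<in> disk \<Longrightarrow> W z \<noteq> 0"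
    "\<And>z. z \<in> disk \<Longrightarrow> cmod (E z) \<le> B" "\<And>z. z \<in> disk \<Longrightarrow> cmod (deriv E z) \<le> B"
    "\<And>z. z \<in> disk \<Longrightarrow> cmod (1 / E z) \<le> B" "\<And>z. z \<in> disk \<Longrightarrow> cmod (deriv (\<lambda>z. 1 / E z) z) \<le> B"
    "\<And>z. z \<in> disk \<Longrightarrow> cmod (W z) \<le> B"
    "\<And>G z. G holomorphic_on disk \<Longrightarrow> z \<in> disk \<Longrightarrow>
       (z - z0) * deriv (\<lambda>z. E z * G z) z - (- (p z0 / q1 z0)) * (E z * G z) = W z * toeplitz_ode p G z"
proof -
  have nz: "q1 z \<noteq> 0" if "z \<in> disk" for z using d(2)[OF that] d(1) by auto
  define P where "P = (\<lambda>z. p z / q1 z)"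
  have hP: "P holomorphic_on disk" unfolding P_def using p q1 nz by (intro holomorphic_intros)
  have bP: "cmod (P z) \<le> M / d" if "z \<in> disk" for z
    unfolding P_def norm_divide using d M[OF that] d(2)[OF that]
    by (intro frac_le) (auto intro: order_trans[OF norm_ge_zero])
  \<comment> \<open>After solving for \<open>deriv G\<close>, the coefficient of \<open>G\<close> is
    \<open>- P z / (z - z0)\<close>. The residue of \<open>P z / (z - z0)\<close> is
    \<open>P z0\<close>, which becomes \<open>- l\<close>; the regular part is \<open>S\<close>,
    which \<open>E\<close> absorbs.\<close>
  obtain S B1 where S: "S holomorphic_on disk" "\<And>z. z \<in> disk \<Longrightarrow> cmod (S z) \<le> B1"
    "\<And>z. P z = P z0 + (z - z0) * S z"
    by (rule bounded_holomorphic_slope[OF hP bP z0]) (assumption | rule that)+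
  obtain E B where E: "E holomorphic_on disk" "\<And>z. E z \<noteq> 0"
    "\<And>z. z \<in> disk \<Longrightarrow> cmod (E z) \<le> B" "\<And>z. z \<in> disk \<Longrightarrow> cmod (1 / E z) \<le> B"
    "\<And>z. z \<in> disk \<Longrightarrow> (E has_field_derivative S z * E z) (at z)"
    "\<And>z. z \<in> disk \<Longrightarrow> ((\<lambda>z. 1 / E z) has_field_derivative - (S z / E z)) (at z)"
    by (rule bounded_exp_primitive[OF S(1,2)]) (assumption | rule that)+
  have B0: "0 \<le> B" using order_trans[OF norm_ge_zero E(3)[OF zero_in_disk]] .
  have B10: "0 \<le> B1" using order_trans[OF norm_ge_zero S(2)[OF zero_in_disk]] .
  \<comment> \<open>\<open>W\<close> carries the division by \<open>q1\<close>. It multiplies only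
    the right-hand side of the equation, so its derivative need not be bounded.\<close>
  define W where "W = (\<lambda>z. E z / q1 z)"
  define B' where "B' = max B (max (B1 * B) (B / d))"
  have B': "B \<le> B'" "B1 * B \<le> B'" "B / d \<le> B'" by (auto simp: B'_def)
  show ?thesis
  proof (rule that[of E W B'])
    show "W holomorphic_on disk" unfolding W_def using E q1 nz by (intro holomorphic_intros)
    show "W z \<noteq> 0" if "z \<in> disk" for z using E nz[OF that] by (simp add: W_def)
    show "cmod (E z) \<le> B'" "cmod (1 / E z) \<le> B'" if "z \<in> disk" for z
      using E(3,4)[OF that] B' by auto
    show "cmod (deriv E z) \<le> B'" if "z \<in> disk" for z
    proof -
      have "cmod (deriv E z) \<le> B1 * B"
        unfolding DERIV_imp_deriv[OF E(5)[OF that]] norm_mult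
        using S(2)[OF that] E(3)[OF that] B10 by (intro mult_mono) auto
      then show ?thesis using B' by linarith
    qed
    show "cmod (deriv (\<lambda>z. 1 / E z) z) \<le> B'" if "z \<in> disk" for z
    proof -
      have "cmod (deriv (\<lambda>z. 1 / E z) z) = cmod (S z) * cmod (1 / E z)"
        unfolding DERIV_imp_deriv[OF E(6)[OF that]] by (simp add: norm_divide)
      also have "\<dots> \<le> B1 * B"
        using S(2)[OF that] E(4)[OF that] B10 by (intro mult_mono) auto
      finally show ?thesis using B' by linarith
    qed
    show "cmod (W z) \<le> B'" if "z \<in> disk" for z
    proof -
      have "cmod (W z) \<le> B / d"
        unfolding W_def norm_divide using d(1) d(2)[OF that] E(3)[OF that] B0 by (intro frac_le) auto
      then show ?thesis using B' by linarith
    qed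
    fix G z assume G: "G holomorphic_on disk" and z: "z \<in> disk"
    have dEG: "deriv (\<lambda>z. E z * G z) z = E z * deriv G z + S z * E z * G z"
      using deriv_mult[OF field_differentiable_disk[OF E(1) z] field_differentiable_disk[OF G z]]
      by (simp add: DERIV_imp_deriv[OF E(5)[OF z]])
    have "(z - z0) * deriv (\<lambda>z. E z * G z) z - (- (p z0 / q1 z0)) * (E z * G z)
        = E z * ((z - z0) * deriv G z + (P z0 + (z - z0) * S z) * G z)"
      unfolding dEG by (simp add: P_def algebra_simps)
    also have "P z0 + (z - z0) * S z = P z" using S(3)[of z] by simp
    also have "E z * ((z - z0) * deriv G z + P z * G z) = W z * ((z - z0) * q1 z * deriv G z + p z * G z)"
      using nz[OF z] by (simp add: W_def P_def field_simps)
    finally show "(z - z0) * deriv (\<lambda>z. E z * G z) z - (- (p z0 / q1 z0)) * (E z * G z) = W z * toeplitz_ode p G z"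
      by (simp add: toeplitz_ode_def q1(2)[OF z])
  qed (use E in auto)
qed

text \<open>\<open>(z - z0) ^ n\<close> solves the homogeneous Euler equation with
  \<open>l = n\<close>; dividing by \<open>E\<close> carries it into the kernel of
  \<open>toeplitz_ode p\<close>.\<close>

lemma not_injective_if_resonant:
  assumes C: "\<forall>G\<in>dirichlet. L2_norm_disk (dirichlet_lift G) \<le> C * L2_norm_disk (toeplitz_ode p G)"
    and z0: "z0 \<in> disk" and q1: "q1 holomorphic_on disk" "\<And>z. z \<in> disk \<Longrightarrow> 1 + z * p z = (z - z0) * q1 z"
    and d: "0 < d" "\<And>z. z \<in> disk \<Longrightarrow> d \<le> cmod (q1 z)" "\<And>z. z \<in> disk \<Longrightarrow> cmod (q1 z) \<le> D"
    and l: "- (p z0 / q1 z0) = of_nat n"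
  shows False
proof -
  obtain E W B where E: "E holomorphic_on disk" "W holomorphic_on disk"
    "\<And>z. E z \<noteq> 0" "\<And>z. z \<in> disk \<Longrightarrow> W z \<noteq> 0"
    "\<And>z. z \<in> disk \<Longrightarrow> cmod (E z) \<le> B" "\<And>z. z \<in> disk \<Longrightarrow> cmod (deriv E z) \<le> B"
    "\<And>z. z \<in> disk \<Longrightarrow> cmod (1 / E z) \<le> B" "\<And>z. z \<in> disk \<Longrightarrow> cmod (deriv (\<lambda>z. 1 / E z) z) \<le> B"
    "\<And>z. z \<in> disk \<Longrightarrow> cmod (W z) \<le> B"
    "\<And>G z. G holomorphic_on disk \<Longrightarrow> z \<in> disk \<Longrightarrow>
       (z - z0) * deriv (\<lambda>z. E z * G z) z - (- (p z0 / q1 z0)) * (E z * G z) = W z * toeplitz_ode p G z"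
    by (rule euler_normal_form[OF z0 q1 d]) (assumption | rule that)+
  define G where "G = (\<lambda>z. 1 / E z * (z - z0) ^ n)"
  have hE: "(\<lambda>z. 1 / E z) holomorphic_on disk" using E by (intro holomorphic_intros) auto
  have G: "G \<in> dirichlet" unfolding G_def
    by (rule dirichlet_mult[OF dirichlet_polynomial_power hE E(7,8)])
  have EG: "(\<lambda>z. E z * G z) = (\<lambda>z. (z - z0) ^ n)" using E(3) by (auto simp: G_def)
  have "toeplitz_ode p G z = 0" if z: "z \<in> disk" for z
  proof -
    have "deriv (\<lambda>z. (z - z0) ^ n) z = of_nat n * (z - z0) ^ (n - 1)"
      by (intro DERIV_imp_deriv) (auto intro!: derivative_eq_intros)
    then have "(z - z0) * deriv (\<lambda>z. (z - z0) ^ n) z = of_nat n * (z - z0) ^ n"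
      by (cases n) auto
    then have "W z * toeplitz_ode p G z = 0"
      unfolding E(10)[OF dirichletD(3)[OF G] z, symmetric] EG l using fun_cong[OF EG, of z] by simp
    then show ?thesis using E(4)[OF z] by simp
  qed
  from toeplitz_ode_kernel_trivial[OF C G this] have "G 0 = 0" by simp
  \<comment> \<open>At \<open>z = 0\<close> the factorisation reads \<open>1 = - z0 * q1 0\<close>.
    Hence \<open>G 0\<close>, a multiple of \<open>(- z0) ^ n\<close>, cannot vanish.\<close>
  moreover have "z0 \<noteq> 0" using q1(2)[of 0] by auto
  ultimately show False using E(3) by (simp add: G_def)
qed

text \<open>Solvability is that of the Euler equation conjugated by \<open>E\<close>. For the lower
  bound, the Euler equation with right-hand side \<open>W z * toeplitz_ode p G z\<close> has a
  solution with a norm estimate, and uniqueness identifies it with \<open>E z * G z\<close>.\<close>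

lemma invertible_if_nonresonant:
  assumes z0: "z0 \<in> disk" and q1: "q1 holomorphic_on disk" "\<And>z. z \<in> disk \<Longrightarrow> 1 + z * p z = (z - z0) * q1 z"
    and d: "0 < d" "\<And>z. z \<in> disk \<Longrightarrow> d \<le> cmod (q1 z)" "\<And>z. z \<in> disk \<Longrightarrow> cmod (q1 z) \<le> D"
    and l: "\<And>n. - (p z0 / q1 z0) \<noteq> of_nat n"
  shows "toeplitz_invertible (\<lambda>z. cnj z + p z)"
proof -
  define l where "l = - (p z0 / q1 z0)"
  obtain E W B where E: "E holomorphic_on disk" "W holomorphic_on disk"
    "\<And>z. E z \<noteq> 0" "\<And>z. z \<in> disk \<Longrightarrow> W z \<noteq> 0"
    "\<And>z. z \<in> disk \<Longrightarrow> cmod (E z) \<le> B" "\<And>z. z \<in> disk \<Longrightarrow> cmod (deriv E z) \<le> B"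
    "\<And>z. z \<in> disk \<Longrightarrow> cmod (1 / E z) \<le> B" "\<And>z. z \<in> disk \<Longrightarrow> cmod (deriv (\<lambda>z. 1 / E z) z) \<le> B"
    "\<And>z. z \<in> disk \<Longrightarrow> cmod (W z) \<le> B"
    "\<And>G z. G holomorphic_on disk \<Longrightarrow> z \<in> disk \<Longrightarrow>
       (z - z0) * deriv (\<lambda>z. E z * G z) z - l * (E z * G z) = W z * toeplitz_ode p G z"
    by (rule euler_normal_form[OF z0 q1 d, folded l_def]) (assumption | rule that)+
  obtain K where K: "0 \<le> K"
    "\<And>k. k \<in> bergman \<Longrightarrow> \<exists>H\<in>dirichlet. (\<forall>z\<in>disk. (z - z0) * deriv H z - l * H z = k z) \<and>
        L2_norm_disk H \<le> K * L2_norm_disk k \<and> L2_norm_disk (deriv H) \<le> K * L2_norm_disk k"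
    "\<And>H. H \<in> dirichlet \<Longrightarrow> \<forall>z\<in>disk. (z - z0) * deriv H z - l * H z = 0 \<Longrightarrow> \<forall>z\<in>disk. H z = 0"
    by (rule euler_ode[OF z0 l[folded l_def]]) (rule that)
  have hE: "(\<lambda>z. 1 / E z) holomorphic_on disk" using E by (intro holomorphic_intros) auto
  have B0: "0 \<le> B" using order_trans[OF norm_ge_zero E(5)[OF zero_in_disk]] .
  have surj: "\<exists>G\<in>dirichlet. \<forall>z\<in>disk. toeplitz_ode p G z = g z" if g: "g \<in> bergman" for g
  proof -
    have "(\<lambda>z. W z * g z) \<in> bergman" by (rule bergman_mult[OF g E(2,9)])
    from K(2)[OF this] obtain H where H: "H \<in> dirichlet" "\<And>z. z \<in> disk \<Longrightarrow> (z - z0) * deriv H z - l * H z = W z * g z"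
      by blast
    define G where "G = (\<lambda>z. 1 / E z * H z)"
    have G: "G \<in> dirichlet" unfolding G_def by (rule dirichlet_mult[OF H(1) hE E(7,8)])
    have EG: "(\<lambda>z. E z * G z) = H" using E(3) by (auto simp: G_def)
    have "W z * toeplitz_ode p G z = W z * g z" if z: "z \<in> disk" for z
      unfolding E(10)[OF dirichletD(3)[OF G] z, symmetric] EG using H(2)[OF z] fun_cong[OF EG, of z] by simp
    then show ?thesis using E(4) G by (intro bexI[of _ G]) auto
  qed
  \<comment> \<open>The 10 is \<open>2 * (1 + 4)\<close>: up to the common factor, \<open>G\<close>
    costs 1, \<open>deriv G\<close> costs 4, and \<open>dirichlet_lift_bergman\<close> doubles their
    sum. One \<open>B\<close> comes from \<open>1 / E\<close>, the other from
    \<open>W\<close>.\<close>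
  have bound: "L2_norm_disk (dirichlet_lift G) \<le> 10 * B * B * K * L2_norm_disk (toeplitz_ode p G)"
    if G: "G \<in> dirichlet" for G
  proof -
    define H where "H = (\<lambda>z. E z * G z)"
    have H: "H \<in> dirichlet" unfolding H_def by (rule dirichlet_mult[OF G E(1,5,6)])
    let ?k = "\<lambda>z. W z * toeplitz_ode p G z"
    have tb: "toeplitz_ode p G \<in> bergman" by (rule toeplitz_ode_bergman[OF p M G])
    have k: "?k \<in> bergman" "L2_norm_disk ?k \<le> B * L2_norm_disk (toeplitz_ode p G)"
      by (rule bergman_mult[OF tb E(2,9)], assumption)+
    from K(2)[OF k(1)] obtain H' where H': "H' \<in> dirichlet"
      "\<And>z. z \<in> disk \<Longrightarrow> (z - z0) * deriv H' z - l * H' z = ?k z"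
      "L2_norm_disk H' \<le> K * L2_norm_disk ?k" "L2_norm_disk (deriv H') \<le> K * L2_norm_disk ?k" by blast
    have D: "(\<lambda>z. H z - H' z) \<in> dirichlet" using H H'(1) by (rule dirichlet_diff)
    have "\<forall>z\<in>disk. H z - H' z = 0"
    proof (rule K(3)[OF D], rule ballI)
      fix z assume z: "z \<in> disk"
      have dd: "deriv (\<lambda>z. H z - H' z) z = deriv H z - deriv H' z"
        using z dirichletD(3)[OF H] dirichletD(3)[OF H'(1)] by (intro deriv_diff field_differentiable_disk)
      have "(z - z0) * deriv H z - l * H z = ?k z"
        unfolding H_def by (rule E(10)[OF dirichletD(3)[OF G] z])
      moreover have "(z - z0) * (deriv H z - deriv H' z) - l * (H z - H' z)
          = ((z - z0) * deriv H z - l * H z) - ((z - z0) * deriv H' z - l * H' z)"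
        by (simp add: algebra_simps)
      ultimately show "(z - z0) * deriv (\<lambda>z. H z - H' z) z - l * (H z - H' z) = 0"
        unfolding dd using H'(2)[OF z] by simp
    qed
    then have HH': "H z = H' z" if "z \<in> disk" for z using that by simp
    define N where "N = B * L2_norm_disk (toeplitz_ode p G)"
    have KN: "K * L2_norm_disk ?k \<le> K * N" unfolding N_def using k(2) K(1) by (rule mult_left_mono)
    have nH: "L2_norm_disk H \<le> K * N" "L2_norm_disk (deriv H) \<le> K * N"
      using H'(3,4) KN L2_norm_disk_cong[OF HH'] L2_norm_disk_cong[OF deriv_cong_disk[OF HH']] by auto
    have GH: "G = (\<lambda>z. 1 / E z * H z)" using E(3) by (auto simp: H_def)
    have "L2_norm_disk G \<le> B * L2_norm_disk H"
      unfolding GH by (rule dirichlet_mult(2)[OF H hE E(7,8)])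
    also have "\<dots> \<le> B * (K * N)" using nH B0 by (intro mult_left_mono)
    finally have nG: "L2_norm_disk G \<le> B * (K * N)" .
    have "L2_norm_disk (deriv G) \<le> 2 * B * (L2_norm_disk H + L2_norm_disk (deriv H))"
      unfolding GH by (rule dirichlet_mult(3)[OF H hE E(7,8)])
    also have "\<dots> \<le> 2 * B * (K * N + K * N)" using nH B0 by (intro mult_left_mono add_mono) auto
    finally have "L2_norm_disk (deriv G) \<le> 4 * (B * (K * N))" by simp
    with nG have "2 * (L2_norm_disk G + L2_norm_disk (deriv G)) \<le> 2 * (B * (K * N) + 4 * (B * (K * N)))"
      by (intro mult_left_mono add_mono) auto
    with dirichlet_lift_bergman(2)[OF G] have "L2_norm_disk (dirichlet_lift G) \<le> 2 * (B * (K * N) + 4 * (B * (K * N)))"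
      by (rule order_trans)
    then show ?thesis by (simp add: N_def mult_ac)
  qed
  show ?thesis
  proof (rule toeplitz_invertible_iff_ode[THEN iffD2, OF p M])
    show "(\<forall>g\<in>bergman. \<exists>G\<in>dirichlet. \<forall>z\<in>disk. toeplitz_ode p G z = g z) \<and>
      (\<exists>C. \<forall>G\<in>dirichlet. L2_norm_disk (dirichlet_lift G) \<le> C * L2_norm_disk (toeplitz_ode p G))"
      using surj bound by (intro conjI exI[of _ "10 * B * B * K"] ballI)
  qed
qed

end


section \<open>Zeros on the circle\<close>

text \<open>By orthogonality the squared norm of \<open>h\<close> is its pairing with
  \<open>g\<close>; the arithmetic-geometric inequality splits the pairing, and half of that squared
  norm is absorbed. Thus a lower bound for the Toeplitz operator becomes one for multiplication by
  the symbol.\<close>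

lemma bergman_proj_norm_le:
  assumes g: "continuous_on disk g" "set_integrable lborel disk (\<lambda>z. (cmod (g z))\<^sup>2)"
    and proj: "is_bergman_proj g h"
  shows "L2_norm_disk h \<le> L2_norm_disk g"
proof -
  have h: "h \<in> bergman" and o: "L2_inner (\<lambda>z. g z - h z) h = 0"
    using proj by (auto simp: is_bergman_proj_def)
  note hd = bergmanD[OF h]
  have i1: "set_integrable lborel disk (\<lambda>z. g z * cnj (h z))"
    by (rule set_integrable_disk_mult_cnj[OF g hd(2,3)])
  have i2: "set_integrable lborel disk (\<lambda>z. h z * cnj (h z))"
    by (rule set_integrable_disk_mult_cnj[OF hd(2,3) hd(2,3)])
  have "L2_inner (\<lambda>z. g z - h z) h = L2_inner g h - L2_inner h h"
    unfolding L2_inner_def right_diff_distrib[symmetric] set_integral_diff(2)[OF i1 i2, symmetric]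
    by (simp add: left_diff_distrib)
  with o have "complex_of_real ((L2_norm_disk h)\<^sup>2) = L2_inner g h" by (simp add: L2_inner_self)
  then have "(L2_norm_disk h)\<^sup>2 = cmod (L2_inner g h)" by (metis norm_of_real abs_of_nonneg zero_le_power2)
  also have "\<dots> = (1 / pi) * cmod (LINT z:disk|lborel. g z * cnj (h z))"
    by (simp add: L2_inner_def norm_mult norm_divide)
  also have "\<dots> \<le> (1 / pi) * (LINT z:disk|lborel. (cmod (g z))\<^sup>2 / 2 + (cmod (h z))\<^sup>2 / 2)"
  proof (rule mult_left_mono)
    have "cmod (LINT z:disk|lborel. g z * cnj (h z)) \<le> (LINT z:disk|lborel. cmod (g z * cnj (h z)))"
      by (rule set_integral_norm_bound[OF i1])
    also have "\<dots> \<le> (LINT z:disk|lborel. (cmod (g z))\<^sup>2 / 2 + (cmod (h z))\<^sup>2 / 2)"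
    proof (rule set_integral_mono)
      show "set_integrable lborel disk (\<lambda>z. cmod (g z * cnj (h z)))"
        using i1 by (rule set_integrable_norm)
      show "set_integrable lborel disk (\<lambda>z. (cmod (g z))\<^sup>2 / 2 + (cmod (h z))\<^sup>2 / 2)"
        using g hd by (intro set_integral_add set_integrable_divide) auto
      show "cmod (g z * cnj (h z)) \<le> (cmod (g z))\<^sup>2 / 2 + (cmod (h z))\<^sup>2 / 2" for z
        using zero_le_power2[of "cmod (g z) - cmod (h z)"]
        by (simp add: norm_mult power2_eq_square algebra_simps)
    qed
    finally show "cmod (LINT z:disk|lborel. g z * cnj (h z)) \<le> (LINT z:disk|lborel. (cmod (g z))\<^sup>2 / 2 + (cmod (h z))\<^sup>2 / 2)" .
  qed simp
  also have "(LINT z:disk|lborel. (cmod (g z))\<^sup>2 / 2 + (cmod (h z))\<^sup>2 / 2)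
      = (LINT z:disk|lborel. (cmod (g z))\<^sup>2) / 2 + (LINT z:disk|lborel. (cmod (h z))\<^sup>2) / 2"
    using g hd by (subst set_integral_add(2)) auto
  finally have "(L2_norm_disk h)\<^sup>2 \<le> (L2_norm_disk g)\<^sup>2"
    unfolding L2_norm_disk_sq by (simp add: field_simps)
  then show ?thesis by (rule power2_le_imp_le) simp
qed

text \<open>The powers of \<open>(1 + cnj \<zeta> z) / 2\<close> concentrate at \<open>\<zeta>\<close>, where the symbol vanishes.\<close>

lemma not_bounded_below_if_boundary_zero:
  assumes phi: "continuous_on (cball 0 1) phi" and zeta: "cmod \<zeta> = 1" "phi \<zeta> = 0"
    and C: "\<And>f. f \<in> bergman \<Longrightarrow> L2_norm_disk f \<le> C * L2_norm_disk (\<lambda>z. phi z * f z)" and C0: "0 \<le> C"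
  shows False
proof -
  have dc: "disk \<subseteq> cball 0 1" by (auto simp: disk_iff)
  obtain M where M: "\<And>z. z \<in> cball 0 1 \<Longrightarrow> cmod (phi z) \<le> M"
    using compact_imp_bounded[OF compact_continuous_image[OF phi compact_cball]] bounded_iff by (metis imageI)
  \<comment> \<open>Gives \<open>C * eps \<le> 1 / 2\<close>, so that the contribution near
    \<open>\<zeta>\<close> can be absorbed; the summand 1 covers \<open>C = 0\<close>.\<close>
  define eps where "eps = 1 / (2 * (C + 1))"
  have eps: "eps > 0" "C * eps \<le> 1 / 2" using C0 by (auto simp: eps_def field_simps)
  obtain del where del: "del > 0" "\<And>z. z \<in> cball 0 1 \<Longrightarrow> dist z \<zeta> < del \<Longrightarrow> cmod (phi z) \<le> eps"
  proof -
    have "\<zeta> \<in> cball 0 1" using zeta by simp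
    then obtain del where "del > 0" "\<forall>z\<in>cball 0 1. dist z \<zeta> < del \<longrightarrow> dist (phi z) (phi \<zeta>) < eps"
      using phi eps(1) unfolding continuous_on_iff by blast
    then show ?thesis using zeta by (intro that[of del]) (auto simp: less_imp_le)
  qed
  define m where "m = (\<lambda>z. (1 + cnj \<zeta> * z) / 2)"
  have cm: "continuous_on S m" for S unfolding m_def by (intro continuous_intros) simp
  \<comment> \<open>The midpoint of 1 and a point \<open>w\<close> of the closed disk has modulus 1
    only for \<open>w = 1\<close>.\<close>
  have m1: "cmod (m z) < 1" if "z \<in> cball 0 1" "z \<noteq> \<zeta>" for z
  proof -
    define w where "w = cnj \<zeta> * z"
    have w1: "cmod w \<le> 1" using that zeta by (simp add: w_def norm_mult)
    have "\<zeta> * w = z"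
      using zeta complex_norm_square[of \<zeta>] by (simp add: w_def mult.assoc[symmetric])
    then have wne: "w \<noteq> 1" using that by auto
    have "Re w < 1"
    proof (rule ccontr)
      assume "\<not> Re w < 1"
      then have "Re w = 1" using w1 complex_Re_le_cmod[of w] by linarith
      then have "(Im w)\<^sup>2 \<le> 0"
        using w1 cmod_power2[of w] power_mono[OF w1, of 2] by simp
      then show False using \<open>Re w = 1\<close> wne by (auto simp: complex_eq_iff)
    qed
    have "(cmod (1 + w))\<^sup>2 = 1 + 2 * Re w + (cmod w)\<^sup>2"
      unfolding cmod_power2 by (simp add: power2_eq_square algebra_simps)
    also have "\<dots> < 2\<^sup>2" using \<open>Re w < 1\<close> power_mono[OF w1, of 2] by simp
    finally have "cmod (1 + w) < 2" by (rule power2_less_imp_less) simp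
    then show ?thesis by (simp add: m_def w_def norm_divide)
  qed
  obtain rho where rho: "0 \<le> rho" "rho < 1" "\<And>z. z \<in> cball 0 1 - ball \<zeta> del \<Longrightarrow> cmod (m z) \<le> rho"
  proof (cases "cball 0 1 - ball \<zeta> del = {}")
    case True
    then show ?thesis by (intro that[of 0]) auto
  next
    case False
    have "compact (cball 0 1 - ball \<zeta> del)" by (intro compact_diff) auto
    moreover have "continuous_on (cball 0 1 - ball \<zeta> del) (\<lambda>z. cmod (m z))"
      by (intro continuous_on_norm cm)
    ultimately obtain x where x: "x \<in> cball 0 1 - ball \<zeta> del"
      "\<forall>y\<in>cball 0 1 - ball \<zeta> del. cmod (m y) \<le> cmod (m x)"
      using continuous_attains_sup[OF _ False] by blast
    then have "cmod (m x) < 1" using del(1) by (intro m1) auto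
    with x show ?thesis by (intro that[of "cmod (m x)"]) auto
  qed
  \<comment> \<open>Away from \<open>\<zeta>\<close> the powers of \<open>m\<close> are at most
    \<open>rho ^ n\<close>, yet on a whole ball inside the disk they will be at least
    \<open>rho' ^ n\<close>; this gap yields the contradiction.\<close>
  obtain rho' where rho': "rho < rho'" "rho' < 1" using rho(2) dense by blast
  obtain x s where xs: "s > 0" "ball x s \<subseteq> disk" "\<And>z. z \<in> ball x s \<Longrightarrow> rho' \<le> cmod (m z)"
  proof -
    define U where "U = disk \<inter> {z. rho' < cmod (m z)}"
    have "open {z. rho' < cmod (m z)}" using cm by (intro open_Collect_less continuous_intros)
    then have "open U" unfolding U_def by (intro open_Int) auto
    \<comment> \<open>\<open>m\<close> maps this point to \<open>(1 + rho') / 2\<close>, which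
      exceeds \<open>rho'\<close>.\<close>
    moreover have "of_real rho' * \<zeta> \<in> U"
    proof -
      have "cnj \<zeta> * (of_real rho' * \<zeta>) = of_real rho'"
        using zeta complex_norm_square[of \<zeta>] by (simp add: mult_ac)
      then have "m (of_real rho' * \<zeta>) = of_real ((1 + rho') / 2)" by (simp add: m_def)
      then have "cmod (m (of_real rho' * \<zeta>)) = (1 + rho') / 2"
        using rho rho' by (simp only: norm_of_real) simp
      then show ?thesis using rho rho' zeta by (simp add: U_def disk_iff norm_mult)
    qed
    ultimately obtain s where "s > 0" "ball (of_real rho' * \<zeta>) s \<subseteq> U" using open_contains_ball by blast
    then show ?thesis by (intro that[of s "of_real rho' * \<zeta>"]) (auto simp: U_def less_imp_le subset_iff)
  qed
  define f where "f = (\<lambda>n z. m z ^ n)"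
  have mle: "cmod (m z) \<le> 1" if "z \<in> disk" for z
    using m1[of z] that zeta by (cases "z = \<zeta>") (auto simp: disk_iff less_imp_le)
  have fb: "f n \<in> bergman" for n
  proof (rule bergman_bounded)
    show "f n holomorphic_on disk" unfolding f_def m_def by (intro holomorphic_intros) simp
    show "cmod (f n z) \<le> 1" if "z \<in> disk" for z
      using mle[OF that] by (simp add: f_def norm_power power_le_one)
  qed
  define N where "N = (\<lambda>n. LINT z:disk|lborel. (cmod (f n z))\<^sup>2)"
  have const: "set_integrable lborel disk (\<lambda>z. c)" "(LINT z:disk|lborel. c) = c * pi" for c :: real
  proof -
    have "emeasure lborel disk < \<infinity>" unfolding disk_def by (rule emeasure_lborel_ball_finite)
    then show "set_integrable lborel disk (\<lambda>z. c)" by (simp add: set_integrable_def)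
    show "(LINT z:disk|lborel. c) = c * pi"
      using content_ball_complex[of 1 0] by (simp add: set_lebesgue_integral_def disk_def)
  qed
  \<comment> \<open>The near part enters with factor \<open>(C * eps)\<^sup>2 \<le> 1 / 2\<close>;
    absorbing it into the left side produces the leading 2.\<close>
  have upper: "N n \<le> 2 * C\<^sup>2 * M\<^sup>2 * pi * rho ^ (2 * n)" for n
  proof -
    note fd = bergmanD[OF fb[of n]]
    let ?g = "\<lambda>z. phi z * f n z"
    have gc: "continuous_on disk ?g"
      using fd(2) continuous_on_subset[OF phi dc] by (intro continuous_intros)
    have pt: "(cmod (?g z))\<^sup>2 \<le> eps\<^sup>2 * (cmod (f n z))\<^sup>2 + M\<^sup>2 * rho ^ (2 * n)" if z: "z \<in> disk" for z
    proof (cases "z \<in> ball \<zeta> del")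
      case True
      then have "cmod (phi z) \<le> eps" using del(2)[of z] z dc by (auto simp: dist_commute)
      then have "(cmod (phi z))\<^sup>2 * (cmod (f n z))\<^sup>2 \<le> eps\<^sup>2 * (cmod (f n z))\<^sup>2"
        by (intro mult_right_mono power_mono) auto
      moreover have "0 \<le> M\<^sup>2 * rho ^ (2 * n)" using rho by simp
      ultimately show ?thesis unfolding norm_mult power_mult_distrib by linarith
    next
      case False
      then have "cmod (m z) \<le> rho" using rho(3)[of z] z dc by auto
      then have "(cmod (f n z))\<^sup>2 \<le> rho ^ (2 * n)"
        unfolding f_def norm_power power_mult[symmetric] mult.commute[of n 2] by (intro power_mono) auto
      moreover have "(cmod (phi z))\<^sup>2 \<le> M\<^sup>2" using M[of z] z dc by (intro power_mono) auto
      ultimately have "(cmod (phi z))\<^sup>2 * (cmod (f n z))\<^sup>2 \<le> M\<^sup>2 * rho ^ (2 * n)"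
        by (intro mult_mono) auto
      moreover have "0 \<le> eps\<^sup>2 * (cmod (f n z))\<^sup>2" by simp
      ultimately show ?thesis unfolding norm_mult power_mult_distrib by linarith
    qed
    have i1: "set_integrable lborel disk (\<lambda>z. eps\<^sup>2 * (cmod (f n z))\<^sup>2 + M\<^sup>2 * rho ^ (2 * n))"
      using fd(3) const(1) by (intro set_integral_add set_integrable_mult_right) auto
    have i2: "set_integrable lborel disk (\<lambda>z. (cmod (?g z))\<^sup>2)"
      by (rule set_integrable_disk_bound[OF i1]) (use gc pt in \<open>auto intro!: continuous_intros\<close>)
    have "(LINT z:disk|lborel. (cmod (?g z))\<^sup>2) \<le> (LINT z:disk|lborel. eps\<^sup>2 * (cmod (f n z))\<^sup>2 + M\<^sup>2 * rho ^ (2 * n))"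
      using i1 i2 pt by (intro set_integral_mono) auto
    also have "\<dots> = (LINT z:disk|lborel. eps\<^sup>2 * (cmod (f n z))\<^sup>2) + (LINT z:disk|lborel. M\<^sup>2 * rho ^ (2 * n))"
      using fd(3) const(1) by (intro set_integral_add(2) set_integrable_mult_right) auto
    also have "\<dots> = eps\<^sup>2 * N n + M\<^sup>2 * rho ^ (2 * n) * pi"
      unfolding const(2) N_def by simp
    finally have g2: "(LINT z:disk|lborel. (cmod (?g z))\<^sup>2) \<le> eps\<^sup>2 * N n + M\<^sup>2 * rho ^ (2 * n) * pi" .
    have "(L2_norm_disk (f n))\<^sup>2 \<le> (C * L2_norm_disk ?g)\<^sup>2"
      using C[OF fb] by (intro power_mono) auto
    then have "N n \<le> C\<^sup>2 * (LINT z:disk|lborel. (cmod (?g z))\<^sup>2)"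
      unfolding power_mult_distrib L2_norm_disk_sq N_def by (simp add: field_simps)
    also have "\<dots> \<le> C\<^sup>2 * (eps\<^sup>2 * N n + M\<^sup>2 * rho ^ (2 * n) * pi)"
      using g2 by (intro mult_left_mono) auto
    also have "\<dots> = (C * eps)\<^sup>2 * N n + C\<^sup>2 * M\<^sup>2 * pi * rho ^ (2 * n)"
      by (simp add: power_mult_distrib algebra_simps)
    finally have *: "N n \<le> (C * eps)\<^sup>2 * N n + C\<^sup>2 * M\<^sup>2 * pi * rho ^ (2 * n)" .
    have "0 \<le> N n" unfolding N_def set_lebesgue_integral_def by (intro Bochner_Integration.integral_nonneg) auto
    moreover have "(C * eps)\<^sup>2 \<le> (1 / 2)\<^sup>2" using eps C0 by (intro power_mono) auto
    ultimately have "(C * eps)\<^sup>2 * N n \<le> (1 / 2) * N n"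
      by (intro mult_right_mono) (auto simp: power2_eq_square)
    with * show ?thesis by linarith
  qed
  define c where "c = measure lborel (ball x s)"
  have c0: "c > 0" unfolding c_def using xs(1) content_ball_complex[of s x] by simp
  have lower: "c * rho' ^ (2 * n) \<le> N n" for n
  proof -
    have fin: "emeasure lborel (ball x s) < \<infinity>" by (rule emeasure_lborel_ball_finite)
    have i: "integrable lborel (\<lambda>z. indicator (ball x s) z * rho' ^ (2 * n))"
      using fin by (intro integrable_mult_left integrable_real_indicator) auto
    have "c * rho' ^ (2 * n) = (LINT z|lborel. indicator (ball x s) z * rho' ^ (2 * n))"
      using fin by (simp add: c_def)
    also have "\<dots> \<le> N n"
      unfolding N_def set_lebesgue_integral_def
    proof (rule Bochner_Integration.integral_mono[OF i])
      show "integrable lborel (\<lambda>z. indicat_real disk z *\<^sub>R (cmod (f n z))\<^sup>2)"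
        using bergmanD(3)[OF fb] by (simp add: set_integrable_def)
      show "indicator (ball x s) z * rho' ^ (2 * n) \<le> indicat_real disk z *\<^sub>R (cmod (f n z))\<^sup>2" for z
      proof (cases "z \<in> ball x s")
        case True
        have "rho' ^ (2 * n) \<le> (cmod (f n z))\<^sup>2"
          unfolding f_def norm_power power_mult[symmetric] mult.commute[of n 2]
          using xs(3)[OF True] rho rho' by (intro power_mono) auto
        then show ?thesis using True xs(2) by auto
      qed simp
    qed
    finally show ?thesis .
  qed
  define D where "D = 2 * C\<^sup>2 * M\<^sup>2 * pi"
  have "c \<le> D * ((rho / rho')\<^sup>2) ^ n" for n
  proof -
    have "c * rho' ^ (2 * n) \<le> D * rho ^ (2 * n)"
      using lower[of n] upper[of n] by (simp add: D_def)
    then have "c \<le> D * rho ^ (2 * n) / rho' ^ (2 * n)"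
      using rho rho' by (simp add: field_simps)
    then show ?thesis by (simp add: power_mult[symmetric] power_divide)
  qed
  moreover have "(\<lambda>n. D * ((rho / rho')\<^sup>2) ^ n) \<longlonglongrightarrow> D * 0"
  proof (intro tendsto_mult_left LIMSEQ_power_zero)
    have "rho / rho' < 1" using rho rho' by simp
    then show "norm ((rho / rho')\<^sup>2) < 1" using rho rho' by (simp add: abs_square_less_1)
  qed
  ultimately have "c \<le> D * 0" by (intro LIMSEQ_le_const) blast+
  then show False using c0 by simp
qed


section \<open>Two zeros in the disk\<close>

text \<open>Gaussian elimination by induction on the equations: equation \<open>j\<close> is solved
  for an unknown \<open>i0\<close> with nonzero coefficient, and the result is substituted into the
  others.\<close>

lemma homogeneous_system_nontrivial_solution:
  fixes v :: "'j \<Rightarrow> 'i \<Rightarrow> 'a::field"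
  assumes "finite J" "finite I" "card J < card I"
  shows "\<exists>c. (\<exists>i\<in>I. c i \<noteq> 0) \<and> (\<forall>j\<in>J. (\<Sum>i\<in>I. c i * v j i) = 0)"
  using assms
proof (induction J arbitrary: I v rule: finite_induct)
  case empty
  then have "I \<noteq> {}" by auto
  then show ?case by (intro exI[of _ "\<lambda>_. 1"]) auto
next
  case (insert j J)
  show ?case
  proof (cases "\<forall>i\<in>I. v j i = 0")
    case True
    from insert.IH[of I v] insert.prems insert.hyps
    obtain c where "\<exists>i\<in>I. c i \<noteq> 0" "\<forall>j\<in>J. (\<Sum>i\<in>I. c i * v j i) = 0" by auto
    with True show ?thesis by (intro exI[of _ c]) auto
  next
    case False
    then obtain i0 where i0: "i0 \<in> I" "v j i0 \<noteq> 0" by blast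
    define I' where "I' = I - {i0}"
    have fin: "finite I'" and I: "I = insert i0 I'" "i0 \<notin> I'" using insert.prems i0 by (auto simp: I'_def)
    have "card J < card I'" using insert.prems insert.hyps i0 by (simp add: I'_def)
    from insert.IH[OF fin this, of "\<lambda>k i. v k i - v k i0 / v j i0 * v j i"]
    obtain c where c: "\<exists>i\<in>I'. c i \<noteq> 0"
      "\<And>k. k \<in> J \<Longrightarrow> (\<Sum>i\<in>I'. c i * (v k i - v k i0 / v j i0 * v j i)) = 0" by blast
    define s where "s = (\<Sum>i\<in>I'. c i * v j i)"
    define c' where "c' = c(i0 := - s / v j i0)"
    have sum: "(\<Sum>i\<in>I. c' i * v k i) = - s / v j i0 * v k i0 + (\<Sum>i\<in>I'. c i * v k i)" for k
    proof -
      have "(\<Sum>i\<in>I'. c' i * v k i) = (\<Sum>i\<in>I'. c i * v k i)"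
        using I(2) by (intro sum.cong) (auto simp: c'_def)
      then show ?thesis using fin I by (simp add: c'_def)
    qed
    have "(\<Sum>i\<in>I. c' i * v k i) = 0" if "k \<in> J" for k
    proof -
      have "0 = (\<Sum>i\<in>I'. c i * v k i) - v k i0 / v j i0 * s"
        using c(2)[OF that] by (simp add: s_def right_diff_distrib sum_subtractf sum_distrib_left mult_ac)
      then show ?thesis unfolding sum by (simp add: mult_ac)
    qed
    moreover have "(\<Sum>i\<in>I. c' i * v j i) = 0" unfolding sum using i0 by (simp add: s_def)
    moreover have "\<exists>i\<in>I. c' i \<noteq> 0" using c(1) I by (auto simp: c'_def)
    ultimately show ?thesis by (intro exI[of _ c']) auto
  qed
qed

text \<open>A bounded linear functional on the Bergman space. Since elements are total functions, it
  must also ignore their values off the disk.\<close>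

definition bergman_functional :: "((complex \<Rightarrow> complex) \<Rightarrow> complex) \<Rightarrow> bool" where
  "bergman_functional e \<longleftrightarrow>
    (\<forall>f\<in>bergman. \<forall>g\<in>bergman. e (\<lambda>z. f z + g z) = e f + e g) \<and>
    (\<forall>f\<in>bergman. \<forall>c. e (\<lambda>z. c * f z) = c * e f) \<and>
    (\<forall>f g. (\<forall>z\<in>disk. f z = g z) \<longrightarrow> e f = e g) \<and>
    (\<exists>N. \<forall>f\<in>bergman. cmod (e f) \<le> N * L2_norm_disk f)"

lemma bergman_functionalD:
  assumes "bergman_functional e"
  shows "f \<in> bergman \<Longrightarrow> g \<in> bergman \<Longrightarrow> e (\<lambda>z. f z + g z) = e f + e g"
    "f \<in> bergman \<Longrightarrow> e (\<lambda>z. c * f z) = c * e f"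
    "(\<And>z. z \<in> disk \<Longrightarrow> f z = g z) \<Longrightarrow> e f = e g"
    "\<exists>N\<ge>0. \<forall>f\<in>bergman. cmod (e f) \<le> N * L2_norm_disk f"
proof -
  show "f \<in> bergman \<Longrightarrow> g \<in> bergman \<Longrightarrow> e (\<lambda>z. f z + g z) = e f + e g"
    "f \<in> bergman \<Longrightarrow> e (\<lambda>z. c * f z) = c * e f"
    using assms unfolding bergman_functional_def by blast+
  show "(\<And>z. z \<in> disk \<Longrightarrow> f z = g z) \<Longrightarrow> e f = e g"
    using assms unfolding bergman_functional_def by blast
  obtain N where N: "\<And>f. f \<in> bergman \<Longrightarrow> cmod (e f) \<le> N * L2_norm_disk f"
    using assms unfolding bergman_functional_def by blast
  have "cmod (e f) \<le> \<bar>N\<bar> * L2_norm_disk f" if "f \<in> bergman" for f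
    by (rule order_trans[OF N[OF that] mult_right_mono[OF abs_ge_self L2_norm_disk_nonneg]])
  then show "\<exists>N\<ge>0. \<forall>f\<in>bergman. cmod (e f) \<le> N * L2_norm_disk f"
    by (intro exI[of _ "\<bar>N\<bar>"]) auto
qed

lemma bergman_functional_sum:
  assumes fin: "finite I" and e: "\<And>i. i \<in> I \<Longrightarrow> bergman_functional (e i)"
  shows "bergman_functional (\<lambda>f. \<Sum>i\<in>I. c i * e i f)"
proof -
  have "\<exists>N. \<forall>i\<in>I. \<forall>f\<in>bergman. cmod (e i f) \<le> N i * L2_norm_disk f"
    using bergman_functionalD(4)[OF e] by (intro bchoice) blast
  then obtain N where N: "\<And>i f. i \<in> I \<Longrightarrow> f \<in> bergman \<Longrightarrow> cmod (e i f) \<le> N i * L2_norm_disk f" by blast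
  have "cmod (\<Sum>i\<in>I. c i * e i f) \<le> (\<Sum>i\<in>I. cmod (c i) * N i) * L2_norm_disk f" if "f \<in> bergman" for f
  proof -
    have "cmod (\<Sum>i\<in>I. c i * e i f) \<le> (\<Sum>i\<in>I. cmod (c i) * (N i * L2_norm_disk f))"
      by (rule sum_norm_le) (use N that in \<open>auto simp: norm_mult intro!: mult_left_mono\<close>)
    then show ?thesis by (simp add: sum_distrib_right mult.assoc)
  qed
  moreover have "(\<Sum>i\<in>I. c i * e i (\<lambda>z. f z + g z)) = (\<Sum>i\<in>I. c i * e i f) + (\<Sum>i\<in>I. c i * e i g)"
    if "f \<in> bergman" "g \<in> bergman" for f g
    using bergman_functionalD(1)[OF e that] by (simp add: sum.distrib[symmetric] distrib_left)
  moreover have "(\<Sum>i\<in>I. c i * e i (\<lambda>z. a * f z)) = a * (\<Sum>i\<in>I. c i * e i f)" if "f \<in> bergman" for f a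
    using bergman_functionalD(2)[OF e that] by (simp add: sum_distrib_left mult_ac)
  moreover have "(\<Sum>i\<in>I. c i * e i f) = (\<Sum>i\<in>I. c i * e i g)" if "\<forall>z\<in>disk. f z = g z" for f g
    using bergman_functionalD(3)[OF e, of _ f g] that by (intro sum.cong) auto
  ultimately show ?thesis unfolding bergman_functional_def by blast
qed

lemma bergman_functional_taylor: "bergman_functional (\<lambda>f. taylor f n)"
  unfolding bergman_functional_def
proof (intro conjI ballI allI impI)
  show "\<exists>N. \<forall>f\<in>bergman. cmod (taylor f n) \<le> N * L2_norm_disk f" using taylor_le_L2_norm by blast
qed (auto simp: taylor_add taylor_cmult bergmanD(1) intro!: taylor_cong)

text \<open>Coefficient \<open>n\<close> of \<open>f\<close> is at most \<open>n + 1\<close> times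
  the norm, which explains the weight in the summability hypothesis.\<close>

lemma bergman_functional_series:
  assumes e: "\<And>f. f \<in> bergman \<Longrightarrow> (\<lambda>n. taylor f n * a n) sums e f"
    and a: "summable (\<lambda>n. real (n + 1) * cmod (a n))"
  shows "\<exists>N. \<forall>f\<in>bergman. cmod (e f) \<le> N * L2_norm_disk f"
proof (intro exI ballI)
  fix f assume f: "f \<in> bergman"
  have le: "norm (taylor f n * a n) \<le> L2_norm_disk f * (real (n + 1) * cmod (a n))" for n
    using mult_right_mono[OF taylor_le_L2_norm[OF f, of n], of "cmod (a n)"] by (simp add: norm_mult mult_ac)
  have sn: "summable (\<lambda>n. norm (taylor f n * a n))"
    by (rule summable_comparison_test'[OF summable_mult[OF a, of "L2_norm_disk f"], of 0]) (use le in auto)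
  have "cmod (e f) \<le> (\<Sum>n. norm (taylor f n * a n))"
    using summable_norm[OF sn] sums_unique[OF e[OF f]] by simp
  also have "\<dots> \<le> (\<Sum>n. L2_norm_disk f * (real (n + 1) * cmod (a n)))"
    by (rule suminf_le[OF le sn summable_mult[OF a]])
  also have "\<dots> = (\<Sum>n. real (n + 1) * cmod (a n)) * L2_norm_disk f"
    using suminf_mult[OF a] by (simp add: mult.commute)
  finally show "cmod (e f) \<le> (\<Sum>n. real (n + 1) * cmod (a n)) * L2_norm_disk f" .
qed

lemma bergman_functional_eval:
  assumes "w \<in> disk"
  shows "bergman_functional (\<lambda>f. f w)"
  unfolding bergman_functional_def
proof (intro conjI ballI allI impI)
  show "\<exists>N. \<forall>f\<in>bergman. cmod (f w) \<le> N * L2_norm_disk f"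
  proof (rule bergman_functional_series)
    show "(\<lambda>n. taylor f n * w ^ n) sums f w" if "f \<in> bergman" for f
      by (rule taylor_sums[OF bergmanD(1)[OF that] assms])
    show "summable (\<lambda>n. real (n + 1) * cmod (w ^ n))"
      using summable_linear_times_power[of "cmod w" 0] assms by (simp add: disk_iff norm_power mult_ac)
  qed
qed (use assms in auto)

lemma bergman_functional_deriv:
  assumes w: "w \<in> disk"
  shows "bergman_functional (\<lambda>f. deriv f w)"
  unfolding bergman_functional_def
proof (intro conjI ballI allI impI)
  let ?a = "\<lambda>n. of_nat n * w ^ (n - 1)"
  show "\<exists>N. \<forall>f\<in>bergman. cmod (deriv f w) \<le> N * L2_norm_disk f"
  proof (rule bergman_functional_series[where a = ?a])
    fix f assume "f \<in> bergman"
    then have f: "f holomorphic_on disk" by (rule bergmanD)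
    then have "deriv f holomorphic_on disk" by (intro holomorphic_deriv) auto
    from taylor_sums[OF this w] have "(\<lambda>n. taylor f (Suc n) * ?a (Suc n)) sums deriv f w"
      unfolding taylor_deriv[OF f] by (simp add: mult_ac)
    then show "(\<lambda>n. taylor f n * ?a n) sums deriv f w" by (subst (asm) sums_Suc_iff) simp
  next
    \<comment> \<open>Differentiating the series with coefficients \<open>n + 1\<close> gives the
      terms \<open>(n + 2) * (n + 1) * cmod w ^ n\<close>, which are the required ones at index
      \<open>Suc n\<close>.\<close>
    have 1: "summable (\<lambda>n. real (n + 1) * x ^ n)" if "norm x < 1" for x :: real
      using geometric_deriv_sums[OF that] by (simp add: sums_iff)
    have "summable (\<lambda>n. diffs (\<lambda>n. real (n + 1)) n * cmod w ^ n)"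
      by (rule termdiff_converges[of "cmod w" 1]) (use 1 w in \<open>auto simp: disk_iff\<close>)
    then have "summable (\<lambda>n. real (Suc n + 1) * cmod (?a (Suc n)))"
      by (simp add: diffs_def norm_mult norm_power mult_ac del: of_nat_Suc)
    then show "summable (\<lambda>n. real (n + 1) * cmod (?a n))" by (subst (asm) summable_Suc_iff)
  qed
next
  fix f g assume fg: "f \<in> bergman" "g \<in> bergman"
  show "deriv (\<lambda>z. f z + g z) w = deriv f w + deriv g w"
    using w fg[THEN bergmanD(1)] by (intro deriv_add field_differentiable_disk)
next
  fix f c assume f: "f \<in> bergman"
  show "deriv (\<lambda>z. c * f z) w = c * deriv f w"
    using w bergmanD(1)[OF f] by (intro deriv_cmult field_differentiable_disk)
next
  fix f g :: "complex \<Rightarrow> complex" assume "\<forall>z\<in>disk. f z = g z"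
  then show "deriv f w = deriv g w" using w by (intro deriv_cong_disk) auto
qed

lemma taylor_mult_eq_0:
  assumes "f holomorphic_on disk" "g holomorphic_on disk" "\<And>k. k < m \<Longrightarrow> taylor g k = 0" "n < m"
  shows "taylor (\<lambda>z. f z * g z) n = 0"
  by (subst taylor_eqI_fps[OF has_fps_expansion_mult[OF assms(1,2)[THEN has_fps_expansion_taylor]]])
    (use assms(3,4) in \<open>auto simp: fps_mult_nth intro!: sum.neutral\<close>)

lemma taylor_power: "taylor (\<lambda>z. z ^ m) n = (if n = m then 1 else 0)"
  by (subst taylor_eqI_fps[OF has_fps_expansion_fps_X_power]) (simp add: fps_X_power_nth)

lemma toeplitz_ode_add:
  assumes "F holomorphic_on disk" "G holomorphic_on disk" "z \<in> disk"
  shows "toeplitz_ode p (\<lambda>z. F z + c * G z) z = toeplitz_ode p F z + c * toeplitz_ode p G z"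
proof -
  have "deriv (\<lambda>z. F z + c * G z) z = deriv F z + c * deriv G z"
    using assms by (subst deriv_add deriv_cmult | intro field_differentiable_disk holomorphic_intros | simp)+
  then show ?thesis by (simp add: toeplitz_ode_def algebra_simps)
qed

lemma dirichlet_add_cmult:
  assumes "F \<in> dirichlet" "G \<in> dirichlet"
  shows "(\<lambda>z. F z + c * G z) \<in> dirichlet"
proof -
  have d0: "deriv (\<lambda>_. - c) = (\<lambda>_. 0)" by auto
  have "(\<lambda>z. - c * G z) \<in> dirichlet"
    by (rule dirichlet_mult(1)[OF assms(2), where B = "cmod c"]) (auto simp: d0)
  from dirichlet_diff[OF assms(1) this] show ?thesis by simp
qed

text \<open>A zero of \<open>1 + z p\<close> at \<open>z1\<close> together with a second one (at another point, or at \<open>z1\<close> itself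
  with \<open>e2\<close> the derivative there) gives two functionals that vanish on \<open>(1 + z p) G'\<close>.
  With the first \<open>m\<close> Taylor coefficients this makes \<open>m + 2\<close> functionals; some nontrivial
  combination kills the images of \<open>1, z, \<dots>, z\<^sup>m\<close>, hence, up to the small remainder \<open>p R\<close> where
  \<open>R\<close> is the Taylor tail of \<open>G\<close>, the whole range.\<close>

lemma not_invertible_two_zeros:
  assumes p: "p holomorphic_on disk" and M: "\<And>z. z \<in> disk \<Longrightarrow> cmod (p z) \<le> M"
    and surj: "\<forall>g\<in>bergman. \<exists>G\<in>dirichlet. \<forall>z\<in>disk. toeplitz_ode p G z = g z"
    and C: "\<forall>G\<in>dirichlet. L2_norm_disk (dirichlet_lift G) \<le> C * L2_norm_disk (toeplitz_ode p G)"
    and z1: "z1 \<in> disk" "1 + z1 * p z1 = 0"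
    and e2: "bergman_functional e2" "\<And>w. w holomorphic_on disk \<Longrightarrow> e2 (\<lambda>z. (1 + z * p z) * w z) = 0"
      "\<And>m. e2 (\<lambda>z. z ^ m * (z - z1)) \<noteq> 0"
  shows False
proof -
  have z1nz: "z1 \<noteq> 0" using z1(2) by auto
  have M0: "0 \<le> M" using order_trans[OF norm_ge_zero M[OF zero_in_disk]] .
  \<comment> \<open>Makes the contraction factor \<open>M * \<bar>C\<bar> / (m + 2)\<close> in
    \<open>step\<close> at most \<open>1 / 2\<close>.\<close>
  obtain m :: nat where m: "2 * (M * \<bar>C\<bar>) \<le> real m" using real_arch_simple by blast
  \<comment> \<open>Indices run from 0 to \<open>m + 1\<close>. All these functionals vanish on
    \<open>(1 + z p) R'\<close> as soon as the first \<open>m\<close> coefficients of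
    \<open>R'\<close> do.\<close>
  define ev where "ev = (\<lambda>i f. if i < m then taylor f i else if i = m then f z1 else e2 f)"
  have evf: "bergman_functional (ev i)" for i
    using bergman_functional_taylor[of i] bergman_functional_eval[OF z1(1)] e2(1)
    by (cases i m rule: linorder_cases) (auto simp: ev_def[abs_def])
  have "\<exists>c. (\<exists>i\<in>{..m+1}. c i \<noteq> 0) \<and> (\<forall>j\<in>{..m}. (\<Sum>i\<in>{..m+1}. c i * ev i (toeplitz_ode p (\<lambda>z. z ^ j))) = 0)"
    by (rule homogeneous_system_nontrivial_solution) auto
  then obtain c where c: "\<exists>i\<le>m+1. c i \<noteq> 0"
    "\<And>j. j \<le> m \<Longrightarrow> (\<Sum>i\<le>m+1. c i * ev i (toeplitz_ode p (\<lambda>z. z ^ j))) = 0" by auto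
  define L where "L = (\<lambda>f. \<Sum>i\<le>m+1. c i * ev i f)"
  have Lf: "bergman_functional L" unfolding L_def by (rule bergman_functional_sum) (auto intro: evf)
  note L = bergman_functionalD[OF Lf]
  have pow: "(\<lambda>z. z ^ j) \<in> dirichlet" for j using dirichlet_polynomial_power[of 0 j] by simp
  note odeb = toeplitz_ode_bergman[OF p M]
  have poly: "(\<lambda>z. \<Sum>j<k. t j * z ^ j) \<in> dirichlet \<and> L (toeplitz_ode p (\<lambda>z. \<Sum>j<k. t j * z ^ j)) = 0"
    if "k \<le> m + 1" for k t
    using that
  proof (induction k)
    case 0
    have 0: "(\<lambda>z. 0) \<in> bergman" by (rule bergman_bounded[of _ 0]) auto
    have d0: "deriv (\<lambda>_::complex. 0::complex) = (\<lambda>_. 0)" by auto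
    have "L (toeplitz_ode p (\<lambda>z. 0)) = L (\<lambda>z. 0 * (0::complex))"
      by (rule L(3)) (simp add: toeplitz_ode_def d0)
    also have "\<dots> = 0" using L(2)[OF 0, of 0] by simp
    finally show ?case using 0 by (simp add: dirichlet_def d0)
  next
    case (Suc k)
    let ?T = "\<lambda>z. \<Sum>j<k. t j * z ^ j"
    have T: "?T \<in> dirichlet" "L (toeplitz_ode p ?T) = 0" using Suc by auto
    have eq: "(\<lambda>z. \<Sum>j<Suc k. t j * z ^ j) = (\<lambda>z. ?T z + t k * z ^ k)" by simp
    have "L (toeplitz_ode p (\<lambda>z. ?T z + t k * z ^ k))
        = L (\<lambda>z. toeplitz_ode p ?T z + t k * toeplitz_ode p (\<lambda>z. z ^ k) z)"
      by (rule L(3)) (rule toeplitz_ode_add[OF dirichletD(3)[OF T(1)] dirichletD(3)[OF pow]])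
    also have "\<dots> = L (toeplitz_ode p ?T) + t k * L (toeplitz_ode p (\<lambda>z. z ^ k))"
      using odeb[OF _ T(1)] odeb[OF _ pow[of k]] by (simp add: L(1,2) bergman_cmult)
    also have "\<dots> = 0" using T(2) c(2)[of k] Suc.prems by (simp add: L_def)
    finally show ?case unfolding eq using dirichlet_add_cmult[OF T(1) pow] by blast
  qed
  \<comment> \<open>Surjectivity writes \<open>g\<close> as the image of some \<open>G\<close>.
    \<open>L\<close> kills the image of its Taylor polynomial \<open>T\<close> and the term with
    \<open>deriv R\<close>, so \<open>g\<close> may be replaced by \<open>p z * R z\<close>, of at
    most half the norm.\<close>
  have step: "\<exists>g'\<in>bergman. L g = L g' \<and> L2_norm_disk g' \<le> L2_norm_disk g / 2" if g: "g \<in> bergman" for g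
  proof -
    obtain G where G: "G \<in> dirichlet" "\<And>z. z \<in> disk \<Longrightarrow> toeplitz_ode p G z = g z" using surj g by blast
    note Gd = dirichletD[OF G(1)]
    define T where "T = (\<lambda>z. \<Sum>j<m+1. taylor G j * z ^ j)"
    have T: "T \<in> dirichlet" "L (toeplitz_ode p T) = 0" using poly[of "m+1" "taylor G"] by (auto simp: T_def)
    define R where "R = (\<lambda>z. G z - T z)"
    have R: "R \<in> dirichlet" unfolding R_def using G(1) T(1) by (rule dirichlet_diff)
    note Rd = dirichletD[OF R]
    have tT: "taylor T k = (if k < m + 1 then taylor G k else 0)" for k
    proof -
      have "taylor (\<lambda>z. \<Sum>j<n. taylor G j * z ^ j) k = (if k < n then taylor G k else 0)" for n
      proof (induction n)
        case 0
        show ?case by (subst taylor_eqI_fps[of _ 0]) auto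
      next
        case (Suc n)
        have "taylor (\<lambda>z. (\<Sum>j<n. taylor G j * z ^ j) + taylor G n * z ^ n) k
            = (if k < n then taylor G k else 0) + taylor G n * (if k = n then 1 else 0)"
          by (subst taylor_add taylor_cmult | intro holomorphic_intros)+ (simp add: taylor_power Suc.IH)
        then show ?case by (auto simp: less_Suc_eq)
      qed
      then show ?thesis unfolding T_def .
    qed
    have tR: "taylor R k = (if k < m + 1 then 0 else taylor G k)" for k
      unfolding R_def by (subst taylor_diff[OF Gd(3) dirichletD(3)[OF T(1)]]) (simp add: tT)
    have dR0: "taylor (deriv R) k = 0" if "k < m" for k
      unfolding taylor_deriv[OF Rd(3)] tR using that by simp
    have hq: "(\<lambda>z. 1 + z * p z) holomorphic_on disk" using p by (intro holomorphic_intros)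
    have "ev i (\<lambda>z. (1 + z * p z) * deriv R z) = 0" for i
      using taylor_mult_eq_0[OF hq Rd(4) dR0, of m i] z1(2) e2(2)[OF Rd(4)] by (auto simp: ev_def)
    then have LqR: "L (\<lambda>z. (1 + z * p z) * deriv R z) = 0" by (simp add: L_def)
    have pR: "(\<lambda>z. p z * R z) \<in> bergman" "L2_norm_disk (\<lambda>z. p z * R z) \<le> M * L2_norm_disk R"
      using bergman_mult[OF Rd(1) p M] by auto
    have odeR: "toeplitz_ode p R \<in> bergman" by (rule odeb[OF _ R])
    have qR: "(\<lambda>z. (1 + z * p z) * deriv R z) \<in> bergman"
      using bergman_diff[OF odeR pR(1)] by (simp add: toeplitz_ode_def)
    have odeT: "toeplitz_ode p T \<in> bergman" by (rule odeb[OF _ T(1)])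
    have "L g = L (\<lambda>z. toeplitz_ode p T z + ((1 + z * p z) * deriv R z + p z * R z))"
    proof (rule L(3))
      fix z assume z: "z \<in> disk"
      have a: "toeplitz_ode p (\<lambda>z. T z + 1 * R z) z = toeplitz_ode p T z + 1 * toeplitz_ode p R z"
        by (rule toeplitz_ode_add[OF dirichletD(3)[OF T(1)] Rd(3) z])
      have b: "(\<lambda>z. T z + 1 * R z) = G" by (simp add: R_def)
      show "g z = toeplitz_ode p T z + ((1 + z * p z) * deriv R z + p z * R z)"
        using a G(2)[OF z] unfolding b by (simp add: toeplitz_ode_def[of p R])
    qed
    also have "\<dots> = L (\<lambda>z. p z * R z)"
      using L(1)[OF odeT bergman_add(1)[OF qR pR(1)]] L(1)[OF qR pR(1)] T(2) LqR by simp
    finally have Lg: "L g = L (\<lambda>z. p z * R z)" .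
    \<comment> \<open>\<open>R\<close> starts in degree \<open>m + 1\<close>, where the coefficients
      of \<open>G\<close> are those of \<open>dirichlet_lift G\<close> divided by at least
      \<open>m + 2\<close>.\<close>
    have "L2_norm_disk R \<le> L2_norm_disk (dirichlet_lift G) / real (m + 2)"
    proof (rule bergman_taylor_le(2)[OF Rd(3)])
      let ?u = "\<lambda>k. (cmod (taylor (dirichlet_lift G) k))\<^sup>2 / real (k + 1)"
      note us = bergman_norm_sums[OF dirichlet_lift_bergman(1)[OF G(1)]]
      have tl: "taylor (dirichlet_lift G) k = of_nat (Suc k) * taylor G k" for k
        using taylor_add_mult_deriv[OF Gd(3)] by (simp add: dirichlet_lift_def[abs_def])
      show "(cmod (taylor R k))\<^sup>2 / real (k + 1) \<le> (1 / real (m + 2))\<^sup>2 * ?u k" for k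
      proof (cases "k < m + 1")
        case False
        then have "1 \<le> real (Suc k) / real (m + 2)" by simp
        then have "1 * cmod (taylor G k) \<le> real (Suc k) / real (m + 2) * cmod (taylor G k)"
          by (intro mult_right_mono) auto
        then have "cmod (taylor G k) \<le> 1 / real (m + 2) * cmod (taylor (dirichlet_lift G) k)"
          unfolding tl norm_mult norm_of_nat by simp
        then have "(cmod (taylor G k))\<^sup>2 / real (k + 1) \<le> (1 / real (m + 2) * cmod (taylor (dirichlet_lift G) k))\<^sup>2 / real (k + 1)"
          by (intro divide_right_mono power_mono) auto
        then show ?thesis unfolding tR using False by (simp add: power_mult_distrib power_divide add_ac)
      qed (simp add: tR)
      show "summable (\<lambda>k. (1 / real (m + 2))\<^sup>2 * ?u k)" by (rule summable_mult[OF sums_summable[OF us]])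
      show "(\<Sum>k. (1 / real (m + 2))\<^sup>2 * ?u k) \<le> (L2_norm_disk (dirichlet_lift G) / real (m + 2))\<^sup>2"
        unfolding suminf_mult[OF sums_summable[OF us]] sums_unique[OF us, symmetric] by (simp add: power_divide)
    qed simp
    then have "M * L2_norm_disk R \<le> M * (L2_norm_disk (dirichlet_lift G) / real (m + 2))"
      using M0 by (intro mult_left_mono)
    also have "\<dots> \<le> M * (\<bar>C\<bar> * L2_norm_disk g / real (m + 2))"
    proof (intro mult_left_mono divide_right_mono M0)
      have "L2_norm_disk (dirichlet_lift G) \<le> C * L2_norm_disk (toeplitz_ode p G)" using C G(1) by blast
      also have "L2_norm_disk (toeplitz_ode p G) = L2_norm_disk g" using G(2) by (rule L2_norm_disk_cong)
      also have "C * L2_norm_disk g \<le> \<bar>C\<bar> * L2_norm_disk g" by (intro mult_right_mono) auto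
      finally show "L2_norm_disk (dirichlet_lift G) \<le> \<bar>C\<bar> * L2_norm_disk g" .
    qed simp
    also have "\<dots> = (M * \<bar>C\<bar> / real (m + 2)) * L2_norm_disk g" by simp
    also have "\<dots> \<le> (1 / 2) * L2_norm_disk g"
      using m by (intro mult_right_mono) (auto simp: field_simps)
    finally have "L2_norm_disk (\<lambda>z. p z * R z) \<le> L2_norm_disk g / 2" using pR(2) by linarith
    with Lg pR(1) show ?thesis by blast
  qed
  obtain N where N: "0 \<le> N" "\<And>f. f \<in> bergman \<Longrightarrow> cmod (L f) \<le> N * L2_norm_disk f" using L(4) by blast
  have iter: "\<forall>g\<in>bergman. cmod (L g) \<le> N * L2_norm_disk g * (1 / 2) ^ k" for k
  proof (induction k)
    case (Suc k)
    show ?case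
    proof
      fix g assume "g \<in> bergman"
      from step[OF this] obtain g' where g': "g' \<in> bergman" "L g = L g'" "L2_norm_disk g' \<le> L2_norm_disk g / 2"
        by blast
      have "cmod (L g) \<le> N * L2_norm_disk g' * (1 / 2) ^ k" using Suc g' by simp
      also have "\<dots> \<le> N * (L2_norm_disk g / 2) * (1 / 2) ^ k"
        using g'(3) N(1) by (intro mult_right_mono mult_left_mono) auto
      finally show "cmod (L g) \<le> N * L2_norm_disk g * (1 / 2) ^ Suc k" by simp
    qed
  qed (use N in simp)
  have L0: "L g = 0" if "g \<in> bergman" for g
  proof -
    have "(\<lambda>k. N * L2_norm_disk g * (1 / 2) ^ k) \<longlonglongrightarrow> N * L2_norm_disk g * 0"
      by (intro tendsto_mult_left LIMSEQ_power_zero) simp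
    then have "cmod (L g) \<le> N * L2_norm_disk g * 0"
      by (rule LIMSEQ_le_const) (use iter that in blast)
    then show ?thesis by simp
  qed
  have Lsplit: "L f = (\<Sum>i<m. c i * taylor f i) + c m * f z1 + c (m + 1) * e2 f" for f
    by (simp add: L_def ev_def lessThan_Suc_atMost[symmetric])
  have powb: "(\<lambda>z. z ^ j) \<in> bergman" for j using pow dirichletD(1) by blast
  \<comment> \<open>The test functions are taken in triangular order:
    \<open>z ^ m * (z - z1)\<close> is seen by \<open>e2\<close> alone; then \<open>z ^ m\<close>
    only by evaluation at the nonzero point \<open>z1\<close>; then each \<open>z ^ i\<close> only
    by its own coefficient.\<close>
  have c1: "c (m + 1) = 0"
  proof -
    let ?f = "\<lambda>z. z ^ m * (z - z1)"
    have "(\<lambda>z. z ^ Suc m - z1 * z ^ m) \<in> bergman" by (intro bergman_diff bergman_cmult powb)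
    moreover have "?f = (\<lambda>z. z ^ Suc m - z1 * z ^ m)" by (auto simp: algebra_simps)
    ultimately have fb: "?f \<in> bergman" by simp
    have "taylor ?f i = 0" if "i < m" for i
      using that by (subst taylor_power_mult) (auto intro!: holomorphic_intros)
    then show ?thesis using L0[OF fb] e2(3)[of m] unfolding Lsplit by simp
  qed
  have c2: "c m = 0"
    using L0[OF powb[of m]] z1nz c1 unfolding Lsplit by (simp add: taylor_power)
  have "c i = 0" if "i < m" for i
  proof -
    have "(\<Sum>k<m. c k * (if k = i then 1 else 0)) = 0"
      using L0[OF powb[of i]] c1 c2 unfolding Lsplit by (simp add: taylor_power)
    then show ?thesis using that by (simp add: if_distrib cong: if_cong)
  qed
  with c1 c2 c(1) show False by (metis Suc_eq_plus1 le_Suc_eq le_neq_implies_less)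
qed


section \<open>The invertibility criterion\<close>

text \<open>The difference quotient of \<open>q\<close> at \<open>z0\<close> is continuous up to the
  circle and zero-free, simplicity of the zero settling the point \<open>z0\<close> itself;
  compactness of the closed disk provides \<open>d\<close> and \<open>D\<close>.\<close>

lemma simple_zero_factor:
  assumes q: "q holomorphic_on disk" "continuous_on (cball 0 1) q"
    and z0: "z0 \<in> disk" "deriv q z0 \<noteq> 0" and zero: "\<And>z. z \<in> cball 0 1 \<Longrightarrow> q z = 0 \<longleftrightarrow> z = z0"
  obtains q1 d D where "q1 holomorphic_on disk" "\<And>z. z \<in> disk \<Longrightarrow> q z = (z - z0) * q1 z"
    "q1 z0 = deriv q z0" "0 < d" "\<And>z. z \<in> disk \<Longrightarrow> d \<le> cmod (q1 z)" "\<And>z. z \<in> disk \<Longrightarrow> cmod (q1 z) \<le> D"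
proof -
  have dc: "disk \<subseteq> cball 0 1" by (auto simp: disk_iff)
  have q0: "q z0 = 0" using zero[of z0] z0 dc by blast
  define q1 where "q1 = (\<lambda>z. if z = z0 then deriv q z0 else (q z - q z0) / (z - z0))"
  have h: "q1 holomorphic_on disk" unfolding q1_def using q(1) by (rule pole_lemma_open) simp
  have eq: "q z = (z - z0) * q1 z" for z by (simp add: q1_def q0)
  have c: "continuous_on (cball 0 1) q1"
    unfolding continuous_on_eq_continuous_within
  proof
    fix z :: complex assume z: "z \<in> cball 0 1"
    show "continuous (at z within cball 0 1) q1"
    proof (cases "z = z0")
      case True
      then have "isCont q1 z"
        using h z0(1) by (metis continuous_on_eq_continuous_at holomorphic_on_imp_continuous_on open_disk)
      then show ?thesis by (rule continuous_at_imp_continuous_at_within)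
    next
      case False
      have cq: "continuous (at z within cball 0 1) q"
        using q(2) z by (simp add: continuous_on_eq_continuous_within)
      have "continuous (at z within cball 0 1) (\<lambda>z. (q z - q z0) / (z - z0))"
        using False by (intro continuous_intros cq) auto
      then show ?thesis
        by (rule continuous_transform_within[where \<delta> = "dist z z0"])
          (use False z in \<open>auto simp: q1_def dist_commute\<close>)
    qed
  qed
  have nz: "q1 z \<noteq> 0" if "z \<in> cball 0 1" for z
    using eq[of z] zero[OF that] z0(2) by (cases "z = z0") (auto simp: q1_def)
  have ne: "cball (0::complex) 1 \<noteq> {}" by simp
  have cn: "continuous_on (cball 0 1) (\<lambda>z. cmod (q1 z))" using c by (rule continuous_on_norm)
  obtain x where x: "x \<in> cball 0 1" "\<forall>y\<in>cball 0 1. cmod (q1 x) \<le> cmod (q1 y)"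
    using continuous_attains_inf[OF compact_cball ne cn] by blast
  obtain y where y: "y \<in> cball 0 1" "\<forall>z\<in>cball 0 1. cmod (q1 z) \<le> cmod (q1 y)"
    using continuous_attains_sup[OF compact_cball ne cn] by blast
  show ?thesis
  proof (rule that[of q1 "cmod (q1 x)" "cmod (q1 y)"])
    show "q1 holomorphic_on disk" by (rule h)
    show "q z = (z - z0) * q1 z" for z by (rule eq)
    show "q1 z0 = deriv q z0" by (simp add: q1_def)
    show "0 < cmod (q1 x)" using nz[OF x(1)] by simp
    show "cmod (q1 x) \<le> cmod (q1 z)" "cmod (q1 z) \<le> cmod (q1 y)" if "z \<in> disk" for z
      using x y that dc by blast+
  qed
qed

text \<open>Here \<open>p1\<close> stands for \<open>p'\<close> and \<open>d\<close> for the
  derivative of \<open>1 + z p\<close>, both at \<open>z0\<close>. Multiplying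
  \<open>- p0 = (k + 1) * d\<close> by \<open>z0\<close> and using \<open>z0 * p0 = - 1\<close>
  gives \<open>1 = (k + 1) * (z0\<^sup>2 * p1 - 1)\<close>.\<close>

lemma resonance_iff:
  fixes z0 p0 p1 d :: complex
  assumes "1 + z0 * p0 = 0" "d = p0 + z0 * p1" "d \<noteq> 0"
  shows "- (p0 / d) = of_nat (Suc k) \<longleftrightarrow> z0\<^sup>2 * p1 - of_nat (k + 2) / of_nat (k + 1) = 0"
proof -
  have z0: "z0 \<noteq> 0" and zp: "z0 * p0 = - 1" using assms(1) by (auto simp: add_eq_0_iff)
  have n: "of_nat (k + 1) \<noteq> (0 :: complex)" by (metis of_nat_eq_0_iff Suc_eq_plus1 nat.distinct(1))
  have "- (p0 / d) = of_nat (Suc k) \<longleftrightarrow> - p0 = of_nat (k + 1) * d"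
    using assms(3) by (simp add: field_simps)
  also have "\<dots> \<longleftrightarrow> z0 * (- p0) = z0 * (of_nat (k + 1) * d)" using z0 by (simp only: mult_cancel_left) simp
  also have "z0 * (- p0) = 1" using zp by simp
  also have "z0 * (of_nat (k + 1) * d) = of_nat (k + 1) * (z0 * p0 + z0\<^sup>2 * p1)"
    unfolding assms(2) by (simp add: algebra_simps power2_eq_square)
  also have "1 = of_nat (k + 1) * (z0 * p0 + z0\<^sup>2 * p1) \<longleftrightarrow> of_nat (k + 1) * (z0\<^sup>2 * p1) = of_nat (k + 2)"
    unfolding zp by (auto simp: algebra_simps)
  also have "\<dots> \<longleftrightarrow> z0\<^sup>2 * p1 - of_nat (k + 2) / of_nat (k + 1) = 0"
    using n by (auto simp: field_simps simp del: of_nat_add)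
  finally show ?thesis .
qed

theorem theorem2p5:
  fixes p :: "complex \<Rightarrow> complex"
  assumes "p holomorphic_on ball 0 1" and "continuous_on (cball 0 1) p"
  shows "toeplitz_invertible (\<lambda>z. cnj z + p z) \<longleftrightarrow>
    ((\<forall>z. cmod z = 1 \<longrightarrow> 1 + z * p z \<noteq> 0) \<and>
     (\<exists>z0. {z \<in> ball 0 1. 1 + z * p z = 0} = {z0} \<and>
           deriv (\<lambda>z. 1 + z * p z) z0 \<noteq> 0 \<and>
           (\<forall>n::nat. z0\<^sup>2 * deriv p z0 - of_nat (n + 2) / of_nat (n + 1) \<noteq> 0)))"
proof -
  have dc: "disk \<subseteq> cball 0 1" by (auto simp: disk_iff)
  have p: "p holomorphic_on disk" using assms(1) by (simp add: disk_def)
  obtain M where M': "\<And>z. z \<in> cball 0 1 \<Longrightarrow> cmod (p z) \<le> M"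
    using compact_imp_bounded[OF compact_continuous_image[OF assms(2) compact_cball]] bounded_iff
    by (metis imageI)
  then have M: "\<And>z. z \<in> disk \<Longrightarrow> cmod (p z) \<le> M" using dc by blast
  define q where "q = (\<lambda>z. 1 + z * p z)"
  have hq: "q holomorphic_on disk" unfolding q_def using p by (intro holomorphic_intros)
  have cq: "continuous_on (cball 0 1) q" unfolding q_def using assms(2) by (intro continuous_intros)
  have dq: "deriv q z = p z + z * deriv p z" if "z \<in> disk" for z
  proof -
    have "(p has_field_derivative deriv p z) (at z)"
      using field_differentiable_disk[OF p that] by (simp add: DERIV_deriv_iff_field_differentiable)
    then show ?thesis unfolding q_def by (intro DERIV_imp_deriv) (auto intro!: derivative_eq_intros)
  qed
  have iff: "toeplitz_invertible (\<lambda>z. cnj z + p z) \<longleftrightarrow>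
    (\<forall>g\<in>bergman. \<exists>G\<in>dirichlet. \<forall>z\<in>disk. toeplitz_ode p G z = g z) \<and>
    (\<exists>C. \<forall>G\<in>dirichlet. L2_norm_disk (dirichlet_lift G) \<le> C * L2_norm_disk (toeplitz_ode p G))"
    using p M by (rule toeplitz_invertible_iff_ode)
  show ?thesis
  proof
    assume inv: "toeplitz_invertible (\<lambda>z. cnj z + p z)"
    with iff obtain C where surj: "\<forall>g\<in>bergman. \<exists>G\<in>dirichlet. \<forall>z\<in>disk. toeplitz_ode p G z = g z"
      and C: "\<forall>G\<in>dirichlet. L2_norm_disk (dirichlet_lift G) \<le> C * L2_norm_disk (toeplitz_ode p G)" by blast
    have circle: "q z \<noteq> 0" if z: "cmod z = 1" for z
    proof
      assume "q z = 0"
      let ?phi = "\<lambda>z. cnj z + p z"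
      have cphi: "continuous_on (cball 0 1) ?phi" using assms(2) by (intro continuous_intros)
      \<comment> \<open>On the circle \<open>cnj z * z = 1\<close>, so the symbol vanishes exactly
        where \<open>q\<close> does.\<close>
      have "?phi z = cnj z * q z"
        using z complex_norm_square[of z] by (simp add: q_def algebra_simps flip: mult.assoc)
      with \<open>q z = 0\<close> have phi0: "?phi z = 0" by simp
      show False
      proof (rule not_bounded_below_if_boundary_zero[OF cphi z phi0, of "\<bar>C\<bar>"])
        fix f assume f: "f \<in> bergman"
        obtain G where G: "G \<in> dirichlet" "\<And>z. z \<in> disk \<Longrightarrow> f z = dirichlet_lift G z"
          by (rule bergman_eq_dirichlet_lift[OF f]) (rule that; assumption)
        have "is_toeplitz_image ?phi f (toeplitz_ode p G)"
          using is_toeplitz_image_iff[OF p M G(1) f G(2)] toeplitz_ode_bergman[OF p M G(1)] by simp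
        then have proj: "is_bergman_proj (\<lambda>z. ?phi z * f z) (toeplitz_ode p G)"
          by (simp add: is_toeplitz_image_def)
        have cont: "continuous_on disk (\<lambda>z. ?phi z * f z)"
          using continuous_on_subset[OF cphi dc] bergmanD(2)[OF f] by (rule continuous_on_mult)
        have sq: "set_integrable lborel disk (\<lambda>z. (cmod (?phi z * f z))\<^sup>2)"
        proof (rule L2_norm_disk_mono(1)[OF bergmanD(3)[OF f] cont])
          show "cmod (?phi z * f z) \<le> (1 + M) * cmod (f z)" if "z \<in> disk" for z
            unfolding norm_mult using norm_triangle_ineq[of "cnj z" "p z"] M[OF that] that
            by (intro mult_right_mono) (auto simp: disk_iff)
          show "0 \<le> 1 + M" using order_trans[OF norm_ge_zero M[OF zero_in_disk]] by simp
        qed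
        have "L2_norm_disk f = L2_norm_disk (dirichlet_lift G)" using G(2) by (rule L2_norm_disk_cong)
        also have "\<dots> \<le> C * L2_norm_disk (toeplitz_ode p G)" using C G(1) by blast
        \<comment> \<open>The projection is contractive, so the bound passes from the operator to
          multiplication by the symbol; the absolute value is taken because \<open>C\<close> is not
          known to be nonnegative.\<close>
        also have "\<dots> \<le> \<bar>C\<bar> * L2_norm_disk (\<lambda>z. ?phi z * f z)"
          by (intro mult_mono bergman_proj_norm_le[OF cont sq proj]) auto
        finally show "L2_norm_disk f \<le> \<bar>C\<bar> * L2_norm_disk (\<lambda>z. ?phi z * f z)" .
      qed simp
    qed
    \<comment> \<open>Otherwise \<open>q\<close> has a positive minimum modulus on the closed disk,
      and the operator has a kernel.\<close>
    have "\<exists>z0\<in>disk. q z0 = 0"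
    proof (rule ccontr)
      assume "\<not> (\<exists>z0\<in>disk. q z0 = 0)"
      then have nz: "q z \<noteq> 0" if "z \<in> cball 0 1" for z
        using circle[of z] that by (cases "cmod z = 1") (auto simp: disk_iff)
      have cn: "continuous_on (cball 0 1) (\<lambda>z. cmod (q z))" using cq by (rule continuous_on_norm)
      obtain x where x: "x \<in> cball 0 1" "\<forall>y\<in>cball 0 1. cmod (q x) \<le> cmod (q y)"
        using continuous_attains_inf[OF compact_cball _ cn] by auto
      show False
      proof (rule not_injective_if_no_zeros[OF p M C])
        show "0 < cmod (q x)" using nz[OF x(1)] by simp
        show "cmod (q x) \<le> cmod (1 + z * p z)" if "z \<in> disk" for z
          using x(2) that dc by (auto simp: q_def)
      qed
    qed
    then obtain z0 where z0: "z0 \<in> disk" "q z0 = 0" by blast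
    have z0nz: "z0 \<noteq> 0" using z0(2) by (auto simp: q_def)
    \<comment> \<open>Left open in the second functional: evaluation at another zero will give
      uniqueness, the derivative at \<open>z0\<close> will give simplicity.\<close>
    note two = not_invertible_two_zeros[OF p M surj C z0(1) z0(2)[unfolded q_def]]
    have uniq: "z = z0" if z: "z \<in> disk" "q z = 0" for z
    proof (rule ccontr)
      assume "z \<noteq> z0"
      moreover have "z \<noteq> 0" using z(2) by (auto simp: q_def)
      ultimately show False
        using z by (intro two[where ?e2.0 = "\<lambda>f. f z"] bergman_functional_eval) (auto simp: q_def)
    qed
    have simple: "deriv q z0 \<noteq> 0"
    proof
      assume d0: "deriv q z0 = 0"
      show False
      proof (rule two[where ?e2.0 = "\<lambda>f. deriv f z0"])
        show "bergman_functional (\<lambda>f. deriv f z0)" by (rule bergman_functional_deriv[OF z0(1)])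
        fix w assume w: "w holomorphic_on disk"
        have "deriv (\<lambda>z. q z * w z) z0 = q z0 * deriv w z0 + deriv q z0 * w z0"
          by (intro deriv_mult field_differentiable_disk hq w z0(1))
        then show "deriv (\<lambda>z. (1 + z * p z) * w z) z0 = 0" using d0 z0(2) by (simp add: q_def)
      next
        fix m
        have "((\<lambda>z. z ^ m * (z - z0)) has_field_derivative z0 ^ m) (at z0)"
          by (auto intro!: derivative_eq_intros)
        then have "deriv (\<lambda>z. z ^ m * (z - z0)) z0 = z0 ^ m" by (rule DERIV_imp_deriv)
        then show "deriv (\<lambda>z. z ^ m * (z - z0)) z0 \<noteq> 0" using z0nz by simp
      qed auto
    qed
    have zero: "q z = 0 \<longleftrightarrow> z = z0" if "z \<in> cball 0 1" for z
      using that circle[of z] uniq[of z] z0 by (cases "cmod z = 1") (auto simp: disk_iff)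
    obtain q1 d D where q1: "q1 holomorphic_on disk" "\<And>z. z \<in> disk \<Longrightarrow> q z = (z - z0) * q1 z"
      "q1 z0 = deriv q z0" "0 < d" "\<And>z. z \<in> disk \<Longrightarrow> d \<le> cmod (q1 z)" "\<And>z. z \<in> disk \<Longrightarrow> cmod (q1 z) \<le> D"
      by (rule simple_zero_factor[OF hq cq z0(1) simple zero]) (assumption | rule that)+
    have "z0\<^sup>2 * deriv p z0 - of_nat (n + 2) / of_nat (n + 1) \<noteq> 0" for n
    proof
      assume "z0\<^sup>2 * deriv p z0 - of_nat (n + 2) / of_nat (n + 1) = 0"
      then have "- (p z0 / deriv q z0) = of_nat (Suc n)"
        using resonance_iff[OF z0(2)[unfolded q_def] dq[OF z0(1)] simple] by blast
      then have "- (p z0 / q1 z0) = of_nat (Suc n)" by (simp only: q1(3))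
      from not_injective_if_resonant[OF p M C z0(1) q1(1) q1(2)[unfolded q_def] q1(4-6) this]
      show False by simp
    qed
    moreover have "{z \<in> ball 0 1. 1 + z * p z = 0} = {z0}"
    proof -
      have "{z \<in> disk. q z = 0} = {z0}" using uniq z0 by blast
      then show ?thesis by (simp only: q_def disk_def)
    qed
    ultimately have "(\<forall>z. cmod z = 1 \<longrightarrow> q z \<noteq> 0) \<and> ({z \<in> ball 0 1. 1 + z * p z = 0} = {z0} \<and>
        deriv q z0 \<noteq> 0 \<and> (\<forall>n::nat. z0\<^sup>2 * deriv p z0 - of_nat (n + 2) / of_nat (n + 1) \<noteq> 0))"
      using circle simple by (intro conjI allI impI)
    then show "(\<forall>z. cmod z = 1 \<longrightarrow> 1 + z * p z \<noteq> 0) \<and>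
     (\<exists>z0. {z \<in> ball 0 1. 1 + z * p z = 0} = {z0} \<and>
           deriv (\<lambda>z. 1 + z * p z) z0 \<noteq> 0 \<and>
           (\<forall>n::nat. z0\<^sup>2 * deriv p z0 - of_nat (n + 2) / of_nat (n + 1) \<noteq> 0))"
      unfolding q_def by (elim conjE) (intro conjI exI[of _ z0])
  next
    assume "(\<forall>z. cmod z = 1 \<longrightarrow> 1 + z * p z \<noteq> 0) \<and>
     (\<exists>z0. {z \<in> ball 0 1. 1 + z * p z = 0} = {z0} \<and>
           deriv (\<lambda>z. 1 + z * p z) z0 \<noteq> 0 \<and>
           (\<forall>n::nat. z0\<^sup>2 * deriv p z0 - of_nat (n + 2) / of_nat (n + 1) \<noteq> 0))"
    then obtain z0 where a: "\<forall>z. cmod z = 1 \<longrightarrow> q z \<noteq> 0" and zs: "{z \<in> disk. q z = 0} = {z0}"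
      and simple: "deriv q z0 \<noteq> 0"
      and b: "\<forall>n::nat. z0\<^sup>2 * deriv p z0 - of_nat (n + 2) / of_nat (n + 1) \<noteq> 0"
      unfolding q_def disk_def by (elim conjE exE)
    have circle: "q z \<noteq> 0" if "cmod z = 1" for z using a that by blast
    have nonres: "z0\<^sup>2 * deriv p z0 - of_nat (n + 2) / of_nat (n + 1) \<noteq> 0" for n using b by blast
    have z0: "z0 \<in> disk" "q z0 = 0" using zs by blast+
    have uniq: "z = z0" if "z \<in> disk" "q z = 0" for z using zs that by blast
    have zero: "q z = 0 \<longleftrightarrow> z = z0" if "z \<in> cball 0 1" for z
      using that circle[of z] uniq[of z] z0 by (cases "cmod z = 1") (auto simp: disk_iff)
    obtain q1 d D where q1: "q1 holomorphic_on disk" "\<And>z. z \<in> disk \<Longrightarrow> q z = (z - z0) * q1 z"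
      "q1 z0 = deriv q z0" "0 < d" "\<And>z. z \<in> disk \<Longrightarrow> d \<le> cmod (q1 z)" "\<And>z. z \<in> disk \<Longrightarrow> cmod (q1 z) \<le> D"
      by (rule simple_zero_factor[OF hq cq z0(1) simple zero]) (assumption | rule that)+
    \<comment> \<open>The value 0 is excluded by \<open>p z0 \<noteq> 0\<close>, and
      \<open>k + 1\<close> by the arithmetic condition at \<open>n = k\<close>.\<close>
    have l: "- (p z0 / q1 z0) \<noteq> of_nat n" for n
    proof (cases n)
      case 0
      have "p z0 \<noteq> 0" using z0(2) by (auto simp: q_def)
      then show ?thesis using 0 q1(3) simple by simp
    next
      case (Suc k)
      then show ?thesis
        using resonance_iff[OF z0(2)[unfolded q_def] dq[OF z0(1)] simple, of k] nonres[of k] q1(3) by metis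
    qed
    show "toeplitz_invertible (\<lambda>z. cnj z + p z)"
      by (rule invertible_if_nonresonant[OF p M z0(1) q1(1) q1(2)[unfolded q_def] q1(4-6) l])
  qed
qed

end
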